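(* Let $n,m\ge 1$ and $\alpha,\beta>0$, and let $s_{t_1,t_2}:(\mathbb{R}^n\times\mathbb{R}^m)\times(\mathbb{R}^n\times\mathbb{R}^m)\to\mathbb{C}$, $t_1,t_2>0$, be a family of kernels, measurable jointly in all variables. Suppose the following conditions hold, with implied constants independent of all the parameters involved. **(A) Standard estimates.** For all $t_1,t_2>0$ and $x=(x_1,x_2)$, $y=(y_1,y_2)$, $y'=(y_1',y_2')$ in $\mathbb{R}^n\times\mathbb{R}^m$: (A1) $$|s_{t_1,t_2}(x,y)|\lesssim \frac{t_1^{\alpha}}{(t_1+|x_1-y_1|)^{n+\alpha}}\,\frac{t_2^{\beta}}{(t_2+|x_2-y_2|)^{m+\beta}};$$ (A2) $$|s_{t_1,t_2}(x,y)-s_{t_1,t_2}(x,(y_1,y_2'))-s_{t_1,t_2}(x,(y_1',y_2))+s_{t_1,t_2}(x,y')|\lesssim \frac{|y_1-y_1'|^{\alpha}}{(t_1+|x_1-y_1|)^{n+\alpha}}\,\frac{|y_2-y_2'|^{\beta}}{(t_2+|x_2-y_2|)^{m+\beta}}$$ whenever $|y_1-y_1'|<t_1/2$ and $|y_2-y_2'|<t_2/2$; (A3) $$|s_{t_1,t_2}(x,y)-s_{t_1,t_2}(x,(y_1,y_2'))|\lesssim \frac{t_1^{\alpha}}{(t_1+|x_1-y_1|)^{n+\alpha}}\,\frac{|y_2-y_2'|^{\beta}}{(t_2+|x_2-y_2|)^{m+\beta}}$$ whenever $|y_2-y_2'|<t_2/2$, and $$|s_{t_1,t_2}(x,y)-s_{t_1,t_2}(x,(y_1',y_2))|\lesssim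 \frac{|y_1-y_1'|^{\alpha}}{(t_1+|x_1-y_1|)^{n+\alpha}}\,\frac{t_2^{\beta}}{(t_2+|x_2-y_2|)^{m+\beta}}$$ whenever $|y_1-y_1'|<t_1/2$. **(B) Strong Carleson $\times$ standard estimates.** For all cubes $I\subset\mathbb{R}^n$ and $J\subset\mathbb{R}^m$, with $\widehat I=I\times(0,\ell(I))$ and $\widehat J=J\times(0,\ell(J))$ (where $\ell$ is side length), and for all values of the remaining free variables: (B1) $$\Big(\iint_{\widehat I}\int_I|s_{t_1,t_2}(x_1,x_2,y_1,y_2)|^2\,dy_1\,\frac{dx_1dt_1}{t_1}\Big)^{1/2}\lesssim\frac{t_2^{\beta}}{(t_2+|x_2-y_2|)^{m+\beta}},$$ $$\Big(\iint_{\widehat J}\int_J|s_{t_1,t_2}(x_1,x_2,y_1,y_2)|^2\,dy_2\,\frac{dx_2dt_2}{t_2}\Big)^{1/2}\lesssim\frac{t_1^{\alpha}}{(t_1+|x_1-y_1|)^{n+\alpha}};$$ (B2) $$\Big(\iint_{\widehat I}\int_I|s_{t_1,t_2}(x_1,x_2,y_1,y_2)-s_{t_1,t_2}(x_1,x_2,y_1,y_2')|^2\,dy_1\,\frac{dx_1dt_1}{t_1}\Big)^{1/2}\lesssim\frac{|y_2-y_2'|^{\beta}}{(t_2+|x_2-y_2|)^{m+\beta}}$$ whenever $|y_2-y_2'|<t_2/2$, and $$\Big(\iint_{\widehat J}\int_J|s_{t_1,t_2}(x_1,x_2,y_1,y_2)-s_{t_1,t_2}(x_1,x_2,y_1',y_2)|^2\,dy_2\,\frac{dx_2dt_2}{t_2}\Big)^{1/2}\lesssim\frac{|y_1-y_1'|^{\alpha}}{(t_1+|x_1-y_1|)^{n+\alpha}}$$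 whenever $|y_1-y_1'|<t_1/2$. **(C) Bi-parameter Carleson condition.** For every $\mathcal D=\mathcal D_n\times\mathcal D_m$, where $\mathcal D_n$ is a dyadic grid in $\mathbb{R}^n$ and $\mathcal D_m$ is a dyadic grid in $\mathbb{R}^m$, put, for $I\in\mathcal D_n$, $J\in\mathcal D_m$, $W_I=I\times(\ell(I)/2,\ell(I))$, $W_J=J\times(\ell(J)/2,\ell(J))$ and $$C^{\mathcal D}_{IJ}=\iint_{W_J}\iint_{W_I}|\theta_{t_1,t_2}\mathbf 1(x_1,x_2)|^2\,\frac{dx_1dt_1}{t_1}\frac{dx_2dt_2}{t_2}.$$ Then $$\sum_{I\times J\in\mathcal D,\ I\times J\subset\Omega}C^{\mathcal D}_{IJ}\lesssim|\Omega|$$ for all sets $\Omega\subset\mathbb{R}^n\times\mathbb{R}^m$ such that $|\Omega|<\infty$ and such that for every $x\in\Omega$ there exists $I\times J\in\mathcal D$ with $x\in I\times J\subset\Omega$. Then $g$ is bounded on $L^p(\mathbb{R}^n\times\mathbb{R}^m)$ for all $1<p<2$.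
   Context: $A\lesssim B$ means $A\le CB$ for a constant $C$ independent of the relevant variables. $\mathbf 1$ is the constant function $1$. **Operators.** $$\theta_{t_1,t_2}f(x_1,x_2)=\iint_{\mathbb{R}^n\times\mathbb{R}^m}s_{t_1,t_2}(x_1,x_2,y_1,y_2)f(y_1,y_2)\,dy_1dy_2,$$ and the bi-parameter Littlewood–Paley square function is $$g(f)(x)=\Big(\int_0^\infty\int_0^\infty|\theta_{t_1,t_2}f(x_1,x_2)|^2\,\frac{dt_1}{t_1}\frac{dt_2}{t_2}\Big)^{1/2},\qquad x=(x_1,x_2)\in\mathbb{R}^n\times\mathbb{R}^m.$$ "$g$ is bounded on $L^p$" means that there is a constant $C$ such that $\|g(f)\|_{L^p}\le C\|f\|_{L^p}$ for all $f\in L^p(\mathbb{R}^n\times\mathbb{R}^m)$. *)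

theory Defs
  imports "HOL-Analysis.Analysis"
begin

text \<open>
  Euclidean n-space is \<^typ>\<open>real ^ 'n\<close>, with \<open>n = CARD('n)\<close>. Measure-theoretic notions are
  those of Lebesgue measure, and integrals of nonnegative quantities take values in
  \<^typ>\<open>ennreal\<close>, so that they make sense without any finiteness assumption. Values of kernels at
  nonpositive times never enter.
\<close>

type_synonym ('n, 'm) kernel =
  "real \<Rightarrow> real \<Rightarrow> (real^'n) \<times> (real^'m) \<Rightarrow> (real^'n) \<times> (real^'m) \<Rightarrow> complex"

text \<open>Real powers on \<open>[0, \<infinity>]\<close>; only exponents \<open>a > 0\<close> are used.\<close>

definition epowr :: "ennreal \<Rightarrow> real \<Rightarrow> ennreal" where
  "epowr u a = (if u = \<infinity> then \<infinity> else ennreal (enn2real u powr a))"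

definition eLp_norm :: "real \<Rightarrow> ('a::euclidean_space \<Rightarrow> ennreal) \<Rightarrow> ennreal" where
  "eLp_norm p F = epowr (\<integral>\<^sup>+x. epowr (F x) p \<partial>lebesgue) (1 / p)"

definition theta ::
  "('n::finite, 'm::finite) kernel \<Rightarrow> real \<Rightarrow> real \<Rightarrow>
   ((real^'n) \<times> (real^'m) \<Rightarrow> complex) \<Rightarrow> (real^'n) \<times> (real^'m) \<Rightarrow> complex" where
  "theta s t1 t2 f x = (\<integral>y. s t1 t2 x y * f y \<partial>lebesgue)"

definition square_function ::
  "('n::finite, 'm::finite) kernel \<Rightarrow> ((real^'n) \<times> (real^'m) \<Rightarrow> complex) \<Rightarrow>
   (real^'n) \<times> (real^'m) \<Rightarrow> ennreal" where
  "square_function s f x =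
     epowr (\<integral>\<^sup>+t2\<in>{0<..}. (\<integral>\<^sup>+t1\<in>{0<..}.
       ennreal ((cmod (theta s t1 t2 f x))\<^sup>2 / (t1 * t2)) \<partial>lebesgue) \<partial>lebesgue) (1 / 2)"

definition bounded_on_Lp ::
  "((('a::euclidean_space) \<Rightarrow> complex) \<Rightarrow> 'a \<Rightarrow> ennreal) \<Rightarrow> real \<Rightarrow> bool" where
  "bounded_on_Lp G p \<longleftrightarrow> (\<exists>C::real. \<forall>f.
     f \<in> borel_measurable lebesgue \<longrightarrow> eLp_norm p (\<lambda>x. ennreal (cmod (f x))) < \<infinity> \<longrightarrow>
       G f \<in> borel_measurable lebesgue \<and>
       eLp_norm p (G f) \<le> ennreal C * eLp_norm p (\<lambda>x. ennreal (cmod (f x))))"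

definition jointly_measurable :: "('n::finite, 'm::finite) kernel \<Rightarrow> bool" where
  "jointly_measurable s \<longleftrightarrow>
     (\<lambda>(t1, t2, x, y). s t1 t2 x y) \<in> borel_measurable (lebesgue_on ({0<..} \<times> {0<..} \<times> UNIV))"

text \<open>The one-parameter majorants of size and of Hoelder type.\<close>

definition size_bound :: "real \<Rightarrow> real \<Rightarrow> real^'n::finite \<Rightarrow> real^'n \<Rightarrow> real" where
  "size_bound \<alpha> t x y = t powr \<alpha> / (t + norm (x - y)) powr (real CARD('n) + \<alpha>)"

definition holder_bound ::
  "real \<Rightarrow> real \<Rightarrow> real^'n::finite \<Rightarrow> real^'n \<Rightarrow> real^'n \<Rightarrow> real" where
  "holder_bound \<alpha> t x y y' =
     norm (y - y') powr \<alpha> / (t + norm (x - y)) powr (real CARD('n) + \<alpha>)"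

definition standard_estimates ::
  "real \<Rightarrow> real \<Rightarrow> ('n::finite, 'm::finite) kernel \<Rightarrow> bool" where
  "standard_estimates \<alpha> \<beta> s \<longleftrightarrow>
    (\<exists>C. \<forall>t1>0. \<forall>t2>0. \<forall>x1 x2 y1 y2.
       cmod (s t1 t2 (x1, x2) (y1, y2)) \<le> C * (size_bound \<alpha> t1 x1 y1 * size_bound \<beta> t2 x2 y2)) \<and>
    (\<exists>C. \<forall>t1>0. \<forall>t2>0. \<forall>x1 x2 y1 y2 y1' y2'.
       norm (y1 - y1') < t1 / 2 \<longrightarrow> norm (y2 - y2') < t2 / 2 \<longrightarrow>
       cmod (s t1 t2 (x1, x2) (y1, y2) - s t1 t2 (x1, x2) (y1, y2')
             - s t1 t2 (x1, x2) (y1', y2) + s t1 t2 (x1, x2) (y1', y2'))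
         \<le> C * (holder_bound \<alpha> t1 x1 y1 y1' * holder_bound \<beta> t2 x2 y2 y2')) \<and>
    (\<exists>C. \<forall>t1>0. \<forall>t2>0. \<forall>x1 x2 y1 y2 y2'.
       norm (y2 - y2') < t2 / 2 \<longrightarrow>
       cmod (s t1 t2 (x1, x2) (y1, y2) - s t1 t2 (x1, x2) (y1, y2'))
         \<le> C * (size_bound \<alpha> t1 x1 y1 * holder_bound \<beta> t2 x2 y2 y2')) \<and>
    (\<exists>C. \<forall>t1>0. \<forall>t2>0. \<forall>x1 x2 y1 y2 y1'.
       norm (y1 - y1') < t1 / 2 \<longrightarrow>
       cmod (s t1 t2 (x1, x2) (y1, y2) - s t1 t2 (x1, x2) (y1', y2))
         \<le> C * (holder_bound \<alpha> t1 x1 y1 y1' * size_bound \<beta> t2 x2 y2))"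

text \<open>Cubes are axis-parallel and half-open, given by their lower corner and side length.\<close>

definition cube :: "real^'n::finite \<Rightarrow> real \<Rightarrow> (real^'n) set" where
  "cube a l = {z. \<forall>i. a $ i \<le> z $ i \<and> z $ i < a $ i + l}"

definition carleson_norm ::
  "real^'n::finite \<Rightarrow> real \<Rightarrow> (real \<Rightarrow> real^'n \<Rightarrow> real^'n \<Rightarrow> complex) \<Rightarrow> ennreal" where
  "carleson_norm a l k =
     epowr (\<integral>\<^sup>+(x, t)\<in>cube a l \<times> {0<..<l}.
       (\<integral>\<^sup>+y\<in>cube a l. ennreal ((cmod (k t x y))\<^sup>2 / t) \<partial>lebesgue) \<partial>lebesgue) (1 / 2)"

definition carleson_standard_estimates ::
  "real \<Rightarrow> real \<Rightarrow> ('n::finite, 'm::finite) kernel \<Rightarrow> bool" where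
  "carleson_standard_estimates \<alpha> \<beta> s \<longleftrightarrow>
    (\<exists>C. \<forall>a. \<forall>l>0. \<forall>t2>0. \<forall>x2 y2.
       carleson_norm a l (\<lambda>t1 x1 y1. s t1 t2 (x1, x2) (y1, y2))
         \<le> ennreal (C * size_bound \<beta> t2 x2 y2)) \<and>
    (\<exists>C. \<forall>a. \<forall>l>0. \<forall>t1>0. \<forall>x1 y1.
       carleson_norm a l (\<lambda>t2 x2 y2. s t1 t2 (x1, x2) (y1, y2))
         \<le> ennreal (C * size_bound \<alpha> t1 x1 y1)) \<and>
    (\<exists>C. \<forall>a. \<forall>l>0. \<forall>t2>0. \<forall>x2 y2 y2'.
       norm (y2 - y2') < t2 / 2 \<longrightarrow>
       carleson_norm a l
         (\<lambda>t1 x1 y1. s t1 t2 (x1, x2) (y1, y2) - s t1 t2 (x1, x2) (y1, y2'))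
         \<le> ennreal (C * holder_bound \<beta> t2 x2 y2 y2')) \<and>
    (\<exists>C. \<forall>a. \<forall>l>0. \<forall>t1>0. \<forall>x1 y1 y1'.
       norm (y1 - y1') < t1 / 2 \<longrightarrow>
       carleson_norm a l
         (\<lambda>t2 x2 y2. s t1 t2 (x1, x2) (y1, y2) - s t1 t2 (x1, x2) (y1', y2))
         \<le> ennreal (C * holder_bound \<alpha> t1 x1 y1 y1'))"

text \<open>
  A dyadic grid, as a set of pairs (lower corner, side length). Its generation \<open>k\<close>, \<open>k\<close> an arbitrary
  integer, is the lattice of cubes of side \<open>2\<^sup>k\<close> with a vertex at \<open>a k\<close>; the condition on
  \<open>a\<close> says that every cube of generation \<open>k\<close> lies in one of generation \<open>k + 1\<close>. Expanding
  offsets in binary, these are exactly the grids obtained from the standard one by translating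
  the cubes of generation \<open>k\<close> by \<open>\<Sum>j<k. 2\<^sup>j \<omega>\<^sub>j\<close>, where each \<open>\<omega>\<^sub>j\<close> is a vector with entries
  in \<open>{0, 1}\<close>.
\<close>

definition dyadic_grid :: "((real^'n::finite) \<times> real) set \<Rightarrow> bool" where
  "dyadic_grid D \<longleftrightarrow> (\<exists>a :: int \<Rightarrow> real^'n.
     (\<forall>k i. (a (k + 1) $ i - a k $ i) / 2 powi k \<in> \<int>) \<and>
     D = {(a k + (2 powi k) *\<^sub>R q, 2 powi k) | k q. \<forall>i. q $ i \<in> \<int>})"

fun box_of :: "(real^'n::finite) \<times> real \<Rightarrow> (real^'n) set" where
  "box_of (a, l) = cube a l"

fun whitney :: "(real^'n::finite) \<times> real \<Rightarrow> ((real^'n) \<times> real) set" where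
  "whitney (a, l) = cube a l \<times> {l / 2<..<l}"

definition carleson_coeff ::
  "('n::finite, 'm::finite) kernel \<Rightarrow> (real^'n) \<times> real \<Rightarrow> (real^'m) \<times> real \<Rightarrow> ennreal" where
  "carleson_coeff s I J =
     (\<integral>\<^sup>+(x2, t2)\<in>whitney J. (\<integral>\<^sup>+(x1, t1)\<in>whitney I.
        ennreal ((cmod (theta s t1 t2 (\<lambda>_. 1) (x1, x2)))\<^sup>2 / (t1 * t2)) \<partial>lebesgue) \<partial>lebesgue)"

text \<open>
  The sets \<open>\<Omega>\<close> below are countable unions of dyadic rectangles, so they are measurable.
\<close>

definition biparameter_carleson :: "('n::finite, 'm::finite) kernel \<Rightarrow> bool" where
  "biparameter_carleson s \<longleftrightarrow> (\<exists>C::real. \<forall>Dn Dm. dyadic_grid Dn \<longrightarrow> dyadic_grid Dm \<longrightarrow>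
     (\<forall>\<Omega>. emeasure lebesgue \<Omega> < \<infinity> \<longrightarrow>
        (\<forall>x\<in>\<Omega>. \<exists>I\<in>Dn. \<exists>J\<in>Dm. x \<in> box_of I \<times> box_of J \<and> box_of I \<times> box_of J \<subseteq> \<Omega>) \<longrightarrow>
        (\<Sum>\<^sub>\<infinity>(I, J)\<in>{(I, J) \<in> Dn \<times> Dm. box_of I \<times> box_of J \<subseteq> \<Omega>}. carleson_coeff s I J)
          \<le> ennreal C * emeasure lebesgue \<Omega>))"

end

theory Submission
  imports Defs
begin

text \<open>
  The Carleson estimates carry no factor \<open>\<bar>I\<bar>\<close>, so they bound Hilbert-Schmidt norms, and the
  theorem follows from the size estimates and these bounds alone, with positive operators throughout.
  For \<open>1 < r < p\<close> close to 1, Hoelder's inequality and the size estimate give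
  \<open>\<bar>\<theta>\<^sub>t f(x)\<bar>\<^sup>2 \<lesssim> A(x,t)\<^sup>e P(x,t)\<^bsup>2/r\<^esup>\<close> with \<open>e = 2 - 2/r\<close>,
  \<open>A(x,t) = t\<^sub>1\<^sup>n t\<^sub>2\<^sup>m \<integral>\<bar>s\<^sub>t(x,y)\<bar>\<^sup>2 dy\<close>, and \<open>P\<close> an average of \<open>\<bar>f\<bar>\<^sup>r\<close> at scale \<open>t\<close> around \<open>x\<close>.
  The Hilbert-Schmidt bounds say that \<open>A / t\<^sub>1\<^sup>n\<close> is integrable in \<open>(x\<^sub>1,t\<^sub>1)\<close> uniformly in
  \<open>(x\<^sub>2,t\<^sub>2)\<close>, and symmetrically. Of any two boxes, one is smaller in some variable by at least the ratio
  of their sides in the other variable, and raising \<open>A\<close> to the power \<open>e\<close> gains a power of this ratio.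
  A second moment argument turns this into the Carleson packing condition for \<open>A\<^sup>e\<close> over arbitrary
  sets \<open>\<Omega>\<close>.

  Let \<open>H\<close> be the strong maximal function of \<open>\<bar>f\<bar>\<^sup>r\<close> and \<open>W\<close> the integral of \<open>A\<^sup>e P\<^bsup>p/r\<^esup>\<close> over \<open>t\<close>. Since
  \<open>P \<lesssim> H\<close>, we get \<open>g(f)\<^sup>2 \<lesssim> H\<^bsup>(2-p)/r\<^esup> W\<close> and hence \<open>g(f)\<^sup>p \<lesssim> H\<^bsup>p/r\<^esup> + W\<close>. Both terms are
  integrable, by the maximal theorem for the exponent \<open>p/r > 1\<close> and the Carleson embedding.
\<close>

section \<open>Real powers of extended nonnegative numbers\<close>

text \<open>The exponent \<open>r\<close> has to lie strictly between 1 and \<open>p\<close>. At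
  \<open>r = 1\<close> the power \<open>e\<close> vanishes, and with it the decay in the ratio of
  scales that makes the sum over scales converge; at \<open>r = p\<close> the maximal theorem is
  lost. Closeness to 1 serves a second purpose: Hoelder's inequality leaves the kernel raised to the
  power \<open>2 - r\<close>, and the weaker decay of this power still dominates a size kernel with
  half the exponents. The packing condition is needed for arbitrary sets, since in two parameters
  control over single rectangles does not imply it. The second moment argument avoids any geometry
  of the set: only pairs of boxes interact, and the ratios of their two sides decide which of the
  two fibrewise bounds is used. The kernel is merely Lebesgue measurable in all variables jointly,
  so its sections are well behaved only almost everywhere, and Lebesgue measure on a product is not
  the product of the Lebesgue measures. Estimates are therefore made for a Borel kernel and a Borel
  function, where Tonelli's theorem applies freely, and are transferred back through nested
  almost-everywhere statements.\<close>

lemma epowr_ennreal: "0 \<le> x \<Longrightarrow> epowr (ennreal x) a = ennreal (x powr a)"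
  by (simp add: epowr_def)

lemma epowr_top [simp]: "epowr top a = top"
  by (simp add: epowr_def)

lemma epowr_0 [simp]: "epowr 0 a = 0"
  by (simp add: epowr_def)

lemma epowr_eq_0_iff [simp]: "epowr u a = 0 \<longleftrightarrow> u = 0"
  by (cases u) (auto simp: epowr_ennreal)

lemma epowr_mono: "u \<le> v \<Longrightarrow> 0 \<le> a \<Longrightarrow> epowr u a \<le> epowr v a"
  by (cases u; cases v)
    (auto simp: epowr_ennreal top_unique powr_mono2 ennreal_leI)

lemma epowr_one [simp]: "epowr u 1 = u"
  by (cases u) (auto simp: epowr_ennreal)

lemma epowr_epowr: "epowr (epowr u a) b = epowr u (a * b)"
  by (cases u) (auto simp: epowr_ennreal powr_powr)

text \<open>True for every exponent because the conventions \<open>epowr 0 a = 0\<close> and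
  \<open>epowr top a = top\<close> match \<open>0 * top = 0\<close> on both sides.\<close>

lemma epowr_mult: "epowr (u * v) a = epowr u a * epowr v a"
proof (cases "u = 0 \<or> v = 0")
  case False
  then show ?thesis
    by (cases u; cases v)
      (auto simp: epowr_ennreal powr_mult ennreal_top_mult ennreal_mult_top simp flip: ennreal_mult)
qed auto

lemma epowr_add: "0 < a \<Longrightarrow> 0 < b \<Longrightarrow> epowr u (a + b) = epowr u a * epowr u b"
  by (cases u) (auto simp: epowr_ennreal powr_add ennreal_mult ennreal_top_mult)

lemma epowr_two: "epowr u 2 = u\<^sup>2"
proof -
  have "epowr u (1 + 1) = epowr u 1 * epowr u 1" by (rule epowr_add) auto
  then show ?thesis by (simp add: power2_eq_square)
qed

lemma epowr_le_iff: "0 < a \<Longrightarrow> epowr u a \<le> v \<longleftrightarrow> u \<le> epowr v (1 / a)"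
proof
  assume a: "0 < a" and h: "epowr u a \<le> v"
  have "epowr (epowr u a) (1/a) \<le> epowr v (1/a)" using a h by (intro epowr_mono) auto
  then show "u \<le> epowr v (1 / a)" using a by (simp add: epowr_epowr)
next
  assume a: "0 < a" and h: "u \<le> epowr v (1 / a)"
  have "epowr u a \<le> epowr (epowr v (1/a)) a" using a h by (intro epowr_mono) auto
  then show "epowr u a \<le> v" using a by (simp add: epowr_epowr)
qed

lemma epowr_measurable [measurable (raw)]:
  assumes [measurable]: "f \<in> borel_measurable M"
  shows "(\<lambda>x. epowr (f x) a) \<in> borel_measurable M"
  unfolding epowr_def by measurable

lemma epowr_le_one_plus:
  assumes "0 < e" "e < 1"
  shows "epowr u e \<le> 1 + u"
proof (cases u)
  case (real x)
  have "x powr e \<le> 1 + x"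
  proof (cases "x \<le> 1")
    case True
    then have "x powr e \<le> 1" using real assms powr_le1[of e x] by auto
    then show ?thesis using real by auto
  next
    case False
    then have "x powr e \<le> x powr 1" using assms by (intro powr_mono) auto
    then show ?thesis using False by auto
  qed
  moreover have "1 + u = ennreal (1 + x)" using real by (simp add: ennreal_plus flip: ennreal_1)
  ultimately show ?thesis using real by (simp add: epowr_ennreal ennreal_leI del: ennreal_plus)
qed auto

text \<open>Both factors increase when \<open>u\<close> and \<open>v\<close> are replaced by their
  maximum. This crude form of Young's inequality serves in Hoelder's inequality and in the final
  passage from a product of \<open>H\<close> and \<open>W\<close> to a sum.\<close>

lemma epowr_interpolate_le:
  assumes "0 < a" "0 < b" "a + b = 1"
  shows "epowr u a * epowr v b \<le> max u v"
proof -
  have "epowr u a * epowr v b \<le> epowr (max u v) a * epowr (max u v) b"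
    using assms by (intro mult_mono epowr_mono) auto
  also have "\<dots> = max u v" using assms epowr_add[of a b "max u v"] by simp
  finally show ?thesis .
qed

section \<open>Power integrals and layer-cake formulas\<close>

lemma nn_integral_powr_0:
  assumes a: "0 < a" and c: "0 < c"
  shows "(\<integral>\<^sup>+t. ennreal (a * t powr (a - 1)) * indicator {0<..<c} t \<partial>lborel) = ennreal (c powr a)"
proof -
  let ?f = "\<lambda>t. a * t powr (a - 1)" and ?F = "\<lambda>t::real. t powr a"
  have d: "DERIV ?F x :> ?f x" if "0 < x" for x
    using that by (auto intro!: derivative_eq_intros)
  \<comment> \<open>For \<open>a < 1\<close> the integrand is unbounded at 0, so the fundamental
    theorem is used in its improper form, with one-sided limits at both ends.\<close>
  have A: "((?F \<circ> real_of_ereal) \<longlongrightarrow> 0) (at_right (ereal 0))"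
    unfolding ereal_tendsto_simps1
    using a by (auto intro!: tendsto_eq_intros tendsto_powr2 simp: eventually_at_right_less[THEN eventually_mono])
  have B: "((?F \<circ> real_of_ereal) \<longlongrightarrow> c powr a) (at_left (ereal c))"
    unfolding ereal_tendsto_simps1
    using c by (intro tendsto_intros) auto
  have C: "isCont ?f x" if "0 < x" for x
    using that by (intro continuous_intros) auto
  have 1: "set_integrable lborel (einterval 0 c) ?f" "(LBINT x=0..c. ?f x) = c powr a - 0"
    using interval_integral_FTC_nonneg[of 0 "ereal c" ?F ?f, OF _ _ _ _ A[unfolded zero_ereal_def[symmetric]] B] d C a c
    by (auto simp: zero_ereal_def)
  have "(\<integral>\<^sup>+t. ennreal (?f t) * indicator {0<..<c} t \<partial>lborel)
      = (\<integral>\<^sup>+t. ennreal (indicator {0<..<c} t *\<^sub>R ?f t) \<partial>lborel)"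
    by (intro nn_integral_cong) (auto split: split_indicator)
  also have "\<dots> = ennreal (\<integral>t. indicator {0<..<c} t *\<^sub>R ?f t \<partial>lborel)"
    using 1 a by (intro nn_integral_eq_integral)
      (auto simp: set_integrable_def einterval_eq zero_ereal_def split: split_indicator)
  also have "\<dots> = ennreal (c powr a)"
    using 1(2) c by (simp add: interval_lebesgue_integral_def set_lebesgue_integral_def einterval_eq zero_ereal_def mult.left_commute[of _ a])
  finally show ?thesis .
qed

lemma nn_integral_powr_top:
  assumes a: "0 < a" and c: "0 < c"
  shows "(\<integral>\<^sup>+t. ennreal (a * t powr (- a - 1)) * indicator {c..} t \<partial>lborel) = ennreal (c powr (- a))"
proof -
  let ?f = "\<lambda>t. a * t powr (- a - 1)" and ?F = "\<lambda>t::real. - (t powr (- a))"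
  have d: "DERIV ?F x :> ?f x" if "c \<le> x" for x
    using that c by (auto intro!: derivative_eq_intros)
  have l: "(?F \<longlongrightarrow> 0) at_top"
    using tendsto_minus[OF tendsto_neg_powr[of "- a" "\<lambda>t. t", OF _ filterlim_ident]] a by simp
  show ?thesis
    using nn_integral_FTC_atLeast[of ?f c ?F 0, OF _ d _ l] a by auto
qed

lemma epowr_layer_cake:
  assumes a: "0 < a"
  shows "epowr u a = (\<integral>\<^sup>+t. ennreal (a * t powr (a - 1)) * indicator {t. 0 < t \<and> ennreal t < u} t \<partial>lborel)"
proof (cases u)
  case (real c)
  show ?thesis
  proof (cases "c = 0")
    case True
    then show ?thesis using real by simp
  next
    case False
    have "{t. 0 < t \<and> ennreal t < u} = {0<..<c}" using real by (auto simp: ennreal_less_iff)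
    then show ?thesis using real False a nn_integral_powr_0[of a c] by (simp add: epowr_ennreal)
  qed
next
  case top
  have ge: "ennreal (c powr a) \<le> (\<integral>\<^sup>+t. ennreal (a * t powr (a - 1)) * indicator {t. 0 < t \<and> ennreal t < u} t \<partial>lborel)" if "0 < c" for c
    unfolding nn_integral_powr_0[OF a that, symmetric]
    by (intro nn_integral_mono) (auto simp: top split: split_indicator)
  have "top \<le> (\<integral>\<^sup>+t. ennreal (a * t powr (a - 1)) * indicator {t. 0 < t \<and> ennreal t < u} t \<partial>lborel)" (is "_ \<le> ?I")
    unfolding ennreal_SUP_of_nat_eq_top[symmetric]
  proof (rule SUP_least)
    fix n :: nat
    show "of_nat n \<le> ?I"
    proof (cases "n = 0")
      case False
      \<comment> \<open>The choice \<open>c = n powr (1 / a)\<close> turns the lower bound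
        \<open>c powr a\<close> into \<open>n\<close>.\<close>
      then show ?thesis
        using ge[of "real n powr (1 / a)"] a by (simp add: powr_powr ennreal_of_nat_eq_real_of_nat)
    qed simp
  qed
  then show ?thesis using top by (simp add: top_unique)
qed

text \<open>Tonelli applied to \<open>epowr_layer_cake\<close>. The weight is what later uses vary:
  it is 1 for plain norms, the function \<open>F\<close> itself in the maximal theorem, and a power
  of the energy in the Carleson embedding.\<close>

lemma nn_integral_epowr_layer_cake:
  assumes "sigma_finite_measure M" and a: "0 < a"
    and [measurable]: "f \<in> borel_measurable M" "w \<in> borel_measurable M"
  shows "(\<integral>\<^sup>+x. w x * epowr (f x) a \<partial>M)
    = (\<integral>\<^sup>+t\<in>{0<..}. ennreal (a * t powr (a - 1)) * (\<integral>\<^sup>+x. w x * indicator {x. ennreal t < f x} x \<partial>M) \<partial>lborel)"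
proof -
  interpret sigma_finite_measure M by fact
  interpret pair_sigma_finite lborel M by unfold_locales
  have [measurable]: "Measurable.pred (lborel \<Otimes>\<^sub>M M) (\<lambda>(t, x). ennreal t < f x)"
    by measurable
  have "(\<integral>\<^sup>+x. w x * epowr (f x) a \<partial>M) = (\<integral>\<^sup>+x. (\<integral>\<^sup>+t. w x * (ennreal (a * t powr (a - 1)) * (indicator {0<..} t * indicator {(t, x). ennreal t < f x} (t, x))) \<partial>lborel) \<partial>M)"
    unfolding epowr_layer_cake[OF a]
    by (intro nn_integral_cong, subst nn_integral_cmult)
      (auto intro!: nn_integral_cong arg_cong2[where f="(*)"] split: split_indicator)
  also have "\<dots> = (\<integral>\<^sup>+t. (\<integral>\<^sup>+x. w x * (ennreal (a * t powr (a - 1)) * (indicator {0<..} t * indicator {(t, x). ennreal t < f x} (t, x))) \<partial>M) \<partial>lborel)"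
    by (intro Fubini') measurable
  also have "\<dots> = (\<integral>\<^sup>+t\<in>{0<..}. ennreal (a * t powr (a - 1)) * (\<integral>\<^sup>+x. w x * indicator {x. ennreal t < f x} x \<partial>M) \<partial>lborel)"
  proof (intro nn_integral_cong)
    fix t :: real
    have "(\<integral>\<^sup>+x. w x * (ennreal (a * t powr (a - 1)) * (indicator {0<..} t * indicator {(t, x). ennreal t < f x} (t, x))) \<partial>M)
      = (\<integral>\<^sup>+x. (ennreal (a * t powr (a - 1)) * indicator {0<..} t) * (w x * indicator {x. ennreal t < f x} x) \<partial>M)"
      by (intro nn_integral_cong) (auto split: split_indicator simp: ac_simps)
    also have "\<dots> = (ennreal (a * t powr (a - 1)) * indicator {0<..} t) * (\<integral>\<^sup>+x. w x * indicator {x. ennreal t < f x} x \<partial>M)"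
      by (rule nn_integral_cmult) measurable
    finally show "(\<integral>\<^sup>+x. w x * (ennreal (a * t powr (a - 1)) * (indicator {0<..} t * indicator {(t, x). ennreal t < f x} (t, x))) \<partial>M)
      = ennreal (a * t powr (a - 1)) * (\<integral>\<^sup>+x. w x * indicator {x. ennreal t < f x} x \<partial>M) * indicator {0<..} t"
      by (simp add: ac_simps)
  qed
  finally show ?thesis .
qed

section \<open>The Hardy-Littlewood maximal function\<close>

text \<open>The centred maximal function restricted to radii \<open>2 powr k\<close> and normalised
  by the radius to the dimension instead of the ball volume; it is comparable to the usual one. The
  supremum is countable, hence measurable even when \<open>F\<close> depends on a parameter.\<close>

definition hl_max :: "('a::euclidean_space \<Rightarrow> ennreal) \<Rightarrow> 'a \<Rightarrow> ennreal" where
  "hl_max F x = (SUP k::int. ennreal (2 powr (- (real_of_int k * DIM('a)))) *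
     (\<integral>\<^sup>+y\<in>ball x (2 powr k). F y \<partial>lborel))"

text \<open>Iterating the one-parameter function, instead of taking a supremum over products of
  balls, reduces norm bounds to one variable at a time.\<close>

abbreviation strong_max :: "('a::euclidean_space \<times> 'b::euclidean_space \<Rightarrow> ennreal) \<Rightarrow> 'a \<times> 'b \<Rightarrow> ennreal" where
  "strong_max F z \<equiv> hl_max (\<lambda>y1. hl_max (\<lambda>y2. F (y1, y2)) (snd z)) (fst z)"

lemma indicator_ball_measurable [measurable (raw)]:
  fixes f g :: "'b \<Rightarrow> 'a::euclidean_space"
  assumes [measurable]: "f \<in> borel_measurable M" "g \<in> borel_measurable M" "r \<in> borel_measurable M"
  shows "(\<lambda>p. indicator (ball (f p) (r p)) (g p) :: ennreal) \<in> borel_measurable M"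
proof -
  have "(\<lambda>p. indicator (ball (f p) (r p)) (g p) :: ennreal) = (\<lambda>p. if dist (f p) (g p) < r p then 1 else 0)"
    by (auto simp: fun_eq_iff split: split_indicator)
  then show ?thesis by simp
qed

lemma hl_max_measurable [measurable (raw)]:
  fixes F :: "'b \<Rightarrow> 'a::euclidean_space \<Rightarrow> ennreal"
  assumes [measurable]: "case_prod F \<in> borel_measurable (M \<Otimes>\<^sub>M borel)" "g \<in> borel_measurable M"
  shows "(\<lambda>w. hl_max (F w) (g w)) \<in> borel_measurable M"
proof -
  have [measurable]: "case_prod F \<in> borel_measurable (M \<Otimes>\<^sub>M lborel)"
    using assms(1) by (simp cong: measurable_cong_sets)
  show ?thesis unfolding hl_max_def by measurable
qed

lemma emeasure_ball_DIM: "0 \<le> r \<Longrightarrow> emeasure lborel (ball (x::'a::euclidean_space) r) = ennreal (unit_ball_vol (DIM('a)) * r ^ DIM('a))"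
  by (rule emeasure_ball)

lemma le_hl_max:
  fixes F :: "'a::euclidean_space \<Rightarrow> ennreal"
  shows "ennreal (2 powr (- (real_of_int k * DIM('a)))) * (\<integral>\<^sup>+y\<in>ball x (2 powr k). F y \<partial>lborel) \<le> hl_max F x"
  unfolding hl_max_def by (rule SUP_upper2[of k]) auto

text \<open>Vitali covering: every point of the level set is the centre of a ball of radius
  \<open>rad i\<close> and mass at least \<open>l * rad i ^ n\<close>, and a disjoint subfamily
  covers the set after enlargement by the factor 5.\<close>

lemma hl_max_weak_type:
  fixes F :: "'a::euclidean_space \<Rightarrow> ennreal"
  assumes F [measurable]: "F \<in> borel_measurable borel" and l: "0 < l"
  shows "emeasure lborel {x. ennreal l < hl_max F x}
    \<le> ennreal (5 ^ DIM('a) * unit_ball_vol (DIM('a)) / l) * (\<integral>\<^sup>+x. F x \<partial>lborel)"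
proof (cases "(\<integral>\<^sup>+x. F x \<partial>lborel) = top")
  case True
  moreover have "0 < 5 ^ DIM('a) * unit_ball_vol (DIM('a)) / l" using l by simp
  then have "ennreal (5 ^ DIM('a) * unit_ball_vol (DIM('a)) / l) \<noteq> 0" by (metis ennreal_eq_0_iff not_le)
  ultimately show ?thesis by (simp add: ennreal_mult_top)
next
  case False
  then obtain I where I: "(\<integral>\<^sup>+x. F x \<partial>lborel) = ennreal I" "0 \<le> I"
    by (cases "\<integral>\<^sup>+x. F x \<partial>lborel") auto
  let ?n = "DIM('a)"
  let ?\<omega> = "unit_ball_vol (DIM('a))"
  define S where "S = {x. ennreal l < hl_max F x}"
  define K where "K = {(x, k). ennreal l < ennreal (2 powr (- (real_of_int k * DIM('a)))) * (\<integral>\<^sup>+y\<in>ball x (2 powr k). F y \<partial>lborel)}"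
  define rad where "rad = (\<lambda>i::'a \<times> int. 2 powr real_of_int (snd i))"
  have rn: "rad i ^ ?n = 2 powr (real_of_int (snd i) * ?n)" for i
    by (simp add: rad_def powr_powr flip: powr_realpow)
  have pos: "0 < rad i" for i by (simp add: rad_def)
  have big: "ennreal (l * rad i ^ ?n) \<le> (\<integral>\<^sup>+y\<in>ball (fst i) (rad i). F y \<partial>lborel)" if "i \<in> K" for i
  proof -
    obtain x k where i: "i = (x, k)" by (cases i)
    let ?J = "\<integral>\<^sup>+y\<in>ball x (2 powr k). F y \<partial>lborel"
    have "ennreal (l * rad i ^ ?n) = ennreal l * ennreal (rad i ^ ?n)" using l pos by (simp add: ennreal_mult less_imp_le)
    also have "\<dots> \<le> (ennreal (2 powr (- (real_of_int k * ?n))) * ?J) * ennreal (rad i ^ ?n)"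
      using that unfolding K_def i by (intro mult_right_mono) auto
    also have "\<dots> = (ennreal (2 powr (- (real_of_int k * ?n))) * ennreal (rad i ^ ?n)) * ?J"
      by (simp add: ac_simps)
    also have "ennreal (2 powr (- (real_of_int k * ?n))) * ennreal (rad i ^ ?n) = 1"
      unfolding rn by (simp add: i powr_minus field_simps flip: ennreal_mult)
    finally show ?thesis by (simp add: i rad_def)
  qed
  \<comment> \<open>Vitali's selection requires bounded radii. A radius above 1 is at most its own
    \<open>n\<close>-th power, and \<open>l * rad i ^ n\<close> cannot exceed the finite total mass
    \<open>I\<close>.\<close>
  have bd: "rad i \<le> max 1 (I / l)" if "i \<in> K" for i
  proof (cases "rad i \<le> 1")
    case False
    have "ennreal (l * rad i ^ ?n) \<le> (\<integral>\<^sup>+y. F y \<partial>lborel)"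
      by (rule order_trans[OF big[OF that]]) (auto intro!: nn_integral_mono split: split_indicator)
    then have "l * rad i ^ ?n \<le> I" using I by (simp add: ennreal_le_iff)
    moreover have "rad i ^ 1 \<le> rad i ^ ?n" using False by (intro power_increasing) (auto simp: DIM_positive Suc_leI)
    ultimately have "rad i \<le> I / l" using l by (simp add: field_simps) (meson mult_left_mono order_trans less_imp_le)
    then show ?thesis by simp
  qed simp
  have SK: "S \<subseteq> (\<Union>i\<in>K. ball (fst i) (rad i))"
  proof
    fix x assume "x \<in> S"
    then obtain k where "(x, k) \<in> K" unfolding S_def K_def hl_max_def by (auto simp: less_SUP_iff)
    then show "x \<in> (\<Union>i\<in>K. ball (fst i) (rad i))"
      using pos[of "(x, k)"] by (intro UN_I[of "(x, k)"]) auto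
  qed
  obtain C where C: "countable C" "C \<subseteq> K"
     "pairwise (\<lambda>i j. disjnt (ball (fst i) (rad i)) (ball (fst j) (rad j))) C"
     "S \<subseteq> (\<Union>i\<in>C. ball (fst i) (5 * rad i))"
    using Vitali_covering_lemma_balls[OF SK, of "max 1 (I / l)"] bd pos by auto
  have [measurable]: "S \<in> sets borel" unfolding S_def by measurable
  have "emeasure lborel S = (\<integral>\<^sup>+x. indicator S x \<partial>lborel)" by simp
  also have "\<dots> \<le> (\<integral>\<^sup>+x. (\<integral>\<^sup>+i. indicator (ball (fst i) (5 * rad i)) x \<partial>count_space C) \<partial>lborel)"
  proof (rule nn_integral_mono)
    fix x :: 'a
    show "(indicator S x :: ennreal) \<le> (\<integral>\<^sup>+i. indicator (ball (fst i) (5 * rad i)) x \<partial>count_space C)"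
    proof (cases "x \<in> S")
      case True
      then obtain j where j: "j \<in> C" "x \<in> ball (fst j) (5 * rad j)" using C(4) by auto
      then show ?thesis using nn_integral_ge_point[of j C "\<lambda>i. indicator (ball (fst i) (5 * rad i)) x"]
        by (auto split: split_indicator)
    qed auto
  qed
  also have "\<dots> = (\<integral>\<^sup>+i. (\<integral>\<^sup>+x. indicator (ball (fst i) (5 * rad i)) x \<partial>lborel) \<partial>count_space C)"
    by (intro nn_integral_count_space_nn_integral C) auto
  also have "\<dots> \<le> (\<integral>\<^sup>+i. (\<integral>\<^sup>+x. ennreal (5 ^ ?n * ?\<omega> / l) * (F x * indicator (ball (fst i) (rad i)) x) \<partial>lborel) \<partial>count_space C)"
  proof (rule nn_integral_mono)
    fix i assume "i \<in> space (count_space C)"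
    then have "i \<in> K" using C by auto
    have "(\<integral>\<^sup>+x. indicator (ball (fst i) (5 * rad i)) x \<partial>lborel) = ennreal (?\<omega> * (5 * rad i) ^ ?n)"
      using pos[of i] by (simp add: emeasure_ball_DIM less_imp_le)
    also have "\<dots> = ennreal (5 ^ ?n * ?\<omega> / l) * ennreal (l * rad i ^ ?n)"
      using l pos[of i] by (subst ennreal_mult'[symmetric]) (simp_all add: power_mult_distrib)
    also have "\<dots> \<le> ennreal (5 ^ ?n * ?\<omega> / l) * (\<integral>\<^sup>+x\<in>ball (fst i) (rad i). F x \<partial>lborel)"
      by (intro mult_left_mono big \<open>i \<in> K\<close>) auto
    also have "\<dots> = (\<integral>\<^sup>+x. ennreal (5 ^ ?n * ?\<omega> / l) * (F x * indicator (ball (fst i) (rad i)) x) \<partial>lborel)"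
      by (simp add: nn_integral_cmult)
    finally show "(\<integral>\<^sup>+x. indicator (ball (fst i) (5 * rad i)) x \<partial>lborel)
      \<le> (\<integral>\<^sup>+x. ennreal (5 ^ ?n * ?\<omega> / l) * (F x * indicator (ball (fst i) (rad i)) x) \<partial>lborel)" .
  qed
  also have "\<dots> = (\<integral>\<^sup>+x. (\<integral>\<^sup>+i. ennreal (5 ^ ?n * ?\<omega> / l) * (F x * indicator (ball (fst i) (rad i)) x) \<partial>count_space C) \<partial>lborel)"
    by (intro nn_integral_count_space_nn_integral[symmetric] C) auto
  also have "\<dots> \<le> (\<integral>\<^sup>+x. ennreal (5 ^ ?n * ?\<omega> / l) * F x \<partial>lborel)"
  proof (rule nn_integral_mono)
    fix x :: 'a
    have "(\<integral>\<^sup>+i. indicator (ball (fst i) (rad i)) x \<partial>count_space C) \<le> (1::ennreal)"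
    proof (cases "\<exists>j\<in>C. x \<in> ball (fst j) (rad j)")
      case True
      then obtain j where j: "j \<in> C" "x \<in> ball (fst j) (rad j)" by auto
      have "(\<integral>\<^sup>+i. indicator (ball (fst i) (rad i)) x \<partial>count_space C) \<le> (\<integral>\<^sup>+i. indicator {j} i \<partial>count_space C)"
        using j C(3) by (intro nn_integral_mono) (auto simp: pairwise_def disjnt_iff split: split_indicator)
      also have "\<dots> \<le> 1" using j by (simp add: emeasure_count_space)
      finally show ?thesis .
    next
      case False
      then have "(\<integral>\<^sup>+i. indicator (ball (fst i) (rad i)) x \<partial>count_space C) = (\<integral>\<^sup>+i. 0 \<partial>count_space C)"
        by (intro nn_integral_cong) auto
      then show ?thesis by simp
    qed
    then have "ennreal (5 ^ ?n * ?\<omega> / l) * F x * (\<integral>\<^sup>+i. indicator (ball (fst i) (rad i)) x \<partial>count_space C) \<le> ennreal (5 ^ ?n * ?\<omega> / l) * F x * 1"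
      by (intro mult_left_mono) auto
    then show "(\<integral>\<^sup>+i. ennreal (5 ^ ?n * ?\<omega> / l) * (F x * indicator (ball (fst i) (rad i)) x) \<partial>count_space C) \<le> ennreal (5 ^ ?n * ?\<omega> / l) * F x"
      by (simp add: nn_integral_cmult mult.assoc)
  qed
  also have "\<dots> = ennreal (5 ^ ?n * ?\<omega> / l) * (\<integral>\<^sup>+x. F x \<partial>lborel)"
    by (simp add: nn_integral_cmult)
  finally show ?thesis by (simp add: S_def)
qed

text \<open>In the chosen normalisation, the average of the constant \<open>l\<close> over a ball is
  \<open>unit_ball_vol (DIM('a)) * l\<close> at every scale. The lemma permits cutting a function
  off at height \<open>l\<close>.\<close>

lemma hl_max_le_add:
  fixes F G :: "'a::euclidean_space \<Rightarrow> ennreal"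
  assumes [measurable]: "F \<in> borel_measurable borel" "G \<in> borel_measurable borel"
    and le: "\<And>x. F x \<le> G x + ennreal l" and l: "0 \<le> l"
  shows "hl_max F x \<le> hl_max G x + ennreal (unit_ball_vol (DIM('a)) * l)"
  unfolding hl_max_def[of F]
proof (rule SUP_least)
  fix k :: int
  let ?c = "2 powr (- (real_of_int k * DIM('a)))" and ?B = "ball x (2 powr real_of_int k)"
  have v: "?c * (unit_ball_vol (DIM('a)) * (2 powr real_of_int k) ^ DIM('a)) = unit_ball_vol (DIM('a))"
    by (simp add: powr_powr powr_minus field_simps flip: powr_realpow)
  have "(\<integral>\<^sup>+y\<in>?B. F y \<partial>lborel) \<le> (\<integral>\<^sup>+y. G y * indicator ?B y + ennreal l * indicator ?B y \<partial>lborel)"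
    using le by (intro nn_integral_mono) (auto split: split_indicator)
  also have "\<dots> = (\<integral>\<^sup>+y\<in>?B. G y \<partial>lborel) + ennreal l * emeasure lborel ?B"
    by (simp add: nn_integral_add nn_integral_cmult)
  finally have "ennreal ?c * (\<integral>\<^sup>+y\<in>?B. F y \<partial>lborel) \<le> ennreal ?c * ((\<integral>\<^sup>+y\<in>?B. G y \<partial>lborel) + ennreal l * emeasure lborel ?B)"
    by (intro mult_left_mono) auto
  also have "\<dots> = ennreal ?c * (\<integral>\<^sup>+y\<in>?B. G y \<partial>lborel) + ennreal (unit_ball_vol (DIM('a)) * l)"
    unfolding emeasure_ball_DIM[OF powr_ge_zero] distrib_left mult.left_commute[of _ "ennreal l"]
    using l by (simp add: v ennreal_mult''[symmetric] mult.commute[of _ l])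
  also have "\<dots> \<le> hl_max G x + ennreal (unit_ball_vol (DIM('a)) * l)"
    by (intro add_right_mono le_hl_max)
  finally show "ennreal ?c * (\<integral>\<^sup>+y\<in>?B. F y \<partial>lborel) \<le> hl_max G x + ennreal (unit_ball_vol (DIM('a)) * l)" .
qed

text \<open>Marcinkiewicz interpolation between the weak bound at exponent 1 and boundedness of the
  maximal function of a bounded function: at each height \<open>t\<close>, only the part of
  \<open>F\<close> above \<open>t\<close> is subjected to the weak bound.\<close>

lemma hl_max_strong_type:
  assumes q: "1 < q"
  shows "\<exists>K\<ge>0. \<forall>F::'a::euclidean_space \<Rightarrow> ennreal. F \<in> borel_measurable borel \<longrightarrow>
    (\<integral>\<^sup>+x. epowr (hl_max F x) q \<partial>lborel) \<le> ennreal K * (\<integral>\<^sup>+x. epowr (F x) q \<partial>lborel)"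
proof -
  define \<omega> where "\<omega> = unit_ball_vol (DIM('a))"
  define c where "c = 5 ^ DIM('a) * \<omega>"
  have \<omega>: "0 \<le> \<omega>" and c: "0 \<le> c" by (auto simp: \<omega>_def c_def)
  define K where "K = (1 + \<omega>) powr q * (c * q / (q - 1))"
  have "(\<integral>\<^sup>+x. epowr (hl_max F x) q \<partial>lborel) \<le> ennreal K * (\<integral>\<^sup>+x. epowr (F x) q \<partial>lborel)"
    if [measurable]: "F \<in> borel_measurable borel" for F :: "'a \<Rightarrow> ennreal"
  proof -
    \<comment> \<open>The part of \<open>F\<close> below \<open>t\<close> contributes at most
      \<open>\<omega> * t\<close> to the maximal function. Dividing by \<open>1 + \<omega>\<close>
      ensures that \<open>M x > t\<close> still leaves more than \<open>t\<close> for the part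
      above.\<close>
    define M where "M = (\<lambda>x. ennreal (1 / (1 + \<omega>)) * hl_max F x)"
    have [measurable]: "M \<in> borel_measurable borel" unfolding M_def by measurable
    have FM: "hl_max F x = ennreal (1 + \<omega>) * M x" for x
      using \<omega> by (simp add: M_def mult.assoc[symmetric] del: ennreal_plus flip: ennreal_mult')
    have weak: "emeasure lborel {x. ennreal t < M x} \<le> ennreal (c / t) * (\<integral>\<^sup>+x. F x * indicator {x. ennreal t < F x} x \<partial>lborel)"
      if t: "0 < t" for t
    proof -
      let ?G = "\<lambda>x. F x * indicator {x. ennreal t < F x} x"
      have "hl_max F x \<le> hl_max ?G x + ennreal (\<omega> * t)" for x
        unfolding \<omega>_def using t by (intro hl_max_le_add) (auto split: split_indicator)
      then have "ennreal t < hl_max ?G x" if "ennreal t < M x" for x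
      proof -
        have "ennreal t + ennreal (\<omega> * t) = ennreal (1 + \<omega>) * ennreal t"
          using t \<omega> by (simp add: algebra_simps flip: ennreal_mult ennreal_plus)
        also have "\<dots> < ennreal (1 + \<omega>) * M x"
          using that \<omega> by (intro ennreal_mult_strict_left_mono) (auto intro: add_pos_nonneg)
        also have "\<dots> \<le> hl_max ?G x + ennreal (\<omega> * t)"
          using \<open>hl_max F x \<le> hl_max ?G x + ennreal (\<omega> * t)\<close> by (simp add: FM)
        finally show ?thesis by (meson add_right_mono leD not_le_imp_less)
      qed
      then have "emeasure lborel {x. ennreal t < M x} \<le> emeasure lborel {x. ennreal t < hl_max ?G x}"
        by (intro emeasure_mono) auto
      also have "\<dots> \<le> ennreal (c / t) * (\<integral>\<^sup>+x. ?G x \<partial>lborel)"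
        unfolding c_def \<omega>_def using t by (intro hl_max_weak_type) auto
      finally show ?thesis .
    qed
    have "(\<integral>\<^sup>+x. epowr (M x) q \<partial>lborel) = (\<integral>\<^sup>+x. 1 * epowr (M x) q \<partial>lborel)" by simp
    also have "\<dots> = (\<integral>\<^sup>+t\<in>{0<..}. ennreal (q * t powr (q - 1)) * (\<integral>\<^sup>+x. 1 * indicator {x. ennreal t < M x} x \<partial>lborel) \<partial>lborel)"
      using q by (intro nn_integral_epowr_layer_cake lborel.sigma_finite_measure_axioms) auto
    \<comment> \<open>The factor \<open>c / t\<close> of the weak bound lowers the power of
      \<open>t\<close> by one. The constant is rearranged so that the layer-cake formula can be read
      backwards with exponent \<open>q - 1\<close> and weight \<open>F\<close>.\<close>
    also have "\<dots> \<le> (\<integral>\<^sup>+t. ennreal (c * q / (q - 1)) * (ennreal ((q - 1) * t powr (q - 1 - 1)) * (\<integral>\<^sup>+x. F x * indicator {x. ennreal t < F x} x \<partial>lborel) * indicator {0<..} t) \<partial>lborel)"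
    proof (rule nn_integral_mono)
      fix t :: real
      let ?J = "\<integral>\<^sup>+x. F x * indicator {x. ennreal t < F x} x \<partial>lborel"
      show "ennreal (q * t powr (q - 1)) * (\<integral>\<^sup>+x. 1 * indicator {x. ennreal t < M x} x \<partial>lborel) * indicator {0<..} t
        \<le> ennreal (c * q / (q - 1)) * (ennreal ((q - 1) * t powr (q - 1 - 1)) * ?J * indicator {0<..} t)"
      proof (cases "0 < t")
        case True
        have "(\<integral>\<^sup>+x. 1 * indicator {x. ennreal t < M x} x \<partial>lborel) = emeasure lborel {x. ennreal t < M x}" by simp
        then have "ennreal (q * t powr (q - 1)) * (\<integral>\<^sup>+x. 1 * indicator {x. ennreal t < M x} x \<partial>lborel)
          \<le> ennreal (q * t powr (q - 1)) * (ennreal (c / t) * ?J)"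
          using weak[OF True] by (intro mult_left_mono) auto
        also have "\<dots> = ennreal (q * t powr (q - 1) * (c / t)) * ?J"
          using q by (subst ennreal_mult') (auto simp: mult.assoc)
        also have "q * t powr (q - 1) * (c / t) = (c * q / (q - 1)) * ((q - 1) * t powr (q - 1 - 1))"
        proof -
          have "t powr (q - 1 - 1) = t powr (q - 1) / t" using True powr_diff[of t "q - 1" 1] by simp
          then show ?thesis using q by simp
        qed
        also have "ennreal ((c * q / (q - 1)) * ((q - 1) * t powr (q - 1 - 1))) = ennreal (c * q / (q - 1)) * ennreal ((q - 1) * t powr (q - 1 - 1))"
          using c q by (intro ennreal_mult) auto
        finally show ?thesis using True by (simp add: ac_simps)
      qed simp
    qed
    also have "\<dots> = ennreal (c * q / (q - 1)) * (\<integral>\<^sup>+t\<in>{0<..}. ennreal ((q - 1) * t powr (q - 1 - 1)) * (\<integral>\<^sup>+x. F x * indicator {x. ennreal t < F x} x \<partial>lborel) \<partial>lborel)"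
      by (intro nn_integral_cmult) measurable
    also have "\<dots> = ennreal (c * q / (q - 1)) * (\<integral>\<^sup>+x. F x * epowr (F x) (q - 1) \<partial>lborel)"
      using q by (subst nn_integral_epowr_layer_cake[OF lborel.sigma_finite_measure_axioms]) auto
    also have "(\<lambda>x. F x * epowr (F x) (q - 1)) = (\<lambda>x. epowr (F x) q)"
      using q epowr_add[of 1 "q - 1"] by (auto simp: fun_eq_iff)
    finally have *: "(\<integral>\<^sup>+x. epowr (M x) q \<partial>lborel) \<le> ennreal (c * q / (q - 1)) * (\<integral>\<^sup>+x. epowr (F x) q \<partial>lborel)" .
    have "(\<integral>\<^sup>+x. epowr (hl_max F x) q \<partial>lborel) = ennreal ((1 + \<omega>) powr q) * (\<integral>\<^sup>+x. epowr (M x) q \<partial>lborel)"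
      using \<omega> by (simp add: FM epowr_mult epowr_ennreal nn_integral_cmult del: ennreal_plus)
    also have "\<dots> \<le> ennreal ((1 + \<omega>) powr q) * (ennreal (c * q / (q - 1)) * (\<integral>\<^sup>+x. epowr (F x) q \<partial>lborel))"
      by (intro mult_left_mono *) auto
    also have "\<dots> = ennreal K * (\<integral>\<^sup>+x. epowr (F x) q \<partial>lborel)"
      unfolding K_def by (subst ennreal_mult') (auto simp: mult.assoc)
    finally show ?thesis .
  qed
  moreover have "0 \<le> K" using c q by (auto simp: K_def)
  ultimately show ?thesis by blast
qed

section \<open>Size kernels and the maximal function\<close>

lemma size_bound_nonneg: "0 \<le> size_bound \<alpha> t x y"
  by (simp add: size_bound_def)

lemma size_bound_measurable [measurable (raw)]:
  assumes [measurable]: "f \<in> borel_measurable M" "g \<in> borel_measurable M" "h \<in> borel_measurable M"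
  shows "(\<lambda>w. size_bound \<alpha> (h w) (f w) (g w)) \<in> borel_measurable M"
  unfolding size_bound_def by measurable

text \<open>The kernel is at most a sum of normalised indicators of balls of radii
  \<open>2 powr (k + j)\<close>, with coefficients decaying like
  \<open>2 powr (- \<alpha> * j)\<close>. Centring the balls at \<open>z\<close> instead of
  \<open>x\<close> is harmless as long as \<open>z\<close> stays within distance \<open>t\<close>;
  this freedom yields a bound at every point of a box, not only at its centre.\<close>

lemma size_bound_le_hl_max:
  assumes a: "0 < \<alpha>"
  shows "\<exists>K\<ge>0. \<forall>(F::real^'n::finite \<Rightarrow> ennreal) t x z. F \<in> borel_measurable borel \<longrightarrow> 0 < t \<longrightarrow> dist x z < t \<longrightarrow>
    (\<integral>\<^sup>+y. ennreal (size_bound \<alpha> t x y) * F y \<partial>lborel) \<le> ennreal K * hl_max F z"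
proof -
  define n where "n = real CARD('n)"
  \<comment> \<open>With \<open>v j\<close> as the normalisation of the ball of radius
    \<open>2 powr (k + j)\<close>, this is the factor left in \<open>(2 powr k) powr \<alpha> / (2
    powr (k + j - 1)) powr (n + \<alpha>) = c j * v j\<close>.\<close>
  define c where "c = (\<lambda>j::nat. 2 powr (n + \<alpha>) * (2 powr (- \<alpha>)) ^ j)"
  have "2 powr (- \<alpha>) < 1" using a powr_less_mono[of "- \<alpha>" 0 2] by simp
  then have sc: "summable c" unfolding c_def by (intro summable_mult summable_geometric) auto
  have c0: "0 \<le> c j" for j by (simp add: c_def)
  have "(\<integral>\<^sup>+y. ennreal (size_bound \<alpha> t x y) * F y \<partial>lborel) \<le> ennreal (suminf c) * hl_max F z"
    if [measurable]: "F \<in> borel_measurable borel" and t: "0 < t" and xz: "dist x z < t"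
    for F :: "real^'n \<Rightarrow> ennreal" and t x z
  proof -
    define k where "k = \<lceil>log 2 t\<rceil>"
    have k: "t \<le> 2 powr k" "2 powr (k - 1) \<le> t"
    proof -
      have "2 powr (log 2 t) \<le> 2 powr k" unfolding k_def by (intro powr_mono) auto
      then show "t \<le> 2 powr k" using t by simp
      have "2 powr (real_of_int k - 1) \<le> 2 powr (log 2 t)" unfolding k_def by (intro powr_mono) linarith+
      then show "2 powr (k - 1) \<le> t" using t by simp
    qed
    define R where "R = (\<lambda>j::nat. 2 powr real_of_int (k + int j) :: real)"
    define v where "v = (\<lambda>j::nat. 2 powr (- (real_of_int (k + int j) * DIM(real^'n))) :: real)"
    have R_0: "R 0 = 2 powr k" by (simp add: R_def)
    have R_Suc: "R (Suc j) = 2 * R j" for j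
    proof -
      have "R (Suc j) = 2 powr (real_of_int (k + int j) + 1)" unfolding R_def by (rule arg_cong) simp
      also have "\<dots> = 2 * R j" unfolding R_def powr_add by simp
      finally show ?thesis .
    qed
    have R_pow: "R j = 2 ^ j * R 0" for j by (induction j) (simp_all add: R_Suc)
    have R_pos: "0 < R j" for j by (simp add: R_def)
    have pt: "ennreal (size_bound \<alpha> t x y) \<le> (\<Sum>j. ennreal (c j) * ennreal (v j) * indicator (ball z (R j)) y)" for y
    proof -
      obtain i where "dist z y / R 0 < 2 ^ i" using real_arch_pow[of 2 "dist z y / R 0"] by auto
      then have "dist z y < R i" unfolding R_pow[of i] using R_pos[of 0] by (simp add: pos_divide_less_eq)
      then have "\<exists>j. dist z y < R j" ..
      then have "\<exists>j. dist z y < R j \<and> (\<forall>i<j. \<not> dist z y < R i)"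
        by (rule exists_least_iff[THEN iffD1])
      then obtain j where j: "dist z y < R j" "\<And>i. i < j \<Longrightarrow> \<not> dist z y < R i"
        by blast
      \<comment> \<open>Since \<open>j\<close> is the first index whose ball contains
        \<open>y\<close>, the preceding ball misses it, and \<open>R j / 2\<close> is the radius of
        that ball. For \<open>j = 0\<close> there is none, and the choice of \<open>k\<close> gives
        the bound by \<open>t\<close> instead.\<close>
      have d: "R j / 2 \<le> t + norm (x - y)"
      proof (cases j)
        case 0
        have "R 0 / 2 \<le> t" using k(2) unfolding R_0 by (simp add: powr_diff)
        then show ?thesis unfolding 0 using norm_ge_zero[of "x - y"] by linarith
      next
        case (Suc i)
        have "R i \<le> dist z y" using j(2)[of i] Suc by simp
        also have "\<dots> \<le> t + norm (x - y)"
          using xz dist_triangle[of z y x] dist_commute[of z x] dist_norm[of x y] by linarith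
        finally show ?thesis unfolding Suc R_Suc by simp
      qed
      have "size_bound \<alpha> t x y \<le> (2 powr k) powr \<alpha> / (R j / 2) powr (n + \<alpha>)"
        unfolding size_bound_def n_def using k(1) t a d R_pos[of j]
        by (intro frac_le powr_mono2) auto
      also have "\<dots> = c j * v j"
      proof -
        have 1: "(2 powr k) powr \<alpha> = 2 powr (k * \<alpha>)" by (simp add: powr_powr)
        have "R j / 2 = 2 powr (real_of_int (k + int j) - 1)" unfolding R_def powr_diff by simp
        then have 2: "(R j / 2) powr (n + \<alpha>) = 2 powr ((real_of_int (k + int j) - 1) * (n + \<alpha>))"
          by (simp only: powr_powr)
        have 3: "c j = 2 powr (n + \<alpha> + real j * (- \<alpha>))" 
          unfolding c_def powr_add by (simp add: powr_power)
        show ?thesis unfolding 1 2 3 v_def powr_diff[symmetric] powr_add[symmetric]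
          by (rule arg_cong) (simp add: n_def algebra_simps)
      qed
      finally have "ennreal (size_bound \<alpha> t x y) \<le> ennreal (c j) * ennreal (v j) * indicator (ball z (R j)) y"
        using j(1) c0 by (simp add: ennreal_leI flip: ennreal_mult')
      also have "\<dots> \<le> (\<Sum>j. ennreal (c j) * ennreal (v j) * indicator (ball z (R j)) y)"
      proof -
        have "f j \<le> suminf f" for f :: "nat \<Rightarrow> ennreal" using sum_le_suminf[of f "{j}"] by simp
        then show ?thesis .
      qed
      finally show ?thesis .
    qed
    have le_max: "ennreal (v j) * (\<integral>\<^sup>+y\<in>ball z (R j). F y \<partial>lborel) \<le> hl_max F z" for j
      unfolding v_def R_def by (rule le_hl_max)
    have "(\<integral>\<^sup>+y. ennreal (size_bound \<alpha> t x y) * F y \<partial>lborel)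
      \<le> (\<integral>\<^sup>+y. (\<Sum>j. ennreal (c j) * ennreal (v j) * (F y * indicator (ball z (R j)) y)) \<partial>lborel)"
    proof (rule nn_integral_mono)
      fix y
      have "ennreal (size_bound \<alpha> t x y) * F y \<le> (\<Sum>j. ennreal (c j) * ennreal (v j) * indicator (ball z (R j)) y) * F y"
        by (intro mult_right_mono pt) auto
      then show "ennreal (size_bound \<alpha> t x y) * F y \<le> (\<Sum>j. ennreal (c j) * ennreal (v j) * (F y * indicator (ball z (R j)) y))"
        by (simp add: ac_simps flip: ennreal_suminf_multc)
    qed
    also have "\<dots> = (\<Sum>j. \<integral>\<^sup>+y. ennreal (c j) * ennreal (v j) * (F y * indicator (ball z (R j)) y) \<partial>lborel)"
      by (intro nn_integral_suminf) measurable
    also have "\<dots> = (\<Sum>j. ennreal (c j) * (ennreal (v j) * (\<integral>\<^sup>+y\<in>ball z (R j). F y \<partial>lborel)))"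
      by (subst nn_integral_cmult) (auto simp: mult.assoc)
    also have "\<dots> \<le> (\<Sum>j. ennreal (c j) * hl_max F z)"
      by (intro suminf_le mult_left_mono le_max) auto
    also have "\<dots> = ennreal (suminf c) * hl_max F z"
      using sc c0 by (simp add: ennreal_suminf_multc suminf_ennreal2)
    finally show ?thesis .
  qed
  moreover have "0 \<le> suminf c" using sc c0 by (intro suminf_nonneg) auto
  ultimately show ?thesis by blast
qed

lemma hl_max_const_one: "hl_max (\<lambda>_. 1) (x::'a::euclidean_space) \<le> ennreal (unit_ball_vol (DIM('a)))"
  using hl_max_le_add[of "\<lambda>_. 1" "\<lambda>_. 0" 1 x] by (simp add: hl_max_def[of "\<lambda>_. 0"])

text \<open>The maximal function of the constant 1 is bounded, so the preceding estimate with this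
  function gives a bound uniform in the scale.\<close>

lemma size_bound_integral:
  assumes a: "0 < \<alpha>"
  shows "\<exists>K\<ge>0. \<forall>t (x::real^'n::finite). 0 < t \<longrightarrow> (\<integral>\<^sup>+y. ennreal (size_bound \<alpha> t x y) \<partial>lborel) \<le> ennreal K"
proof -
  obtain K where K: "0 \<le> K" "\<And>(F::real^'n \<Rightarrow> ennreal) t x z. F \<in> borel_measurable borel \<Longrightarrow> 0 < t \<Longrightarrow> dist x z < t \<Longrightarrow>
    (\<integral>\<^sup>+y. ennreal (size_bound \<alpha> t x y) * F y \<partial>lborel) \<le> ennreal K * hl_max F z"
    using size_bound_le_hl_max[OF a, where 'n='n] by blast
  have "(\<integral>\<^sup>+y. ennreal (size_bound \<alpha> t x y) \<partial>lborel) \<le> ennreal (K * unit_ball_vol (DIM(real^'n)))"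
    if "0 < t" for t and x :: "real^'n"
  proof -
    have "(\<integral>\<^sup>+y. ennreal (size_bound \<alpha> t x y) * 1 \<partial>lborel) \<le> ennreal K * hl_max (\<lambda>_. 1) x"
      using that by (intro K) auto
    also have "\<dots> \<le> ennreal K * ennreal (unit_ball_vol (DIM(real^'n)))"
      by (intro mult_left_mono hl_max_const_one) auto
    finally show ?thesis using K(1) by (simp add: ennreal_mult)
  qed
  then show ?thesis using K(1) by (intro exI[of _ "K * unit_ball_vol (DIM(real^'n))"]) auto
qed

section \<open>Interaction of boxes\<close>

lemma borel_measurable_continuous_compose:
  assumes "g \<in> borel_measurable borel" and "continuous_on UNIV f"
  shows "(\<lambda>x. g (f x)) \<in> borel_measurable borel"
  by (rule measurable_compose[OF borel_measurable_continuous_onI[OF assms(2)] assms(1)])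

lemma borel_measurable_fst_snd [measurable]:
  "fst \<in> borel_measurable (borel :: ('a::second_countable_topology \<times> 'b::second_countable_topology) measure)"
  "snd \<in> borel_measurable (borel :: ('a \<times> 'b) measure)"
  by (auto intro!: borel_measurable_continuous_onI continuous_intros)

lemma powr_quotient: "0 < s \<Longrightarrow> 0 < t \<Longrightarrow> (s / t) powr a = s powr a * t powr (- a)" for s t a :: real
  by (simp add: powr_divide powr_minus_divide)

text \<open>The measure \<open>dx dt / t\<close>. It lives on the whole space with density 0 at
  nonpositive times, so positivity of \<open>snd Y\<close> is available almost everywhere. A point
  \<open>Y\<close> stands for the ball of centre \<open>fst Y\<close> and radius
  \<open>snd Y\<close>.\<close>

definition upper :: "('a::euclidean_space \<times> real) measure" where
  "upper = density lborel (\<lambda>Y. ennreal (if 0 < snd Y then 1 / snd Y else 0))"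

lemma space_upper [simp]: "space upper = UNIV"
  and sets_upper [simp, measurable_cong]: "sets upper = sets borel"
  by (simp_all add: upper_def)

lemma nn_integral_upper:
  assumes [measurable]: "h \<in> borel_measurable borel"
  shows "(\<integral>\<^sup>+Y. h Y \<partial>(upper :: ('a::euclidean_space \<times> real) measure)) = (\<integral>\<^sup>+x. (\<integral>\<^sup>+t\<in>{0<..}. ennreal (1 / t) * h (x, t) \<partial>lborel) \<partial>lborel)"
    and nn_integral_upper_swap: "(\<integral>\<^sup>+Y. h Y \<partial>(upper :: ('a \<times> real) measure)) = (\<integral>\<^sup>+t\<in>{0<..}. ennreal (1 / t) * (\<integral>\<^sup>+x. h (x, t) \<partial>lborel) \<partial>lborel)"
proof -
  have [measurable]: "h \<in> borel_measurable (borel \<Otimes>\<^sub>M borel)" by (simp add: borel_prod)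
  have *: "(\<integral>\<^sup>+Y. h Y \<partial>(upper :: ('a \<times> real) measure)) = (\<integral>\<^sup>+Y. ennreal (if 0 < snd Y then 1 / snd Y else 0) * h Y \<partial>(lborel \<Otimes>\<^sub>M lborel))"
    unfolding upper_def by (subst nn_integral_density) (auto simp: lborel_prod)
  show "(\<integral>\<^sup>+Y. h Y \<partial>(upper :: ('a \<times> real) measure)) = (\<integral>\<^sup>+x. (\<integral>\<^sup>+t\<in>{0<..}. ennreal (1 / t) * h (x, t) \<partial>lborel) \<partial>lborel)"
    unfolding * by (subst lborel.nn_integral_fst[symmetric]) (auto intro!: nn_integral_cong split: split_indicator)
  have "(\<integral>\<^sup>+Y. h Y \<partial>(upper :: ('a \<times> real) measure)) = (\<integral>\<^sup>+t. (\<integral>\<^sup>+x. ennreal (if 0 < t then 1 / t else 0) * h (x, t) \<partial>lborel) \<partial>lborel)"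
    unfolding * by (subst lborel_pair.nn_integral_snd[symmetric]) (measurable, simp only: snd_conv)
  also have "\<dots> = (\<integral>\<^sup>+t\<in>{0<..}. ennreal (1 / t) * (\<integral>\<^sup>+x. h (x, t) \<partial>lborel) \<partial>lborel)"
    by (intro nn_integral_cong) (auto simp: nn_integral_cmult split: split_indicator)
  finally show "(\<integral>\<^sup>+Y. h Y \<partial>(upper :: ('a \<times> real) measure)) = (\<integral>\<^sup>+t\<in>{0<..}. ennreal (1 / t) * (\<integral>\<^sup>+x. h (x, t) \<partial>lborel) \<partial>lborel)" .
qed

lemma sigma_finite_upper: "sigma_finite_measure upper"
  unfolding upper_def by (subst sigma_finite_measure.sigma_finite_iff_density_finite[OF lborel.sigma_finite_measure_axioms]) auto

interpretation upper: sigma_finite_measure upper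
  by (rule sigma_finite_upper)

lemma AE_upper: "AE Y in upper. 0 < snd Y"
  unfolding upper_def by (subst AE_density) auto

lemma nn_integral_powr_0_closed:
  assumes a: "0 < a" and c: "0 < c"
  shows "(\<integral>\<^sup>+t. ennreal (t powr (a - 1)) * indicator {0<..c} t \<partial>lborel) = ennreal (c powr a / a)"
proof -
  have "(\<integral>\<^sup>+t. ennreal (t powr (a - 1)) * indicator {0<..c} t \<partial>lborel)
    = (\<integral>\<^sup>+t. ennreal (1 / a) * (ennreal (a * t powr (a - 1)) * indicator {0<..<c} t) \<partial>lborel)"
  proof (rule nn_integral_cong_AE)
    have "AE t in lborel. t \<noteq> c" by (rule AE_lborel_singleton)
    then show "AE t in lborel. ennreal (t powr (a - 1)) * indicator {0<..c} t = ennreal (1 / a) * (ennreal (a * t powr (a - 1)) * indicator {0<..<c} t)"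
      by eventually_elim (use a in \<open>auto simp flip: ennreal_mult split: split_indicator\<close>)
  qed
  also have "\<dots> = ennreal (1 / a) * ennreal (c powr a)"
    by (subst nn_integral_cmult) (auto simp: nn_integral_powr_0 a c)
  finally show ?thesis using a by (simp flip: ennreal_mult)
qed

text \<open>Since \<open>u\<^sup>e \<le> 1 + u\<close> for \<open>u = (t / snd Y)\<^sup>n a\<close>, the power \<open>a\<^sup>e\<close> gains a factor
  \<open>(\<tau> / t)\<close> to the power \<open>n e\<close> over the trivial bound \<open>t\<^sup>n\<close>.\<close>

lemma epowr_small_scales:
  fixes e C t \<tau> :: real and a :: "'a::euclidean_space \<times> real \<Rightarrow> ennreal"
  assumes [measurable]: "a \<in> borel_measurable borel"
    and e: "0 < e" "e < 1"
    and C: "(\<integral>\<^sup>+Y. a Y * ennreal (1 / snd Y ^ DIM('a)) \<partial>upper) \<le> ennreal C" "0 \<le> C"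
    and t: "0 < \<tau>" "\<tau> \<le> t"
  shows "(\<integral>\<^sup>+Y. epowr (a Y) e * indicator {Y. snd Y \<le> \<tau> \<and> dist x (fst Y) < 2 * t} Y \<partial>upper)
    \<le> ennreal ((C + 2 ^ DIM('a) * unit_ball_vol (DIM('a)) / (DIM('a) * e)) * (t ^ DIM('a) * (\<tau> / t) powr (DIM('a) * e)))"
proof -
  define n where "n = DIM('a)"
  define \<omega> where "\<omega> = unit_ball_vol n"
  have n: "0 < n" by (simp add: n_def)
  have \<omega>: "0 \<le> \<omega>" by (simp add: \<omega>_def)
  have ne: "0 < n * e" using n e by simp
  let ?I = "\<lambda>Y::'a \<times> real. indicator {Y. snd Y \<le> \<tau> \<and> dist x (fst Y) < 2 * t} Y :: ennreal"
  have [measurable]: "?I \<in> borel_measurable borel" by (intro borel_measurable_indicator) measurable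
  have pt: "epowr (a Y) e * ?I Y \<le> ennreal ((snd Y / t) powr (n * e)) * ?I Y + ennreal ((\<tau> / t) powr (n * e) * t ^ n) * (a Y * ennreal (1 / snd Y ^ n))"
    if Y: "0 < snd Y" for Y
  proof (cases "snd Y \<le> \<tau> \<and> dist x (fst Y) < 2 * t")
    case True
    define s where "s = snd Y"
    have s: "0 < s" "s \<le> \<tau>" using True Y by (auto simp: s_def)
    have "a Y = ennreal ((s / t) ^ n) * (ennreal ((t / s) ^ n) * a Y)"
      using s t by (simp add: mult.assoc[symmetric] power_divide flip: ennreal_mult)
    then have "epowr (a Y) e = epowr (ennreal ((s / t) ^ n)) e * epowr (ennreal ((t / s) ^ n) * a Y) e"
      by (metis epowr_mult)
    also have "epowr (ennreal ((s / t) ^ n)) e = ennreal ((s / t) powr (n * e))"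
      using s t by (simp add: epowr_ennreal powr_powr flip: powr_realpow)
    also have "ennreal ((s / t) powr (n * e)) * epowr (ennreal ((t / s) ^ n) * a Y) e
        \<le> ennreal ((s / t) powr (n * e)) * (1 + ennreal ((t / s) ^ n) * a Y)"
      using e by (intro mult_left_mono epowr_le_one_plus) auto
    also have "\<dots> = ennreal ((s / t) powr (n * e)) + ennreal ((s / t) powr (n * e)) * (ennreal ((t / s) ^ n) * a Y)"
      by (simp add: distrib_left)
    also have "\<dots> \<le> ennreal ((s / t) powr (n * e)) + ennreal ((\<tau> / t) powr (n * e)) * (ennreal ((t / s) ^ n) * a Y)"
      using s t e by (intro add_left_mono mult_right_mono ennreal_leI powr_mono2) (auto simp: divide_right_mono)
    also have "ennreal ((\<tau> / t) powr (n * e)) * (ennreal ((t / s) ^ n) * a Y) = ennreal ((\<tau> / t) powr (n * e) * t ^ n) * (a Y * ennreal (1 / s ^ n))"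
      using s t by (simp add: ennreal_mult' divide_inverse power_mult_distrib power_inverse ac_simps)
    finally show ?thesis using True by (simp add: s_def)
  qed auto
  have "(\<integral>\<^sup>+Y. epowr (a Y) e * ?I Y \<partial>upper)
    \<le> (\<integral>\<^sup>+Y. ennreal ((snd Y / t) powr (n * e)) * ?I Y + ennreal ((\<tau> / t) powr (n * e) * t ^ n) * (a Y * ennreal (1 / snd Y ^ n)) \<partial>upper)"
    using AE_upper by (intro nn_integral_mono_AE) (auto elim!: eventually_mono intro: pt)
  also have "\<dots> = (\<integral>\<^sup>+Y. ennreal ((snd Y / t) powr (n * e)) * ?I Y \<partial>upper) + ennreal ((\<tau> / t) powr (n * e) * t ^ n) * (\<integral>\<^sup>+Y. a Y * ennreal (1 / snd Y ^ n) \<partial>upper)"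
    by (simp add: nn_integral_add nn_integral_cmult)
  \<comment> \<open>The first constant is the integral of \<open>(s / t) powr (n * e) / s\<close>
    over \<open>s \<le> \<tau>\<close>, convergent because \<open>n * e > 0\<close>, times the
    volume of a ball of radius \<open>2 * t\<close>. The second term is the hypothesis on
    \<open>a\<close>.\<close>
  also have "\<dots> \<le> ennreal (2 ^ n * \<omega> / (n * e) * (t ^ n * (\<tau> / t) powr (n * e))) + ennreal ((\<tau> / t) powr (n * e) * t ^ n) * ennreal C"
  proof (intro add_mono mult_left_mono)
    have "(\<integral>\<^sup>+Y. ennreal ((snd Y / t) powr (n * e)) * ?I Y \<partial>upper)
      = (\<integral>\<^sup>+s\<in>{0<..}. ennreal (1 / s) * (\<integral>\<^sup>+y. ennreal ((s / t) powr (n * e)) * ?I (y, s) \<partial>lborel) \<partial>lborel)"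
      by (subst nn_integral_upper_swap) auto
    also have "\<dots> = (\<integral>\<^sup>+s. ennreal (t powr (- (n * e)) * (\<omega> * (2 * t) ^ n)) * (ennreal (s powr (n * e - 1)) * indicator {0<..\<tau>} s) \<partial>lborel)"
    proof (rule nn_integral_cong)
      fix s :: real
      show "ennreal (1 / s) * (\<integral>\<^sup>+y. ennreal ((s / t) powr (n * e)) * ?I (y, s) \<partial>lborel) * indicator {0<..} s
        = ennreal (t powr (- (n * e)) * (\<omega> * (2 * t) ^ n)) * (ennreal (s powr (n * e - 1)) * indicator {0<..\<tau>} s)"
      proof (cases "0 < s \<and> s \<le> \<tau>")
        case True
        have "(\<integral>\<^sup>+y. ennreal ((s / t) powr (n * e)) * ?I (y, s) \<partial>lborel) = (\<integral>\<^sup>+y. ennreal ((s / t) powr (n * e)) * indicator (ball x (2 * t)) y \<partial>lborel)"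
          using True by (intro nn_integral_cong) (auto split: split_indicator)
        also have "\<dots> = ennreal ((s / t) powr (n * e)) * ennreal (\<omega> * (2 * t) ^ n)"
          using t by (simp add: nn_integral_cmult emeasure_ball_DIM \<omega>_def n_def)
        finally have "ennreal (1 / s) * (\<integral>\<^sup>+y. ennreal ((s / t) powr (n * e)) * ?I (y, s) \<partial>lborel)
          = ennreal (1 / s * ((s / t) powr (n * e) * (\<omega> * (2 * t) ^ n)))"
          using True by (subst ennreal_mult') (auto simp: ennreal_mult')
        also have "1 / s * ((s / t) powr (n * e) * (\<omega> * (2 * t) ^ n)) = t powr (- (n * e)) * (\<omega> * (2 * t) ^ n) * s powr (n * e - 1)"
          using True t by (simp add: powr_quotient powr_diff)
        finally show ?thesis using True t \<omega> by (simp add: ennreal_mult')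
      qed (auto split: split_indicator)
    qed
    also have "\<dots> = ennreal (t powr (- (n * e)) * (\<omega> * (2 * t) ^ n)) * ennreal (\<tau> powr (n * e) / (n * e))"
      using nn_integral_powr_0_closed[OF ne t(1)] by (simp add: nn_integral_cmult)
    also have "\<dots> = ennreal (2 ^ n * \<omega> / (n * e) * (t ^ n * (\<tau> / t) powr (n * e)))"
      using t \<omega> by (subst ennreal_mult'[symmetric]) (auto simp: powr_quotient power_mult_distrib ac_simps)
    finally show "(\<integral>\<^sup>+Y. ennreal ((snd Y / t) powr (n * e)) * ?I Y \<partial>upper) \<le> ennreal (2 ^ n * \<omega> / (n * e) * (t ^ n * (\<tau> / t) powr (n * e)))"
      by simp
    show "(\<integral>\<^sup>+Y. a Y * ennreal (1 / snd Y ^ n) \<partial>upper) \<le> ennreal C" using C by (simp add: n_def)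
  qed auto
  also have "\<dots> = ennreal ((C + 2 ^ n * \<omega> / (n * e)) * (t ^ n * (\<tau> / t) powr (n * e)))"
    using t \<omega> C ne e by (subst ennreal_mult'[symmetric], simp, subst ennreal_plus[symmetric]) (auto simp: algebra_simps)
  finally show ?thesis by (simp add: n_def \<omega>_def)
qed

abbreviation ball_overlap :: "'a::euclidean_space \<Rightarrow> real \<Rightarrow> 'a \<Rightarrow> real \<Rightarrow> ennreal" where
  "ball_overlap x t y u \<equiv> \<integral>\<^sup>+z. indicator (ball x t) z * indicator (ball y u) z \<partial>lborel"

lemma ball_overlap_le:
  fixes x x' :: "'a::euclidean_space"
  assumes "0 \<le> t" "0 \<le> t'"
  shows "(ball_overlap x t x' t')
    \<le> ennreal (unit_ball_vol (DIM('a)) * min t t' ^ DIM('a)) * indicator {y. dist x y < t + t'} x'"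
proof (cases "dist x x' < t + t'")
  case True
  have *: "ball_overlap x t x' t' \<le> emeasure lborel (ball y s)"
    if "(y, s) \<in> {(x, t), (x', t')}" for y s
  proof -
    have "ball_overlap x t x' t' \<le> (\<integral>\<^sup>+z. indicator (ball y s) z \<partial>lborel)"
      using that by (intro nn_integral_mono) (auto split: split_indicator)
    then show ?thesis by simp
  qed
  show ?thesis
    using *[of x t] *[of x' t'] True assms by (auto simp: min_def emeasure_ball_DIM)
next
  case False
  have "(indicator (ball x t) z * indicator (ball x' t') z :: ennreal) = 0" for z
    using False dist_triangle[of x x' z] by (auto simp: dist_commute split: split_indicator)
  then have "ball_overlap x t x' t' = (\<integral>\<^sup>+z. 0 \<partial>(lborel :: 'a measure))"
    by (intro nn_integral_cong)
  then show ?thesis by simp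
qed

text \<open>At a fixed scale \<open>s\<close>, integrating the overlap over the centres and dividing
  by \<open>s ^ m\<close> gives at most
  \<open>\<omega>\<^sup>2 * (min t s * (t + s) / s) ^ m\<close>, and the base is at most
  \<open>2 * t\<close> whichever radius is larger. Nothing but the factor with exponent
  \<open>d\<close> then makes the integral over scales converge, with \<open>1 / d\<close> from each
  side of \<open>t\<close>.\<close>

lemma nn_integral_upper_overlap:
  fixes x :: "'b::euclidean_space"
  assumes t: "0 < t" and d: "0 < d"
  shows "(\<integral>\<^sup>+Y. ennreal (1 / snd Y ^ DIM('b) * (min (snd Y / t) (t / snd Y)) powr d) *
      (ball_overlap x t (fst Y) (snd Y)) \<partial>upper)
    \<le> ennreal ((unit_ball_vol (DIM('b)))\<^sup>2 * 2 ^ DIM('b) * (2 / d) * t ^ DIM('b))"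
proof -
  define m where "m = DIM('b)"
  define \<omega> where "\<omega> = unit_ball_vol m"
  have \<omega>: "0 \<le> \<omega>" by (simp add: \<omega>_def)
  define c where "c = \<omega>\<^sup>2 * (2 * t) ^ m"
  have c: "0 \<le> c" using t by (simp add: c_def)
  let ?\<mu> = "\<lambda>s. min (s / t) (t / s) powr d"
  let ?O = "\<lambda>Y. (ball_overlap x t (fst Y) (snd Y)) :: ennreal"
  have inner: "ennreal (1 / s) * (\<integral>\<^sup>+y. ennreal (1 / s ^ m * ?\<mu> s) * ?O (y, s) \<partial>lborel)
      \<le> ennreal (1 / s * ?\<mu> s) * ennreal c" if s: "0 < s" for s
  proof -
    have "(\<integral>\<^sup>+y. ennreal (1 / s ^ m * ?\<mu> s) * ?O (y, s) \<partial>lborel)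
      \<le> (\<integral>\<^sup>+y. ennreal (1 / s ^ m * ?\<mu> s) * (ennreal (\<omega> * min t s ^ m) * indicator (ball x (t + s)) y) \<partial>lborel)"
      using ball_overlap_le[of t s x] s t
      by (intro nn_integral_mono mult_left_mono) (auto simp: \<omega>_def m_def ball_def)
    also have "\<dots> = ennreal (1 / s ^ m * ?\<mu> s) * (ennreal (\<omega> * min t s ^ m) * ennreal (\<omega> * (t + s) ^ m))"
      using s t by (simp add: nn_integral_cmult emeasure_ball_DIM \<omega>_def m_def)
    also have "\<dots> = ennreal (?\<mu> s * (\<omega>\<^sup>2 * (min t s * (t + s) / s) ^ m))"
      using s t \<omega> by (simp add: power_mult_distrib power_divide power2_eq_square ac_simps flip: ennreal_mult')
    also have "\<dots> \<le> ennreal (?\<mu> s * c)"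
    proof -
      have "min t s * (t + s) / s \<le> 2 * t"
      proof (cases "t \<le> s")
        case True
        then have "t * (t + s) \<le> t * (2 * s)" using t by (intro mult_left_mono) auto
        then show ?thesis using True s by (simp add: min_def field_simps)
      next
        case False
        then show ?thesis using s by (simp add: min_def)
      qed
      moreover have "0 \<le> min t s * (t + s) / s" using s t by simp
      ultimately show ?thesis unfolding c_def
        using s t by (intro ennreal_leI mult_left_mono power_mono) auto
    qed
    finally have "ennreal (1 / s) * (\<integral>\<^sup>+y. ennreal (1 / s ^ m * ?\<mu> s) * ?O (y, s) \<partial>lborel) \<le> ennreal (1 / s) * ennreal (?\<mu> s * c)"
      by (intro mult_left_mono) auto
    then show ?thesis using s c by (simp add: mult.assoc flip: ennreal_mult')
  qed
  have "(\<integral>\<^sup>+Y. ennreal (1 / snd Y ^ m * ?\<mu> (snd Y)) * ?O Y \<partial>upper)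
    = (\<integral>\<^sup>+s\<in>{0<..}. ennreal (1 / s) * (\<integral>\<^sup>+y. ennreal (1 / s ^ m * ?\<mu> s) * ?O (y, s) \<partial>lborel) \<partial>lborel)"
    by (subst nn_integral_upper_swap) auto
  also have "\<dots> \<le> (\<integral>\<^sup>+s. ennreal (1 / s * ?\<mu> s) * ennreal c * indicator {0<..} s \<partial>lborel)"
    using inner by (intro nn_integral_mono) (auto split: split_indicator)
  also have "\<dots> \<le> (\<integral>\<^sup>+s. ennreal (c * t powr (- d)) * (ennreal (s powr (d - 1)) * indicator {0<..t} s)
      + ennreal (c * t powr d / d) * (ennreal (d * s powr (- d - 1)) * indicator {t..} s) \<partial>lborel)"
  proof (rule nn_integral_mono)
    fix s :: real
    show "ennreal (1 / s * ?\<mu> s) * ennreal c * indicator {0<..} s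
      \<le> ennreal (c * t powr (- d)) * (ennreal (s powr (d - 1)) * indicator {0<..t} s)
      + ennreal (c * t powr d / d) * (ennreal (d * s powr (- d - 1)) * indicator {t..} s)"
    proof (cases "0 < s")
      case True
      have eq: "ennreal (1 / s * ?\<mu> s) * ennreal c = ennreal (1 / s * ?\<mu> s * c)"
        by (rule ennreal_mult''[OF c, symmetric])
      show ?thesis
      proof (cases "s \<le> t")
        case le: True
        have "1 / s * ?\<mu> s * c \<le> 1 / s * (s / t) powr d * c"
          using True t d c by (intro mult_right_mono mult_left_mono powr_mono2) auto
        also have "\<dots> = c * t powr (- d) * s powr (d - 1)"
          using True t by (simp add: powr_quotient powr_diff)
        finally have "ennreal (1 / s * ?\<mu> s * c) \<le> ennreal (c * t powr (- d) * s powr (d - 1))" by (rule ennreal_leI)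
        also have "\<dots> = ennreal (c * t powr (- d)) * ennreal (s powr (d - 1))"
          using c by (intro ennreal_mult) auto
        finally show ?thesis unfolding eq using le True by (simp add: add_increasing2)
      next
        case False
        have "1 / s * ?\<mu> s * c \<le> 1 / s * (t / s) powr d * c"
          using True t d c by (intro mult_right_mono mult_left_mono powr_mono2) auto
        also have "\<dots> = c * t powr d / d * (d * s powr (- d - 1))"
          using True t d by (simp add: powr_quotient powr_diff)
        finally have "ennreal (1 / s * ?\<mu> s * c) \<le> ennreal (c * t powr d / d * (d * s powr (- d - 1)))" by (rule ennreal_leI)
        also have "\<dots> = ennreal (c * t powr d / d) * ennreal (d * s powr (- d - 1))"
          using c d by (intro ennreal_mult) auto
        finally show ?thesis unfolding eq using False True by simp
      qed
    qed simp
  qed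
  also have "\<dots> = ennreal (c * t powr (- d)) * ennreal (t powr d / d) + ennreal (c * t powr d / d) * ennreal (t powr (- d))"
    using nn_integral_powr_0_closed[OF d t] nn_integral_powr_top[OF d t]
    by (simp add: nn_integral_add nn_integral_cmult)
  also have "\<dots> = ennreal (\<omega>\<^sup>2 * 2 ^ m * (2 / d) * t ^ m)"
    using t c d by (simp add: c_def powr_minus field_simps power_mult_distrib flip: ennreal_mult ennreal_plus)
  finally show ?thesis by (simp add: m_def \<omega>_def)
qed

text \<open>The hypothesis lives on fibres with fixed \<open>Y2\<close>. In the range of \<open>Y1\<close> selected by the conditional,
  the gain in \<open>epowr_small_scales\<close> is at least \<open>min (snd Y2 / t2) (t2 / snd Y2)\<close> to a positive power, and
  therefore summable over the scales of \<open>Y2\<close>.\<close>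

lemma carleson_interaction:
  fixes A :: "('a::euclidean_space \<times> real) \<times> ('b::euclidean_space \<times> real) \<Rightarrow> ennreal"
  assumes [measurable]: "A \<in> borel_measurable borel"
    and e: "0 < e" "e < 1" and C: "0 \<le> C"
    and h: "AE Y2 in upper. (\<integral>\<^sup>+Y1. A (Y1, Y2) * ennreal (1 / snd Y1 ^ DIM('a)) \<partial>upper) \<le> ennreal C"
  shows "\<exists>K\<ge>0. \<forall>x1 t1 x2 t2. 0 < t1 \<longrightarrow> 0 < t2 \<longrightarrow>
    (\<integral>\<^sup>+Y2. (\<integral>\<^sup>+Y1. epowr (A (Y1, Y2)) e * ennreal (1 / (snd Y1 ^ DIM('a) * snd Y2 ^ DIM('b))) *
        ((ball_overlap x1 t1 (fst Y1) (snd Y1)) *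
         (ball_overlap x2 t2 (fst Y2) (snd Y2))) *
        (if snd Y1 * t2 \<le> t1 * snd Y2 \<and> snd Y1 * snd Y2 \<le> t1 * t2 then 1 else 0) \<partial>upper) \<partial>upper)
    \<le> ennreal (K * (t1 ^ DIM('a) * t2 ^ DIM('b)))"
proof -
  define n where "n = DIM('a)"
  define m where "m = DIM('b)"
  define c where "c = C + 2 ^ n * unit_ball_vol n / (n * e)"
  define \<omega> where "\<omega> = unit_ball_vol n"
  define d where "d = n * e"
  have d: "0 < d" using e by (simp add: d_def n_def)
  have c: "0 \<le> c" using C e by (simp add: c_def)
  have \<omega>: "0 \<le> \<omega>" by (simp add: \<omega>_def)
  \<comment> \<open>The overlap in the first variable is at most
    \<open>\<omega> * snd Y1 ^ n\<close>, which cancels the normalisation of the first ball. The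
    factor \<open>c\<close> comes from \<open>epowr_small_scales\<close>, the rest from
    \<open>nn_integral_upper_overlap\<close>.\<close>
  define K where "K = \<omega> * c * ((unit_ball_vol m)\<^sup>2 * 2 ^ m * (2 / d))"
  have K: "0 \<le> K" using \<omega> c d by (simp add: K_def)
  have [measurable]: "A \<in> borel_measurable (borel \<Otimes>\<^sub>M borel)" by (simp add: borel_prod)
  have "(\<integral>\<^sup>+Y2. (\<integral>\<^sup>+Y1. epowr (A (Y1, Y2)) e * ennreal (1 / (snd Y1 ^ n * snd Y2 ^ m)) *
        ((ball_overlap x1 t1 (fst Y1) (snd Y1)) *
         (ball_overlap x2 t2 (fst Y2) (snd Y2))) *
        (if snd Y1 * t2 \<le> t1 * snd Y2 \<and> snd Y1 * snd Y2 \<le> t1 * t2 then 1 else 0) \<partial>upper) \<partial>upper)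
    \<le> ennreal (K * (t1 ^ n * t2 ^ m))"
    if t: "0 < t1" "0 < t2" for x1 t1 x2 t2
  proof -
    let ?O1 = "\<lambda>Y::'a \<times> real. (ball_overlap x1 t1 (fst Y) (snd Y)) :: ennreal"
    let ?O2 = "\<lambda>Y::'b \<times> real. (ball_overlap x2 t2 (fst Y) (snd Y)) :: ennreal"
    let ?\<mu> = "\<lambda>s. min (s / t2) (t2 / s)"
    let ?f = "\<lambda>Y2 Y1. epowr (A (Y1, Y2)) e * ennreal (1 / (snd Y1 ^ n * snd Y2 ^ m)) * (?O1 Y1 * ?O2 Y2) *
        (if snd Y1 * t2 \<le> t1 * snd Y2 \<and> snd Y1 * snd Y2 \<le> t1 * t2 then 1 else 0)"
    have inner: "(\<integral>\<^sup>+Y1. ?f Y2 Y1 \<partial>upper) \<le> ennreal (\<omega> * c * t1 ^ n) * (ennreal (1 / snd Y2 ^ m * ?\<mu> (snd Y2) powr d) * ?O2 Y2)"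
      if Y2: "0 < snd Y2" and h: "(\<integral>\<^sup>+Y1. A (Y1, Y2) * ennreal (1 / snd Y1 ^ n) \<partial>upper) \<le> ennreal C" for Y2
    proof -
      \<comment> \<open>The largest value of \<open>snd Y1\<close> that the conditional admits. It
        is at most \<open>t1\<close>, so the first ball of the pair is the smaller one and must be
        centred within \<open>2 * t1\<close> of \<open>x1\<close> to meet the other.\<close>
      define \<tau> where "\<tau> = t1 * ?\<mu> (snd Y2)"
      have \<mu>: "0 < ?\<mu> (snd Y2)" "?\<mu> (snd Y2) \<le> 1"
        using t Y2 by (cases "snd Y2 \<le> t2"; simp add: min_le_iff_disj)+
      then have \<tau>: "0 < \<tau>" "\<tau> \<le> t1" using t by (auto simp: \<tau>_def mult_left_le)
      have pt: "?f Y2 Y1 \<le> (ennreal (\<omega> / snd Y2 ^ m) * ?O2 Y2) * (epowr (A (Y1, Y2)) e * indicator {Y. snd Y \<le> \<tau> \<and> dist x1 (fst Y) < 2 * t1} Y1)"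
        if Y1: "0 < snd Y1" for Y1
      proof (cases "snd Y1 * t2 \<le> t1 * snd Y2 \<and> snd Y1 * snd Y2 \<le> t1 * t2")
        case True
        then have le: "snd Y1 \<le> \<tau>" using t Y2 by (auto simp: \<tau>_def min_def field_simps)
        then have "min t1 (snd Y1) = snd Y1" using \<tau> by auto
        then have "?O1 Y1 \<le> ennreal (\<omega> * snd Y1 ^ n) * indicator {y. dist x1 y < t1 + snd Y1} (fst Y1)"
          using ball_overlap_le[of t1 "snd Y1" x1 "fst Y1"] t Y1 by (simp add: \<omega>_def n_def)
        also have "\<dots> \<le> ennreal (\<omega> * snd Y1 ^ n) * indicator {Y. snd Y \<le> \<tau> \<and> dist x1 (fst Y) < 2 * t1} Y1"
          using le \<tau> by (intro mult_left_mono) (auto split: split_indicator)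
        finally have "?f Y2 Y1 \<le> epowr (A (Y1, Y2)) e * ennreal (1 / (snd Y1 ^ n * snd Y2 ^ m)) * ((ennreal (\<omega> * snd Y1 ^ n) * indicator {Y. snd Y \<le> \<tau> \<and> dist x1 (fst Y) < 2 * t1} Y1) * ?O2 Y2) * 1"
          by (intro mult_mono) auto
        also have "\<dots> = (ennreal (1 / (snd Y1 ^ n * snd Y2 ^ m)) * ennreal (\<omega> * snd Y1 ^ n)) * ?O2 Y2 * (epowr (A (Y1, Y2)) e * indicator {Y. snd Y \<le> \<tau> \<and> dist x1 (fst Y) < 2 * t1} Y1)"
          by (simp add: ac_simps)
        also have "ennreal (1 / (snd Y1 ^ n * snd Y2 ^ m)) * ennreal (\<omega> * snd Y1 ^ n) = ennreal (\<omega> / snd Y2 ^ m)"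
          using Y1 Y2 by (subst ennreal_mult'[symmetric]) auto
        finally show ?thesis .
      qed auto
      have "(\<integral>\<^sup>+Y1. ?f Y2 Y1 \<partial>upper) \<le> (\<integral>\<^sup>+Y1. (ennreal (\<omega> / snd Y2 ^ m) * ?O2 Y2) * (epowr (A (Y1, Y2)) e * indicator {Y. snd Y \<le> \<tau> \<and> dist x1 (fst Y) < 2 * t1} Y1) \<partial>upper)"
        by (rule nn_integral_mono_AE, use AE_upper in eventually_elim) (rule pt)
      also have "\<dots> = (ennreal (\<omega> / snd Y2 ^ m) * ?O2 Y2) * (\<integral>\<^sup>+Y1. epowr (A (Y1, Y2)) e * indicator {Y. snd Y \<le> \<tau> \<and> dist x1 (fst Y) < 2 * t1} Y1 \<partial>upper)"
        by (intro nn_integral_cmult) measurable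
      also have "\<dots> \<le> (ennreal (\<omega> / snd Y2 ^ m) * ?O2 Y2) * ennreal (c * (t1 ^ n * (\<tau> / t1) powr d))"
      proof (intro mult_left_mono)
        show "(\<integral>\<^sup>+Y1. epowr (A (Y1, Y2)) e * indicator {Y. snd Y \<le> \<tau> \<and> dist x1 (fst Y) < 2 * t1} Y1 \<partial>upper) \<le> ennreal (c * (t1 ^ n * (\<tau> / t1) powr d))"
          unfolding c_def d_def n_def by (intro epowr_small_scales e C \<tau> h[unfolded n_def]) measurable
      qed auto
      also have "\<dots> = (ennreal (\<omega> / snd Y2 ^ m) * ennreal (c * (t1 ^ n * (\<tau> / t1) powr d))) * ?O2 Y2"
        by (simp add: ac_simps)
      also have "ennreal (\<omega> / snd Y2 ^ m) * ennreal (c * (t1 ^ n * (\<tau> / t1) powr d)) = ennreal (\<omega> * c * t1 ^ n) * ennreal (1 / snd Y2 ^ m * ?\<mu> (snd Y2) powr d)"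
        using t Y2 c \<omega> by (simp add: \<tau>_def ac_simps flip: ennreal_mult')
      finally show ?thesis by (simp add: mult.assoc)
    qed
    have "(\<integral>\<^sup>+Y2. (\<integral>\<^sup>+Y1. ?f Y2 Y1 \<partial>upper) \<partial>upper) \<le> (\<integral>\<^sup>+Y2. ennreal (\<omega> * c * t1 ^ n) * (ennreal (1 / snd Y2 ^ m * ?\<mu> (snd Y2) powr d) * ?O2 Y2) \<partial>upper)"
      by (rule nn_integral_mono_AE, use AE_upper h[folded n_def] in eventually_elim) (rule inner)
    also have "\<dots> = ennreal (\<omega> * c * t1 ^ n) * (\<integral>\<^sup>+Y2. ennreal (1 / snd Y2 ^ m * ?\<mu> (snd Y2) powr d) * ?O2 Y2 \<partial>upper)"
      by (intro nn_integral_cmult) measurable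
    also have "\<dots> \<le> ennreal (\<omega> * c * t1 ^ n) * ennreal ((unit_ball_vol m)\<^sup>2 * 2 ^ m * (2 / d) * t2 ^ m)"
      unfolding m_def using nn_integral_upper_overlap[OF t(2) d, of x2] by (intro mult_left_mono) auto
    also have "\<dots> = ennreal (K * (t1 ^ n * t2 ^ m))"
      using \<omega> c t by (subst ennreal_mult'[symmetric]) (auto simp: K_def ac_simps)
    finally show ?thesis .
  qed
  then show ?thesis using K unfolding n_def m_def by blast
qed

section \<open>The Carleson packing condition\<close>

lemma sets_upper_pair: "sets (upper \<Otimes>\<^sub>M upper) = sets (borel :: (('a::euclidean_space \<times> real) \<times> ('b::euclidean_space \<times> real)) measure)"
  using sets_pair_measure_cong[OF sets_upper sets_upper] by (simp only: borel_prod)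

lemma nn_integral_swap:
  assumes "sigma_finite_measure M" "sigma_finite_measure N"
    and "case_prod f \<in> borel_measurable (M \<Otimes>\<^sub>M N)"
  shows "(\<integral>\<^sup>+y. (\<integral>\<^sup>+x. f x y \<partial>M) \<partial>N) = (\<integral>\<^sup>+x. (\<integral>\<^sup>+y. f x y \<partial>N) \<partial>M)"
  using assms by (intro pair_sigma_finite.Fubini' pair_sigma_finite.intro)

lemma AE_upper_pair: "AE X in (upper \<Otimes>\<^sub>M upper :: (('a::euclidean_space \<times> real) \<times> ('b::euclidean_space \<times> real)) measure). 0 < snd (fst X) \<and> 0 < snd (snd X)"
proof (rule pair_sigma_finite.AE_pair_measure[OF pair_sigma_finite.intro[OF sigma_finite_upper sigma_finite_upper]])
  have "open {X :: ('a \<times> real) \<times> ('b \<times> real). 0 < snd (fst X) \<and> 0 < snd (snd X)}"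
    by (intro open_Collect_conj open_Collect_less continuous_intros)
  then show "{X \<in> space (upper \<Otimes>\<^sub>M upper :: (('a \<times> real) \<times> ('b \<times> real)) measure). 0 < snd (fst X) \<and> 0 < snd (snd X)} \<in> sets (upper \<Otimes>\<^sub>M upper)"
    unfolding sets_upper_pair space_pair_measure by (intro borel_open) simp
  have *: "AE y in (upper :: ('b \<times> real) measure). 0 < snd x \<and> 0 < snd y" if x: "0 < snd x" for x :: "'a \<times> real"
    using AE_upper by (rule eventually_mono) (use x in simp)
  have "AE x in (upper :: ('a \<times> real) measure). AE y in (upper :: ('b \<times> real) measure). 0 < snd x \<and> 0 < snd y"
    using AE_upper by (rule eventually_mono) (rule *)
  then show "AE x in (upper :: ('a \<times> real) measure). AE y in (upper :: ('b \<times> real) measure). 0 < snd (fst (x, y)) \<and> 0 < snd (snd (x, y))" by simp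
qed

text \<open>Second moment argument: with \<open>G\<close> the \<open>w\<close>-weighted sum of the normalised indicators of the boxes
  in \<open>U\<close>, the hypotheses bound \<open>\<integral>G\<^sup>2\<close> by the total mass, and \<open>G\<close> is supported in \<open>\<Omega>\<close>. Since
  \<open>G \<le> G\<^sup>2 / \<kappa> + \<kappa>\<close>, the first term is absorbed for a suitable \<open>\<kappa>\<close>; this is where the
  finiteness of the mass is needed.\<close>

lemma carleson_of_interaction:
  fixes w :: "('a::euclidean_space \<times> real) \<times> ('b::euclidean_space \<times> real) \<Rightarrow> ennreal"
    and R :: "('a \<times> real) \<times> ('b \<times> real) \<Rightarrow> ('a \<times> real) \<times> ('b \<times> real) \<Rightarrow> bool"
  defines "MU \<equiv> (upper \<Otimes>\<^sub>M upper) :: (('a \<times> real) \<times> ('b \<times> real)) measure"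
  defines "V \<equiv> \<lambda>X. snd (fst X) ^ DIM('a) * snd (snd X) ^ DIM('b)"
  defines "bx \<equiv> \<lambda>X z. (indicator (ball (fst (fst X)) (snd (fst X))) (fst z) * indicator (ball (fst (snd X)) (snd (snd X))) (snd z) :: ennreal)"
  assumes w [measurable]: "w \<in> borel_measurable borel"
    and K: "0 < K"
    and R [measurable]: "Measurable.pred (borel \<Otimes>\<^sub>M borel) (\<lambda>(X, X'). R X X')"
    and cover: "\<And>X X'. R X X' \<or> R X' X"
    and int: "\<And>X. 0 < snd (fst X) \<Longrightarrow> 0 < snd (snd X) \<Longrightarrow>
      (\<integral>\<^sup>+X'. w X' * ennreal (1 / V X') * (\<integral>\<^sup>+z. bx X z * bx X' z \<partial>lborel) * (if R X X' then 1 else 0) \<partial>MU) \<le> ennreal (K * V X)"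
    and U [measurable]: "U \<in> sets borel" and \<Omega> [measurable]: "\<Omega> \<in> sets borel"
    and sub: "\<And>X z. X \<in> U \<Longrightarrow> bx X z \<noteq> 0 \<Longrightarrow> z \<in> \<Omega>"
    and fin: "(\<integral>\<^sup>+X. w X * indicator U X \<partial>MU) < top"
  shows "(\<integral>\<^sup>+X. w X * indicator U X \<partial>MU)
    \<le> ennreal (8 * K / (unit_ball_vol (DIM('a)) * unit_ball_vol (DIM('b)))\<^sup>2) * emeasure lborel \<Omega>"
proof -
  define c where "c = unit_ball_vol (DIM('a)) * unit_ball_vol (DIM('b))"
  have c: "0 < c" by (simp add: c_def)
  have sb [measurable_cong]: "sets MU = sets borel" unfolding MU_def by (rule sets_upper_pair)
  have MU: "sigma_finite_measure MU"
    unfolding MU_def by (intro sigma_finite_pair_measure sigma_finite_upper)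
  note [measurable (raw)] = sigma_finite_measure.borel_measurable_nn_integral[OF MU]
  note swap = nn_integral_swap[OF MU lborel.sigma_finite_measure_axioms] nn_integral_swap[OF MU MU]
  have [measurable]: "Measurable.pred (MU \<Otimes>\<^sub>M MU) (\<lambda>(X, X'). R X X')"
    using measurable_compose[OF _ R, of "\<lambda>p. (fst p, snd p)" "MU \<Otimes>\<^sub>M MU"] by (simp add: split_beta)
  have [measurable]: "Measurable.pred (MU \<Otimes>\<^sub>M MU) (\<lambda>(X, X'). R X' X)"
    using measurable_compose[OF _ R, of "\<lambda>p. (snd p, fst p)" "MU \<Otimes>\<^sub>M MU"] by (simp add: split_beta)
  have AE_pos: "AE X in MU. 0 < snd (fst X) \<and> 0 < snd (snd X)"
    unfolding MU_def by (rule AE_upper_pair)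
  have [measurable]: "V \<in> borel_measurable borel" 
    unfolding V_def by (intro borel_measurable_continuous_onI continuous_intros)
  have [measurable]: "(\<lambda>(X, z). bx X z) \<in> borel_measurable (borel \<Otimes>\<^sub>M borel)"
  proof -
    define S :: "((('a \<times> real) \<times> ('b \<times> real)) \<times> ('a \<times> 'b)) set" where
      "S = {p. dist (fst (fst (fst p))) (fst (snd p)) < snd (fst (fst p)) \<and> dist (fst (snd (fst p))) (snd (snd p)) < snd (snd (fst p))}"
    have "open S" unfolding S_def by (intro open_Collect_conj open_Collect_less continuous_intros)
    then have "S \<in> sets (borel \<Otimes>\<^sub>M borel)" unfolding borel_prod by (rule borel_open)
    moreover have "(\<lambda>(X, z). bx X z) = indicator S"
      by (auto simp: fun_eq_iff bx_def S_def split: split_indicator)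
    ultimately show ?thesis by simp
  qed
  define g where "g = (\<lambda>X. w X * indicator U X * ennreal (1 / V X))"
  have [measurable]: "g \<in> borel_measurable borel" unfolding g_def by measurable
  define G where "G = (\<lambda>z. \<integral>\<^sup>+X. g X * bx X z \<partial>MU)"
  have [measurable]: "G \<in> borel_measurable borel" unfolding G_def by measurable
  define O2 where "O2 = (\<lambda>X X'. \<integral>\<^sup>+z. bx X z * bx X' z \<partial>lborel)"
  have [measurable]: "(\<lambda>(X, X'). O2 X X') \<in> borel_measurable (borel \<Otimes>\<^sub>M borel)"
    unfolding O2_def by measurable
  have O2_sym: "O2 X X' = O2 X' X" for X X' by (simp add: O2_def mult.commute)
  let ?J = "\<integral>\<^sup>+X. (\<integral>\<^sup>+X'. g X * g X' * O2 X X' * (if R X X' then 1 else 0) \<partial>MU) \<partial>MU"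
  define \<nu> where "\<nu> = (\<integral>\<^sup>+X. w X * indicator U X \<partial>MU)"
  have vol: "(\<integral>\<^sup>+z. bx X z \<partial>lborel) = ennreal (c * V X)" if "0 < snd (fst X)" "0 < snd (snd X)" for X
  proof -
    have "(\<integral>\<^sup>+z. bx X z \<partial>lborel) = (\<integral>\<^sup>+z. indicator (ball (fst (fst X)) (snd (fst X)) \<times> ball (fst (snd X)) (snd (snd X))) z \<partial>(lborel \<Otimes>\<^sub>M lborel))"
      unfolding lborel_prod by (simp add: bx_def indicator_times)
    also have "\<dots> = emeasure (lborel \<Otimes>\<^sub>M lborel) (ball (fst (fst X)) (snd (fst X)) \<times> ball (fst (snd X)) (snd (snd X)))"
      by (rule nn_integral_indicator) (intro pair_measureI, simp_all)
    also have "\<dots> = emeasure lborel (ball (fst (fst X)) (snd (fst X))) * emeasure lborel (ball (fst (snd X)) (snd (snd X)))"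
      by (rule lborel.emeasure_pair_measure_Times) simp_all
    also have "\<dots> = ennreal (c * V X)"
      using that by (simp add: emeasure_ball_DIM c_def V_def ac_simps flip: ennreal_mult)
    finally show ?thesis .
  qed
  have intG: "(\<integral>\<^sup>+z. G z \<partial>lborel) = ennreal c * \<nu>"
  proof -
    have "(\<integral>\<^sup>+z. G z \<partial>lborel) = (\<integral>\<^sup>+X. (\<integral>\<^sup>+z. g X * bx X z \<partial>lborel) \<partial>MU)"
      unfolding G_def by (intro swap) measurable
    also have "\<dots> = (\<integral>\<^sup>+X. g X * (\<integral>\<^sup>+z. bx X z \<partial>lborel) \<partial>MU)"
      by (intro nn_integral_cong nn_integral_cmult) measurable
    also have "\<dots> = (\<integral>\<^sup>+X. ennreal c * (w X * indicator U X) \<partial>MU)"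
    proof (rule nn_integral_cong_AE, use AE_pos in eventually_elim)
      fix X :: "('a \<times> real) \<times> ('b \<times> real)" assume X: "0 < snd (fst X) \<and> 0 < snd (snd X)"
      then have "0 < V X" by (simp add: V_def)
      then have "ennreal (1 / V X) * ennreal (c * V X) = ennreal c" using c by (simp flip: ennreal_mult)
      moreover have "g X * (\<integral>\<^sup>+z. bx X z \<partial>lborel) = (ennreal (1 / V X) * ennreal (c * V X)) * (w X * indicator U X)"
        using X by (simp add: vol g_def ac_simps)
      ultimately show "g X * (\<integral>\<^sup>+z. bx X z \<partial>lborel) = ennreal c * (w X * indicator U X)" by simp
    qed
    also have "\<dots> = ennreal c * \<nu>" unfolding \<nu>_def by (intro nn_integral_cmult) measurable
    finally show ?thesis .
  qed
  \<comment> \<open>The second box may range over all boxes, as its restriction to \<open>U\<close>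
    is simply dropped; the normalisation by \<open>V X\<close> cancels the bound
    \<open>K * V X\<close>.\<close>
  have half: "?J \<le> ennreal K * \<nu>"
  proof -
    have "?J
      \<le> (\<integral>\<^sup>+X. ennreal K * (w X * indicator U X) \<partial>MU)"
    proof (rule nn_integral_mono_AE, use AE_pos in eventually_elim)
      fix X :: "('a \<times> real) \<times> ('b \<times> real)" assume X: "0 < snd (fst X) \<and> 0 < snd (snd X)"
      then have V: "0 < V X" by (simp add: V_def)
      have "(\<integral>\<^sup>+X'. g X * g X' * O2 X X' * (if R X X' then 1 else 0) \<partial>MU)
        \<le> (\<integral>\<^sup>+X'. g X * (w X' * ennreal (1 / V X') * O2 X X' * (if R X X' then 1 else 0)) \<partial>MU)"
        by (intro nn_integral_mono) (auto simp: g_def mult.assoc split: split_indicator)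
      also have "\<dots> = g X * (\<integral>\<^sup>+X'. w X' * ennreal (1 / V X') * O2 X X' * (if R X X' then 1 else 0) \<partial>MU)"
        by (intro nn_integral_cmult) measurable
      also have "\<dots> \<le> g X * ennreal (K * V X)"
        unfolding O2_def using X by (intro mult_left_mono int) auto
      also have "\<dots> = (ennreal (1 / V X) * ennreal (K * V X)) * (w X * indicator U X)"
        by (simp add: g_def ac_simps)
      also have "ennreal (1 / V X) * ennreal (K * V X) = ennreal K" using V K by (simp flip: ennreal_mult)
      finally show "(\<integral>\<^sup>+X'. g X * g X' * O2 X X' * (if R X X' then 1 else 0) \<partial>MU) \<le> ennreal K * (w X * indicator U X)" .
    qed
    also have "\<dots> = ennreal K * \<nu>" unfolding \<nu>_def by (intro nn_integral_cmult) measurable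
    finally show ?thesis .
  qed
  have intG2: "(\<integral>\<^sup>+z. G z * G z \<partial>lborel) \<le> ennreal (2 * K) * \<nu>"
  proof -
    have "(\<integral>\<^sup>+z. G z * G z \<partial>lborel) = (\<integral>\<^sup>+z. (\<integral>\<^sup>+X. g X * bx X z * G z \<partial>MU) \<partial>lborel)"
      by (subst (2) G_def) (simp add: nn_integral_multc G_def)
    also have "\<dots> = (\<integral>\<^sup>+X. (\<integral>\<^sup>+z. g X * bx X z * G z \<partial>lborel) \<partial>MU)"
      by (intro swap) measurable
    also have "\<dots> = (\<integral>\<^sup>+X. (\<integral>\<^sup>+X'. g X * g X' * O2 X X' \<partial>MU) \<partial>MU)"
    proof (rule nn_integral_cong)
      fix X
      have "(\<integral>\<^sup>+z. g X * bx X z * G z \<partial>lborel) = (\<integral>\<^sup>+z. (\<integral>\<^sup>+X'. g X * g X' * (bx X z * bx X' z) \<partial>MU) \<partial>lborel)"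
        unfolding G_def by (intro nn_integral_cong, subst nn_integral_cmult[symmetric]) (auto simp: ac_simps)
      also have "\<dots> = (\<integral>\<^sup>+X'. (\<integral>\<^sup>+z. g X * g X' * (bx X z * bx X' z) \<partial>lborel) \<partial>MU)"
        by (intro swap) measurable
      also have "\<dots> = (\<integral>\<^sup>+X'. g X * g X' * O2 X X' \<partial>MU)"
        unfolding O2_def by (intro nn_integral_cong nn_integral_cmult) measurable
      finally show "(\<integral>\<^sup>+z. g X * bx X z * G z \<partial>lborel) = (\<integral>\<^sup>+X'. g X * g X' * O2 X X' \<partial>MU)" .
    qed
    \<comment> \<open>Every pair of boxes is related by \<open>R\<close> in at least one order. As
      \<open>O2\<close> is symmetric, both orders lead to the same double integral, whence the
      constant \<open>2 * K\<close>.\<close>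
    also have "\<dots> \<le> (\<integral>\<^sup>+X. (\<integral>\<^sup>+X'. g X * g X' * O2 X X' * (if R X X' then 1 else 0) + g X * g X' * O2 X X' * (if R X' X then 1 else 0) \<partial>MU) \<partial>MU)"
    proof (intro nn_integral_mono)
      fix X X'
      show "g X * g X' * O2 X X' \<le> g X * g X' * O2 X X' * (if R X X' then 1 else 0) + g X * g X' * O2 X X' * (if R X' X then 1 else 0)"
        using cover[of X X'] by (cases "R X X'") (auto simp: add_increasing2)
    qed
    also have "\<dots> = (\<integral>\<^sup>+X. (\<integral>\<^sup>+X'. g X * g X' * O2 X X' * (if R X X' then 1 else 0) \<partial>MU)
        + (\<integral>\<^sup>+X'. g X * g X' * O2 X X' * (if R X' X then 1 else 0) \<partial>MU) \<partial>MU)"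
      by (intro nn_integral_cong nn_integral_add) measurable
    also have "\<dots> = ?J
        + (\<integral>\<^sup>+X. (\<integral>\<^sup>+X'. g X * g X' * O2 X X' * (if R X' X then 1 else 0) \<partial>MU) \<partial>MU)"
      by (intro nn_integral_add) measurable
    also have "(\<integral>\<^sup>+X. (\<integral>\<^sup>+X'. g X * g X' * O2 X X' * (if R X' X then 1 else 0) \<partial>MU) \<partial>MU)
      = (\<integral>\<^sup>+X'. (\<integral>\<^sup>+X. g X * g X' * O2 X X' * (if R X' X then 1 else 0) \<partial>MU) \<partial>MU)"
      by (intro swap) measurable
    also have "\<dots> = ?J"
    proof (intro nn_integral_cong)
      fix X X'
      show "g X' * g X * O2 X' X * (if R X X' then 1 else 0) = g X * g X' * O2 X X' * (if R X X' then 1 else 0)"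
        by (simp only: O2_sym[of X' X] mult.commute[of "g X'" "g X"])
    qed
    also have "?J + \<dots> \<le> ennreal K * \<nu> + ennreal K * \<nu>"
      by (intro add_mono half)
    also have "\<dots> = ennreal (2 * K) * \<nu>"
    proof -
      have "ennreal (2 * K) = ennreal K + ennreal K" using K by (subst ennreal_plus[symmetric]) auto
      then show ?thesis by (simp only: distrib_right)
    qed
    finally show ?thesis .
  qed
  \<comment> \<open>Chosen so that \<open>(1 / \<kappa>) * 2 * K = c / 2\<close>: the quadratic term
    then takes exactly half of the left side \<open>c * \<nu>\<close>. What remains is
    \<open>\<nu> \<le> (2 * \<kappa> / c) * |\<Omega>|\<close>, the origin of
    \<open>8 * K / c\<^sup>2\<close>.\<close>
  define \<kappa> where "\<kappa> = 4 * K / c"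
  have \<kappa>: "0 < \<kappa>" using K c by (simp add: \<kappa>_def)
  have pt: "G z \<le> ennreal (1 / \<kappa>) * (G z * G z) + ennreal \<kappa> * indicator \<Omega> z" for z
  proof (cases "z \<in> \<Omega>")
    case True
    show ?thesis
    proof (cases "G z \<le> ennreal \<kappa>")
      case True
      then show ?thesis using \<open>z \<in> \<Omega>\<close> by (simp add: add_increasing)
    next
      case False
      have "G z = ennreal (1 / \<kappa>) * (ennreal \<kappa> * G z)"
        using \<kappa> by (simp add: mult.assoc[symmetric] flip: ennreal_mult)
      also have "\<dots> \<le> ennreal (1 / \<kappa>) * (G z * G z)"
        using False by (intro mult_left_mono mult_right_mono) auto
      finally show ?thesis by (simp add: add_increasing2)
    qed
  next
    case False
    have "g X * bx X z = 0" for X using sub[of X z] False by (auto simp: g_def split: split_indicator)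
    then have "G z = (\<integral>\<^sup>+X. 0 \<partial>MU)" unfolding G_def by (intro nn_integral_cong)
    then show ?thesis by simp
  qed
  have "ennreal c * \<nu> \<le> (\<integral>\<^sup>+z. ennreal (1 / \<kappa>) * (G z * G z) + ennreal \<kappa> * indicator \<Omega> z \<partial>lborel)"
    unfolding intG[symmetric] by (intro nn_integral_mono pt)
  also have "\<dots> = ennreal (1 / \<kappa>) * (\<integral>\<^sup>+z. G z * G z \<partial>lborel) + ennreal \<kappa> * emeasure lborel \<Omega>"
    by (simp add: nn_integral_add nn_integral_cmult)
  also have "\<dots> \<le> ennreal (1 / \<kappa>) * (ennreal (2 * K) * \<nu>) + ennreal \<kappa> * emeasure lborel \<Omega>"
    by (intro add_right_mono mult_left_mono intG2) auto
  also have "ennreal (1 / \<kappa>) * (ennreal (2 * K) * \<nu>) = ennreal (c / 2) * \<nu>"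
    using \<kappa> K c by (simp add: mult.assoc[symmetric] \<kappa>_def flip: ennreal_mult)
  finally have main: "ennreal c * \<nu> \<le> ennreal (c / 2) * \<nu> + ennreal \<kappa> * emeasure lborel \<Omega>" .
  show ?thesis
  proof (cases "emeasure lborel \<Omega>")
    case (real m)
    obtain v where v: "\<nu> = ennreal v" "0 \<le> v" using fin by (cases \<nu>) (auto simp: \<nu>_def)
    have "c * v \<le> c / 2 * v + \<kappa> * m"
      using main c \<kappa> v real by (simp add: ennreal_le_iff flip: ennreal_mult ennreal_plus)
    then have "v \<le> 8 * K / c\<^sup>2 * m"
      using c by (simp add: \<kappa>_def field_simps power2_eq_square)
    then show ?thesis
      using v real K c unfolding \<nu>_def[symmetric] c_def[symmetric]
      by (simp add: ennreal_leI flip: ennreal_mult)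
  next
    case top
    then show ?thesis using K c by (simp add: ennreal_mult_top c_def[symmetric])
  qed
qed

lemma nn_integral_box_overlap:
  fixes x x' :: "'a::euclidean_space" and y y' :: "'b::euclidean_space"
  shows "(\<integral>\<^sup>+z. (indicator (ball x t) (fst z) * indicator (ball y s) (snd z)) *
      (indicator (ball x' t') (fst z) * indicator (ball y' s') (snd z)) \<partial>lborel)
    = (ball_overlap x t x' t') *
      ball_overlap y s y' s'"
proof -
  have "(\<integral>\<^sup>+z. (indicator (ball x t) (fst z) * indicator (ball y s) (snd z)) *
      (indicator (ball x' t') (fst z) * indicator (ball y' s') (snd z)) \<partial>lborel)
    = (\<integral>\<^sup>+a. (\<integral>\<^sup>+b. (indicator (ball x t) a * indicator (ball x' t') a) *
      (indicator (ball y s) b * indicator (ball y' s') b) \<partial>lborel) \<partial>lborel)"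
    unfolding lborel_prod[symmetric]
    by (subst lborel.nn_integral_fst[symmetric]) (measurable, simp add: ac_simps)
  also have "\<dots> = (\<integral>\<^sup>+a. (indicator (ball x t) a * indicator (ball x' t') a) *
      (ball_overlap y s y' s') \<partial>lborel)"
    by (intro nn_integral_cong nn_integral_cmult) measurable
  also have "\<dots> = (ball_overlap x t x' t') *
      ball_overlap y s y' s'"
    by (intro nn_integral_multc) measurable
  finally show ?thesis .
qed

text \<open>These sets exhaust the half-space of positive times. They are bounded and keep away from
  time 0, where the density \<open>1 / t\<close> blows up; \<open>N + 1\<close> in the denominator
  avoids division by zero at \<open>N = 0\<close>.\<close>

lemma emeasure_upper_truncated:
  "emeasure upper {Y :: 'a::euclidean_space \<times> real. norm (fst Y) \<le> real N \<and> 1 / (real N + 1) \<le> snd Y \<and> snd Y \<le> real N} < top"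
proof -
  let ?S = "{Y :: 'a \<times> real. norm (fst Y) \<le> real N \<and> 1 / (real N + 1) \<le> snd Y \<and> snd Y \<le> real N}"
  have "closed ?S" by (intro closed_Collect_conj closed_Collect_le continuous_intros)
  then have [measurable]: "?S \<in> sets borel" by (rule borel_closed)
  have "0 \<le> b" if "1 / (real N + 1) \<le> b" for b :: real
    by (rule order_trans[OF _ that]) simp
  then have "?S \<subseteq> cball 0 (real N) \<times> {0..real N}" by auto
  then have "bounded ?S" by (rule bounded_subset[rotated]) (intro bounded_Times bounded_cball bounded_closed_interval)
  then have fin: "emeasure lborel ?S < \<infinity>" by (rule emeasure_bounded_finite)
  have "emeasure upper ?S = (\<integral>\<^sup>+Y. ennreal (if 0 < snd Y then 1 / snd Y else 0) * indicator ?S Y \<partial>lborel)"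
    unfolding upper_def by (intro emeasure_density) measurable
  also have "\<dots> \<le> (\<integral>\<^sup>+Y. ennreal (real N + 1) * indicator ?S Y \<partial>lborel)"
    by (intro nn_integral_mono) (auto simp: field_simps simp del: ennreal_plus intro!: ennreal_leI split: split_indicator)
  also have "\<dots> = ennreal (real N + 1) * emeasure lborel ?S" by (simp add: nn_integral_cmult)
  also have "\<dots> < top" using fin by (simp add: ennreal_mult_less_top)
  finally show ?thesis .
qed

lemma nn_integral_upper_pair:
  fixes f :: "('a::euclidean_space \<times> real) \<times> ('b::euclidean_space \<times> real) \<Rightarrow> ennreal"
  assumes [measurable]: "f \<in> borel_measurable borel"
  shows "(\<integral>\<^sup>+X. f X \<partial>(upper \<Otimes>\<^sub>M upper)) = (\<integral>\<^sup>+Y2. (\<integral>\<^sup>+Y1. f (Y1, Y2) \<partial>upper) \<partial>upper)"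
    and nn_integral_upper_pair_swap: "(\<integral>\<^sup>+X. f X \<partial>(upper \<Otimes>\<^sub>M upper)) = (\<integral>\<^sup>+Y1. (\<integral>\<^sup>+Y2. f (Y1, Y2) \<partial>upper) \<partial>upper)"
proof -
  have f: "f \<in> borel_measurable (upper \<Otimes>\<^sub>M upper)"
    using assms measurable_cong_sets[OF sets_upper_pair refl] by blast
  show "(\<integral>\<^sup>+X. f X \<partial>(upper \<Otimes>\<^sub>M upper)) = (\<integral>\<^sup>+Y2. (\<integral>\<^sup>+Y1. f (Y1, Y2) \<partial>upper) \<partial>upper)"
    by (rule pair_sigma_finite.nn_integral_snd[OF pair_sigma_finite.intro[OF sigma_finite_upper sigma_finite_upper] f, symmetric])
  show "(\<integral>\<^sup>+X. f X \<partial>(upper \<Otimes>\<^sub>M upper)) = (\<integral>\<^sup>+Y1. (\<integral>\<^sup>+Y2. f (Y1, Y2) \<partial>upper) \<partial>upper)"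
    by (rule sigma_finite_measure.nn_integral_fst[OF sigma_finite_upper f, symmetric])
qed

text \<open>\<open>U\<close> is a family of boxes contained in \<open>\<Omega>\<close>. The two
  fibrewise hypotheses control the interactions in which the first or the second side is relatively
  the smaller one, which is the input of the second moment argument. That argument needs finite
  mass, so it is run on truncations of \<open>U\<close>, and monotone convergence removes
  them.\<close>

lemma carleson_weight:
  fixes A :: "('a::euclidean_space \<times> real) \<times> ('b::euclidean_space \<times> real) \<Rightarrow> ennreal" and e C :: real
  assumes A [measurable]: "A \<in> borel_measurable borel"
    and e: "0 < e" "e < 1" and C: "0 \<le> C"
    and h1: "AE Y2 in upper. (\<integral>\<^sup>+Y1. A (Y1, Y2) * ennreal (1 / snd Y1 ^ DIM('a)) \<partial>upper) \<le> ennreal C"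
    and h2: "AE Y1 in upper. (\<integral>\<^sup>+Y2. A (Y1, Y2) * ennreal (1 / snd Y2 ^ DIM('b)) \<partial>upper) \<le> ennreal C"
  shows "\<exists>K\<ge>0. \<forall>U \<Omega>. U \<in> sets borel \<longrightarrow> \<Omega> \<in> sets borel \<longrightarrow>
    (\<forall>X z. X \<in> U \<longrightarrow> dist (fst (fst X)) (fst z) < snd (fst X) \<longrightarrow> dist (fst (snd X)) (snd z) < snd (snd X) \<longrightarrow> z \<in> \<Omega>) \<longrightarrow>
    (\<integral>\<^sup>+X. epowr (A X) e * indicator U X \<partial>(upper \<Otimes>\<^sub>M upper)) \<le> ennreal K * emeasure lborel \<Omega>"
proof -
  define n where "n = DIM('a)"
  define m where "m = DIM('b)"
  define MU where "MU = (upper \<Otimes>\<^sub>M upper :: (('a \<times> real) \<times> ('b \<times> real)) measure)"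
  have [measurable_cong]: "sets MU = sets borel" unfolding MU_def by (rule sets_upper_pair)
  have [measurable]: "A \<in> borel_measurable (borel \<Otimes>\<^sub>M borel)" by (simp add: borel_prod)
  let ?O = "\<lambda>x t Y. (ball_overlap x t (fst Y) (snd Y)) :: ennreal"
  \<comment> \<open>In terms of the side ratios \<open>\<rho>1\<close> and \<open>\<rho>2\<close> of
    \<open>X'\<close> to \<open>X\<close>, for positive sides, \<open>R1\<close> says
    \<open>\<rho>1 \<le> min \<rho>2 (1 / \<rho>2)\<close>, and \<open>R2\<close> is the same with
    the variables interchanged. Products instead of quotients keep the relations closed and free of
    division.\<close>
  define R1 :: "('a \<times> real) \<times> ('b \<times> real) \<Rightarrow> ('a \<times> real) \<times> ('b \<times> real) \<Rightarrow> bool" where "R1 = (\<lambda>X X'. snd (fst X') * snd (snd X) \<le> snd (fst X) * snd (snd X') \<and> snd (fst X') * snd (snd X') \<le> snd (fst X) * snd (snd X))"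
  define R2 :: "('a \<times> real) \<times> ('b \<times> real) \<Rightarrow> ('a \<times> real) \<times> ('b \<times> real) \<Rightarrow> bool" where "R2 = (\<lambda>X X'. snd (snd X') * snd (fst X) \<le> snd (snd X) * snd (fst X') \<and> snd (snd X') * snd (fst X') \<le> snd (snd X) * snd (fst X))"
  let ?f = "\<lambda>X X'. epowr (A X') e * ennreal (1 / (snd (fst X') ^ n * snd (snd X') ^ m)) *
    (?O (fst (fst X)) (snd (fst X)) (fst X') * ?O (fst (snd X)) (snd (snd X)) (snd X'))"
  obtain K1 where K1: "0 \<le> K1" "\<And>x1 t1 x2 t2. 0 < t1 \<Longrightarrow> 0 < t2 \<Longrightarrow>
      (\<integral>\<^sup>+Y2. (\<integral>\<^sup>+Y1. epowr (A (Y1, Y2)) e * ennreal (1 / (snd Y1 ^ n * snd Y2 ^ m)) *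
        (?O x1 t1 Y1 * ?O x2 t2 Y2) *
        (if snd Y1 * t2 \<le> t1 * snd Y2 \<and> snd Y1 * snd Y2 \<le> t1 * t2 then 1 else 0) \<partial>upper) \<partial>upper)
      \<le> ennreal (K1 * (t1 ^ n * t2 ^ m))"
    using carleson_interaction[OF A e C h1] unfolding n_def m_def by blast
  have "(\<lambda>p :: ('b \<times> real) \<times> ('a \<times> real). (snd p, fst p)) \<in> borel \<rightarrow>\<^sub>M borel"
    by (intro borel_measurable_continuous_onI continuous_intros)
  from measurable_compose[OF this A] have A': "(\<lambda>(Y2, Y1). A (Y1, Y2)) \<in> borel_measurable borel"
    by (simp add: split_beta)
  obtain K2 where K2: "0 \<le> K2" "\<And>x1 t1 x2 t2. 0 < t1 \<Longrightarrow> 0 < t2 \<Longrightarrow>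
      (\<integral>\<^sup>+Y1. (\<integral>\<^sup>+Y2. epowr (A (Y1, Y2)) e * ennreal (1 / (snd Y2 ^ m * snd Y1 ^ n)) *
        (?O x2 t2 Y2 * ?O x1 t1 Y1) *
        (if snd Y2 * t1 \<le> t2 * snd Y1 \<and> snd Y2 * snd Y1 \<le> t2 * t1 then 1 else 0) \<partial>upper) \<partial>upper)
      \<le> ennreal (K2 * (t2 ^ m * t1 ^ n))"
    using carleson_interaction[OF A' e C] h2 unfolding n_def m_def split_conv by blast
  have [measurable]: "(\<lambda>X'. ?f X X') \<in> borel_measurable borel" for X
    by measurable
  have [measurable]: "(\<lambda>X'. if R1 X X' then 1 else 0 :: ennreal) \<in> borel_measurable borel"
    "(\<lambda>X'. if R2 X X' then 1 else 0 :: ennreal) \<in> borel_measurable borel" for X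
    unfolding R1_def R2_def by measurable
  \<comment> \<open>The summand 1 only makes the constant strictly positive, as
    \<open>carleson_of_interaction\<close> demands.\<close>
  have int: "(\<integral>\<^sup>+X'. ?f X X' * (if R1 X X' \<or> R2 X X' then 1 else 0) \<partial>MU)
      \<le> ennreal ((K1 + K2 + 1) * (snd (fst X) ^ n * snd (snd X) ^ m))"
    if X: "0 < snd (fst X)" "0 < snd (snd X)" for X
  proof -
    have "(\<integral>\<^sup>+X'. ?f X X' * (if R1 X X' \<or> R2 X X' then 1 else 0) \<partial>MU)
      \<le> (\<integral>\<^sup>+X'. ?f X X' * (if R1 X X' then 1 else 0) + ?f X X' * (if R2 X X' then 1 else 0) \<partial>MU)"
      by (intro nn_integral_mono) auto
    also have "\<dots> = (\<integral>\<^sup>+X'. ?f X X' * (if R1 X X' then 1 else 0) \<partial>MU) + (\<integral>\<^sup>+X'. ?f X X' * (if R2 X X' then 1 else 0) \<partial>MU)"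
      by (intro nn_integral_add) measurable
    also have "(\<integral>\<^sup>+X'. ?f X X' * (if R1 X X' then 1 else 0) \<partial>MU) \<le> ennreal (K1 * (snd (fst X) ^ n * snd (snd X) ^ m))"
      unfolding MU_def using K1(2)[OF X, of "fst (fst X)" "fst (snd X)"]
      by (subst nn_integral_upper_pair) (measurable, simp add: R1_def)
    also have "(\<integral>\<^sup>+X'. ?f X X' * (if R2 X X' then 1 else 0) \<partial>MU) \<le> ennreal (K2 * (snd (fst X) ^ n * snd (snd X) ^ m))"
      unfolding MU_def using K2(2)[OF X, of "fst (snd X)" "fst (fst X)"]
      by (subst nn_integral_upper_pair_swap) (measurable, simp add: R2_def ac_simps)
    also have "ennreal (K1 * (snd (fst X) ^ n * snd (snd X) ^ m)) + ennreal (K2 * (snd (fst X) ^ n * snd (snd X) ^ m))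
      \<le> ennreal ((K1 + K2 + 1) * (snd (fst X) ^ n * snd (snd X) ^ m))"
      using X K1(1) K2(1) by (subst ennreal_plus[symmetric]) (auto simp: algebra_simps intro!: ennreal_leI)
    finally show ?thesis by (simp add: add_right_mono)
  qed
  define K where "K = 8 * (K1 + K2 + 1) / (unit_ball_vol (DIM('a)) * unit_ball_vol (DIM('b)))\<^sup>2"
  have K: "0 \<le> K" using K1(1) K2(1) by (simp add: K_def)
  have Rm: "Measurable.pred (borel \<Otimes>\<^sub>M borel) (\<lambda>(X, X'). R1 X X' \<or> R2 X X')"
  proof -
    have "closed {p. R1 (fst p) (snd p) \<or> R2 (fst p) (snd p)}" unfolding R1_def R2_def
      by (intro closed_Collect_conj closed_Collect_disj closed_Collect_le continuous_intros)
    then have "{p. R1 (fst p) (snd p) \<or> R2 (fst p) (snd p)} \<in> sets (borel \<Otimes>\<^sub>M borel)"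
      unfolding borel_prod by (rule borel_closed)
    then show ?thesis by (simp add: pred_def split_beta space_pair_measure)
  qed
  \<comment> \<open>If \<open>X'\<close> has at most the side product of \<open>X\<close>, then
    \<open>R1 X X'\<close> or \<open>R2 X X'\<close> holds, according to which ratio is smaller;
    otherwise the same is true with the boxes exchanged.\<close>
  have cover: "(R1 X X' \<or> R2 X X') \<or> (R1 X' X \<or> R2 X' X)" for X X'
    unfolding R1_def R2_def by (simp add: mult.commute) linarith
  have bound: "(\<integral>\<^sup>+X. epowr (A X) e * indicator U X \<partial>MU) \<le> ennreal K * emeasure lborel \<Omega>"
    if [measurable]: "U \<in> sets borel" "\<Omega> \<in> sets borel"
      and sub: "\<And>X z. X \<in> U \<Longrightarrow> dist (fst (fst X)) (fst z) < snd (fst X) \<Longrightarrow> dist (fst (snd X)) (snd z) < snd (snd X) \<Longrightarrow> z \<in> \<Omega>"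
      and fin: "(\<integral>\<^sup>+X. epowr (A X) e * indicator U X \<partial>MU) < top" for U \<Omega>
    unfolding K_def MU_def
  proof (rule carleson_of_interaction[where R = "\<lambda>X X'. R1 X X' \<or> R2 X X'"])
    show "(\<integral>\<^sup>+X'. epowr (A X') e * ennreal (1 / (snd (fst X') ^ DIM('a) * snd (snd X') ^ DIM('b))) *
      (\<integral>\<^sup>+z. (indicator (ball (fst (fst X)) (snd (fst X))) (fst z) * indicator (ball (fst (snd X)) (snd (snd X))) (snd z)) *
        (indicator (ball (fst (fst X')) (snd (fst X'))) (fst z) * indicator (ball (fst (snd X')) (snd (snd X'))) (snd z)) \<partial>lborel) *
      (if R1 X X' \<or> R2 X X' then 1 else 0) \<partial>(upper \<Otimes>\<^sub>M upper)) \<le> ennreal ((K1 + K2 + 1) * (snd (fst X) ^ DIM('a) * snd (snd X) ^ DIM('b)))"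
      if "0 < snd (fst X)" "0 < snd (snd X)" for X
      unfolding nn_integral_box_overlap using int[OF that] by (simp add: n_def m_def MU_def)
    show "z \<in> \<Omega>" if "X \<in> U" "(indicator (ball (fst (fst X)) (snd (fst X))) (fst z) * indicator (ball (fst (snd X)) (snd (snd X))) (snd z) :: ennreal) \<noteq> 0" for X z
      using sub[OF that(1), of z] that(2) by (auto split: split_indicator_asm)
  qed (use K1(1) K2(1) Rm cover fin in \<open>auto simp: MU_def\<close>)
  have AE_pos: "AE X in MU. 0 < snd (fst X) \<and> 0 < snd (snd X)"
    unfolding MU_def by (rule AE_upper_pair)
  define S where "S = (\<lambda>N. {Y :: 'a \<times> real. norm (fst Y) \<le> real N \<and> 1 / (real N + 1) \<le> snd Y \<and> snd Y \<le> real N})"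
  define S' where "S' = (\<lambda>N. {Y :: 'b \<times> real. norm (fst Y) \<le> real N \<and> 1 / (real N + 1) \<le> snd Y \<and> snd Y \<le> real N})"
  have "closed (S N)" "closed (S' N)" for N
    unfolding S_def S'_def by (intro closed_Collect_conj closed_Collect_le continuous_intros)+
  then have [measurable]: "S N \<in> sets borel" "S' N \<in> sets borel" for N by (auto intro: borel_closed)
  have [measurable]: "S N \<times> S' N \<in> sets borel" for N
    using \<open>closed (S N)\<close> \<open>closed (S' N)\<close> by (intro borel_closed closed_Times)
  \<comment> \<open>On the truncation \<open>snd Y1 \<le> N\<close>, so \<open>A\<close> is at most
    \<open>N ^ n\<close> times the integrand of \<open>h1\<close>; together with \<open>A\<close> to
    the power \<open>e\<close> being at most \<open>1 + A\<close>, this leaves finite quantities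
    only.\<close>
  have fin: "(\<integral>\<^sup>+X. epowr (A X) e * indicator (S N \<times> S' N) X \<partial>MU) < top" for N
  proof -
    have "(\<integral>\<^sup>+X. epowr (A X) e * indicator (S N \<times> S' N) X \<partial>MU)
      = (\<integral>\<^sup>+Y2. (\<integral>\<^sup>+Y1. epowr (A (Y1, Y2)) e * indicator (S N \<times> S' N) (Y1, Y2) \<partial>upper) \<partial>upper)"
      unfolding MU_def by (intro nn_integral_upper_pair) measurable
    also have "\<dots> \<le> (\<integral>\<^sup>+Y2. indicator (S' N) Y2 * (emeasure upper (S N) + ennreal (real N ^ n) * ennreal C) \<partial>upper)"
    proof (rule nn_integral_mono_AE, use h1 in eventually_elim)
      fix Y2 :: "'b \<times> real"
      assume h: "(\<integral>\<^sup>+Y1. A (Y1, Y2) * ennreal (1 / snd Y1 ^ DIM('a)) \<partial>upper) \<le> ennreal C"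
      have "(\<integral>\<^sup>+Y1. epowr (A (Y1, Y2)) e * indicator (S N \<times> S' N) (Y1, Y2) \<partial>upper)
        \<le> (\<integral>\<^sup>+Y1. indicator (S' N) Y2 * (indicator (S N) Y1 + ennreal (real N ^ n) * (A (Y1, Y2) * ennreal (1 / snd Y1 ^ n))) \<partial>upper)"
      proof (rule nn_integral_mono)
        fix Y1 :: "'a \<times> real"
        show "epowr (A (Y1, Y2)) e * indicator (S N \<times> S' N) (Y1, Y2)
          \<le> indicator (S' N) Y2 * (indicator (S N) Y1 + ennreal (real N ^ n) * (A (Y1, Y2) * ennreal (1 / snd Y1 ^ n)))"
        proof (cases "Y1 \<in> S N \<and> Y2 \<in> S' N")
          case True
          then have t: "1 / (real N + 1) \<le> snd Y1" "snd Y1 \<le> real N" by (auto simp: S_def)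
          have "0 < 1 / (real N + 1)" by simp
          then have "0 < snd Y1" using t(1) by (rule less_le_trans)
          then have "1 \<le> real N ^ n * (1 / snd Y1 ^ n)" using t by (simp add: power_mono)
          then have "1 * A (Y1, Y2) \<le> ennreal (real N ^ n * (1 / snd Y1 ^ n)) * A (Y1, Y2)"
            by (intro mult_right_mono) auto
          also have "\<dots> = ennreal (real N ^ n) * (A (Y1, Y2) * ennreal (1 / snd Y1 ^ n))"
            by (subst ennreal_mult') (auto simp: ac_simps)
          finally have "A (Y1, Y2) \<le> ennreal (real N ^ n) * (A (Y1, Y2) * ennreal (1 / snd Y1 ^ n))" by simp
          then have "1 + A (Y1, Y2) \<le> 1 + ennreal (real N ^ n) * (A (Y1, Y2) * ennreal (1 / snd Y1 ^ n))"
            by (rule add_left_mono)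
          with epowr_le_one_plus[OF e, of "A (Y1, Y2)"] show ?thesis using True by (auto intro: order_trans)
        qed auto
      qed
      also have "\<dots> = indicator (S' N) Y2 * (emeasure upper (S N) + ennreal (real N ^ n) * (\<integral>\<^sup>+Y1. A (Y1, Y2) * ennreal (1 / snd Y1 ^ n) \<partial>upper))"
        by (simp add: nn_integral_cmult nn_integral_add)
      also have "\<dots> \<le> indicator (S' N) Y2 * (emeasure upper (S N) + ennreal (real N ^ n) * ennreal C)"
        using h unfolding n_def by (intro mult_left_mono add_left_mono) auto
      finally show "(\<integral>\<^sup>+Y1. epowr (A (Y1, Y2)) e * indicator (S N \<times> S' N) (Y1, Y2) \<partial>upper)
        \<le> indicator (S' N) Y2 * (emeasure upper (S N) + ennreal (real N ^ n) * ennreal C)" .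
    qed
    also have "\<dots> = emeasure upper (S' N) * (emeasure upper (S N) + ennreal (real N ^ n) * ennreal C)"
      by (simp add: nn_integral_multc)
    also have "\<dots> < top"
      using emeasure_upper_truncated[of N, where 'a='a] emeasure_upper_truncated[of N, where 'a='b]
      by (simp add: S_def S'_def ennreal_mult_less_top)
    finally show ?thesis .
  qed
  have inc: "incseq (\<lambda>N. S N \<times> S' N)"
  proof (rule incseq_SucI)
    fix N :: nat
    have "1 / (real (Suc N) + 1) \<le> 1 / (real N + 1)" by (intro divide_left_mono) auto
    then show "S N \<times> S' N \<subseteq> S (Suc N) \<times> S' (Suc N)" by (auto simp: S_def S'_def)
  qed
  have UN: "X \<in> (\<Union>N. S N \<times> S' N)" if X: "0 < snd (fst X)" "0 < snd (snd X)" for X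
  proof -
    define b where "b = norm (fst (fst X)) + norm (fst (snd X)) + snd (fst X) + snd (snd X) + 1 / snd (fst X) + 1 / snd (snd X)"
    obtain N where N: "b \<le> real N" using real_arch_simple by blast
    have "0 \<le> 1 / snd (fst X)" "0 \<le> 1 / snd (snd X)" using X by auto
    then have le: "norm (fst (fst X)) \<le> N" "norm (fst (snd X)) \<le> N" "snd (fst X) \<le> N" "snd (snd X) \<le> N"
      "1 / snd (fst X) \<le> real N + 1" "1 / snd (snd X) \<le> real N + 1"
      using N X norm_ge_zero[of "fst (fst X)"] norm_ge_zero[of "fst (snd X)"] unfolding b_def by linarith+
    then have "1 / (real N + 1) \<le> snd (fst X)" "1 / (real N + 1) \<le> snd (snd X)"
      using X by (auto simp: field_simps)
    then show ?thesis using le by (intro UN_I[of N]) (auto simp: S_def S'_def mem_Times_iff)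
  qed
  have "(\<integral>\<^sup>+X. epowr (A X) e * indicator U X \<partial>MU) \<le> ennreal K * emeasure lborel \<Omega>"
    if [measurable]: "U \<in> sets borel" "\<Omega> \<in> sets borel"
      and sub: "\<And>X z. X \<in> U \<Longrightarrow> dist (fst (fst X)) (fst z) < snd (fst X) \<Longrightarrow> dist (fst (snd X)) (snd z) < snd (snd X) \<Longrightarrow> z \<in> \<Omega>" for U \<Omega>
  proof -
    have "(\<integral>\<^sup>+X. epowr (A X) e * indicator U X \<partial>MU) = (\<integral>\<^sup>+X. (SUP N. epowr (A X) e * indicator (U \<inter> S N \<times> S' N) X) \<partial>MU)"
    proof (rule nn_integral_cong_AE, use AE_pos in eventually_elim)
      fix X :: "('a \<times> real) \<times> ('b \<times> real)" assume X: "0 < snd (fst X) \<and> 0 < snd (snd X)"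
      then obtain N where N: "X \<in> S N \<times> S' N" using UN by blast
      show "epowr (A X) e * indicator U X = (SUP N. epowr (A X) e * indicator (U \<inter> S N \<times> S' N) X)"
      proof (rule antisym)
        show "epowr (A X) e * indicator U X \<le> (SUP N. epowr (A X) e * indicator (U \<inter> S N \<times> S' N) X)"
          using N by (intro SUP_upper2[of N]) (auto split: split_indicator)
        show "(SUP N. epowr (A X) e * indicator (U \<inter> S N \<times> S' N) X) \<le> epowr (A X) e * indicator U X"
          by (intro SUP_least) (auto split: split_indicator)
      qed
    qed
    also have "\<dots> = (SUP N. \<integral>\<^sup>+X. epowr (A X) e * indicator (U \<inter> S N \<times> S' N) X \<partial>MU)"
    proof (rule nn_integral_monotone_convergence_SUP)
      show "incseq (\<lambda>N X. epowr (A X) e * indicator (U \<inter> S N \<times> S' N) X)"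
        using inc by (intro incseq_SucI le_funI mult_left_mono) (auto simp: incseq_Suc_iff split: split_indicator)
    qed measurable
    also have "\<dots> \<le> ennreal K * emeasure lborel \<Omega>"
    proof (rule SUP_least, rule bound)
      fix N
      have "(\<integral>\<^sup>+X. epowr (A X) e * indicator (U \<inter> S N \<times> S' N) X \<partial>MU) \<le> (\<integral>\<^sup>+X. epowr (A X) e * indicator (S N \<times> S' N) X \<partial>MU)"
        by (intro nn_integral_mono) (auto split: split_indicator)
      also note fin
      finally show "(\<integral>\<^sup>+X. epowr (A X) e * indicator (U \<inter> S N \<times> S' N) X \<partial>MU) < top" .
    qed (use sub in \<open>auto\<close>)
    finally show ?thesis .
  qed
  then show ?thesis using K unfolding MU_def by blast
qed

text \<open>A box with \<open>P X > t\<close> lies entirely in the set where \<open>H > t\<close>,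
  because \<open>H\<close> dominates \<open>P X\<close> throughout the box. The packing condition
  applied at each height and the layer-cake formula on both sides give the claim.\<close>

lemma carleson_embedding:
  fixes A :: "('a::euclidean_space \<times> real) \<times> ('b::euclidean_space \<times> real) \<Rightarrow> ennreal" and e C q :: real
  assumes A [measurable]: "A \<in> borel_measurable borel"
    and e: "0 < e" "e < 1" and C: "0 \<le> C" and q: "0 < q"
    and h1: "AE Y2 in upper. (\<integral>\<^sup>+Y1. A (Y1, Y2) * ennreal (1 / snd Y1 ^ DIM('a)) \<partial>upper) \<le> ennreal C"
    and h2: "AE Y1 in upper. (\<integral>\<^sup>+Y2. A (Y1, Y2) * ennreal (1 / snd Y2 ^ DIM('b)) \<partial>upper) \<le> ennreal C"
  shows "\<exists>K\<ge>0. \<forall>P H. P \<in> borel_measurable borel \<longrightarrow> H \<in> borel_measurable borel \<longrightarrow>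
    (\<forall>X z. dist (fst (fst X)) (fst z) < snd (fst X) \<longrightarrow> dist (fst (snd X)) (snd z) < snd (snd X) \<longrightarrow> P X \<le> H z) \<longrightarrow>
    (\<integral>\<^sup>+X. epowr (A X) e * epowr (P X) q \<partial>(upper \<Otimes>\<^sub>M upper)) \<le> ennreal K * (\<integral>\<^sup>+z. epowr (H z) q \<partial>lborel)"
proof -
  define MU where "MU = (upper \<Otimes>\<^sub>M upper :: (('a \<times> real) \<times> ('b \<times> real)) measure)"
  have [measurable_cong]: "sets MU = sets borel" unfolding MU_def by (rule sets_upper_pair)
  have MU: "sigma_finite_measure MU"
    unfolding MU_def by (intro sigma_finite_pair_measure sigma_finite_upper)
  obtain K where K: "0 \<le> K" and cw: "\<And>U \<Omega>. U \<in> sets borel \<Longrightarrow> \<Omega> \<in> sets borel \<Longrightarrow>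
    (\<And>X z. X \<in> U \<Longrightarrow> dist (fst (fst X)) (fst z) < snd (fst X) \<Longrightarrow> dist (fst (snd X)) (snd z) < snd (snd X) \<Longrightarrow> z \<in> \<Omega>) \<Longrightarrow>
    (\<integral>\<^sup>+X. epowr (A X) e * indicator U X \<partial>MU) \<le> ennreal K * emeasure lborel \<Omega>"
    using carleson_weight[OF A e C h1 h2] unfolding MU_def by blast
  have "(\<integral>\<^sup>+X. epowr (A X) e * epowr (P X) q \<partial>MU) \<le> ennreal K * (\<integral>\<^sup>+z. epowr (H z) q \<partial>lborel)"
    if [measurable]: "P \<in> borel_measurable borel" "H \<in> borel_measurable borel"
      and PH: "\<And>X z. dist (fst (fst X)) (fst z) < snd (fst X) \<Longrightarrow> dist (fst (snd X)) (snd z) < snd (snd X) \<Longrightarrow> P X \<le> H z" for P H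
  proof -
    have "(\<integral>\<^sup>+X. epowr (A X) e * epowr (P X) q \<partial>MU)
      = (\<integral>\<^sup>+t\<in>{0<..}. ennreal (q * t powr (q - 1)) * (\<integral>\<^sup>+X. epowr (A X) e * indicator {X. ennreal t < P X} X \<partial>MU) \<partial>lborel)"
      by (intro nn_integral_epowr_layer_cake MU q) measurable
    also have "\<dots> \<le> (\<integral>\<^sup>+t. ennreal K * (ennreal (q * t powr (q - 1)) * (\<integral>\<^sup>+z. 1 * indicator {z. ennreal t < H z} z \<partial>lborel) * indicator {0<..} t) \<partial>lborel)"
    proof (rule nn_integral_mono)
      fix t :: real
      have "(\<integral>\<^sup>+X. epowr (A X) e * indicator {X. ennreal t < P X} X \<partial>MU) \<le> ennreal K * emeasure lborel {z. ennreal t < H z}"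
        using PH by (intro cw) (measurable, auto intro: less_le_trans)
      also have "emeasure lborel {z. ennreal t < H z} = (\<integral>\<^sup>+z. 1 * indicator {z. ennreal t < H z} z \<partial>lborel)" by simp
      finally have "ennreal (q * t powr (q - 1)) * (\<integral>\<^sup>+X. epowr (A X) e * indicator {X. ennreal t < P X} X \<partial>MU) * indicator {0<..} t
        \<le> ennreal (q * t powr (q - 1)) * (ennreal K * (\<integral>\<^sup>+z. 1 * indicator {z. ennreal t < H z} z \<partial>lborel)) * indicator {0<..} t"
        by (intro mult_right_mono mult_left_mono) auto
      then show "ennreal (q * t powr (q - 1)) * (\<integral>\<^sup>+X. epowr (A X) e * indicator {X. ennreal t < P X} X \<partial>MU) * indicator {0<..} t
        \<le> ennreal K * (ennreal (q * t powr (q - 1)) * (\<integral>\<^sup>+z. 1 * indicator {z. ennreal t < H z} z \<partial>lborel) * indicator {0<..} t)"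
        by (simp only: ac_simps)
    qed
    also have "\<dots> = ennreal K * (\<integral>\<^sup>+t\<in>{0<..}. ennreal (q * t powr (q - 1)) * (\<integral>\<^sup>+z. 1 * indicator {z. ennreal t < H z} z \<partial>lborel) \<partial>lborel)"
      by (intro nn_integral_cmult) measurable
    also have "\<dots> = ennreal K * (\<integral>\<^sup>+z. 1 * epowr (H z) q \<partial>lborel)"
      by (subst nn_integral_epowr_layer_cake[OF lborel.sigma_finite_measure_axioms q]) simp_all
    finally show ?thesis by simp
  qed
  then show ?thesis using K unfolding MU_def by blast
qed

section \<open>Kernels and Hilbert-Schmidt bounds\<close>

text \<open>Both integrals are normalised to 1 and the integrand is bounded by the sum of the two
  normalised functions; this costs the factor 2. If one integral vanishes, so does the product
  almost everywhere; if one is infinite and neither vanishes, the right side is infinite.\<close>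

lemma nn_integral_Holder:
  assumes [measurable]: "\<phi> \<in> borel_measurable M" "\<psi> \<in> borel_measurable M"
    and ab: "0 < a" "0 < b" "a + b = 1"
  shows "(\<integral>\<^sup>+x. epowr (\<phi> x) a * epowr (\<psi> x) b \<partial>M) \<le> 2 * (epowr (\<integral>\<^sup>+x. \<phi> x \<partial>M) a * epowr (\<integral>\<^sup>+x. \<psi> x \<partial>M) b)"
proof (cases "(\<integral>\<^sup>+x. \<phi> x \<partial>M) = 0 \<or> (\<integral>\<^sup>+x. \<psi> x \<partial>M) = 0")
  case True
  then have "(AE x in M. \<phi> x = 0) \<or> (AE x in M. \<psi> x = 0)"
    by (simp add: nn_integral_0_iff_AE)
  then have "AE x in M. epowr (\<phi> x) a * epowr (\<psi> x) b = 0"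
    by (elim disjE) (erule eventually_mono, simp)+
  then have "(\<integral>\<^sup>+x. epowr (\<phi> x) a * epowr (\<psi> x) b \<partial>M) = (\<integral>\<^sup>+x. 0 \<partial>M)" by (rule nn_integral_cong_AE)
  then show ?thesis by simp
next
  case nz: False
  show ?thesis
  proof (cases "(\<integral>\<^sup>+x. \<phi> x \<partial>M) = top \<or> (\<integral>\<^sup>+x. \<psi> x \<partial>M) = top")
    case True
    then show ?thesis using nz by (auto simp: ennreal_mult_top ennreal_top_mult)
  next
    case False
    then obtain u v where u: "(\<integral>\<^sup>+x. \<phi> x \<partial>M) = ennreal u" "0 < u" and v: "(\<integral>\<^sup>+x. \<psi> x \<partial>M) = ennreal v" "0 < v"
      using nz by (cases "\<integral>\<^sup>+x. \<phi> x \<partial>M"; cases "\<integral>\<^sup>+x. \<psi> x \<partial>M") (auto simp: ennreal_eq_0_iff less_le)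
    let ?c = "epowr (ennreal u) a * epowr (ennreal v) b"
    have "epowr (\<phi> x) a * epowr (\<psi> x) b \<le> ?c * (ennreal (1 / u) * \<phi> x + ennreal (1 / v) * \<psi> x)" for x
    proof -
      have "\<phi> x = ennreal u * (ennreal (1 / u) * \<phi> x)" "\<psi> x = ennreal v * (ennreal (1 / v) * \<psi> x)"
        using u(2) v(2) by (simp_all add: mult.assoc[symmetric] flip: ennreal_mult)
      then have "epowr (\<phi> x) a * epowr (\<psi> x) b
        = (epowr (ennreal u) a * epowr (ennreal (1 / u) * \<phi> x) a) * (epowr (ennreal v) b * epowr (ennreal (1 / v) * \<psi> x) b)"
        by (metis epowr_mult)
      also have "\<dots> = ?c * (epowr (ennreal (1 / u) * \<phi> x) a * epowr (ennreal (1 / v) * \<psi> x) b)"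
        by (simp only: ac_simps)
      also have "\<dots> \<le> ?c * (ennreal (1 / u) * \<phi> x + ennreal (1 / v) * \<psi> x)"
        by (intro mult_left_mono order_trans[OF epowr_interpolate_le[OF ab]]) (auto simp: add_increasing add_increasing2)
      finally show ?thesis .
    qed
    then have "(\<integral>\<^sup>+x. epowr (\<phi> x) a * epowr (\<psi> x) b \<partial>M) \<le> (\<integral>\<^sup>+x. ?c * (ennreal (1 / u) * \<phi> x + ennreal (1 / v) * \<psi> x) \<partial>M)"
      by (intro nn_integral_mono)
    also have "\<dots> = ?c * (ennreal (1 / u) * ennreal u + ennreal (1 / v) * ennreal v)"
      by (simp add: nn_integral_cmult nn_integral_add u(1) v(1))
    also have "\<dots> = 2 * ?c" using u(2) v(2) by (simp add: mult.commute flip: ennreal_mult)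
    finally show ?thesis by (simp add: u(1) v(1))
  qed
qed

text \<open>With \<open>D = t + norm (x - y)\<close>, the left side equals
  \<open>(t / D) powr d\<close> times the right side for
  \<open>d = \<alpha> / 2 - (n + \<alpha>) * (r - 1)\<close>. The condition on \<open>r\<close> says
  \<open>d \<ge> 0\<close>, and \<open>t \<le> D\<close>.\<close>

lemma size_bound_power_le:
  fixes x y :: "real^'n::finite" and \<alpha> r t :: real
  assumes t: "0 < t" and \<alpha>: "0 < \<alpha>" and r: "1 < r" and le: "(CARD('n) + \<alpha>) * (r - 1) \<le> \<alpha> / 2"
  shows "(t ^ CARD('n)) powr (1 - r) * size_bound \<alpha> t x y powr (2 - r) \<le> size_bound (\<alpha> / 2) t x y"
proof -
  define n where "n = real CARD('n)"
  define D where "D = t + norm (x - y)"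
  have D: "0 < D" "t \<le> D" using t by (auto simp: D_def add_pos_nonneg)
  define d where "d = \<alpha> / 2 - (n + \<alpha>) * (r - 1)"
  have d: "0 \<le> d" using le by (simp add: d_def n_def)
  have "(t ^ CARD('n)) powr (1 - r) * size_bound \<alpha> t x y powr (2 - r)
    = t powr (n * (1 - r) + \<alpha> * (2 - r)) * D powr (- ((n + \<alpha>) * (2 - r)))"
  proof -
    have sz: "size_bound \<alpha> t x y = t powr \<alpha> * D powr (- (n + \<alpha>))"
      unfolding size_bound_def D_def n_def powr_minus_divide by simp
    have "(t ^ CARD('n)) powr (1 - r) = t powr (n * (1 - r))"
      using t by (simp add: n_def powr_powr flip: powr_realpow)
    moreover have "(t powr \<alpha> * D powr (- (n + \<alpha>))) powr (2 - r) = t powr (\<alpha> * (2 - r)) * D powr (- (n + \<alpha>) * (2 - r))"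
      using D by (simp only: powr_mult powr_powr)
    ultimately show ?thesis unfolding sz by (simp only: powr_add mult_minus_left mult.assoc)
  qed
  also have "\<dots> = (t / D) powr d * (t powr (\<alpha> / 2) * D powr (- (n + \<alpha> / 2)))"
  proof -
    have "n * (1 - r) + \<alpha> * (2 - r) = d + \<alpha> / 2" "- ((n + \<alpha>) * (2 - r)) = - d + - (n + \<alpha> / 2)"
      by (simp_all add: d_def field_simps)
    then show ?thesis using t D by (simp only: powr_add powr_quotient[OF t D(1)] ac_simps)
  qed
  also have "\<dots> \<le> 1 * (t powr (\<alpha> / 2) * D powr (- (n + \<alpha> / 2)))"
    using t D d by (intro mult_right_mono powr_le1) auto
  also have "\<dots> = size_bound (\<alpha> / 2) t x y"
    unfolding size_bound_def D_def n_def powr_minus_divide by simp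
  finally show ?thesis .
qed

lemma size_bound_le:
  fixes x y :: "real^'n::finite" and \<alpha> t :: real
  assumes t: "0 < t" and \<alpha>: "0 < \<alpha>"
  shows "size_bound \<alpha> t x y \<le> 1 / t ^ CARD('n)"
proof -
  have "size_bound \<alpha> t x y \<le> t powr \<alpha> / t powr (CARD('n) + \<alpha>)"
    unfolding size_bound_def using t \<alpha> by (intro frac_le powr_mono2) auto
  also have "\<dots> = 1 / t ^ CARD('n)"
    using t by (simp add: powr_add powr_realpow)
  finally show ?thesis .
qed

text \<open>Linear maps between spaces of equal dimension preserve null sets, and since
  \<open>g\<close> is a right inverse of \<open>f\<close>, the exceptional set for \<open>g\<close>
  lies in the image under \<open>f\<close> of the original one. It is used with permutations of
  coordinates, so that the variables to be frozen come first.\<close>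

lemma AE_lborel_linear:
  fixes f :: "'a::euclidean_space \<Rightarrow> 'b::euclidean_space"
  assumes P: "AE p in lborel. P p" and f: "linear f" and d: "DIM('a) = DIM('b)" and g: "\<And>q. f (g q) = q"
  shows "AE q in lborel. P (g q)"
proof -
  obtain N where N: "N \<in> null_sets lborel" "{p. \<not> P p} \<subseteq> N"
    using P by (auto simp: eventually_ae_filter)
  then have "negligible N" by (simp add: negligible_iff_null_sets null_sets_completionI)
  then have "negligible (f ` N)"
    using f d by (intro negligible_differentiable_image_negligible linear_imp_differentiable_on) auto
  then have "f ` N \<in> null_sets lebesgue" by (simp add: negligible_iff_null_sets)
  moreover have "{q \<in> space lebesgue. \<not> P (g q)} \<subseteq> f ` N"
  proof
    fix q assume "q \<in> {q \<in> space lebesgue. \<not> P (g q)}"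
    then have "g q \<in> N" using N(2) by blast
    then have "f (g q) \<in> f ` N" by (rule imageI)
    then show "q \<in> f ` N" by (simp only: g)
  qed
  ultimately have "AE q in lebesgue. P (g q)" by (rule AE_I')
  then show ?thesis by (simp add: AE_completion_iff)
qed

lemma AE_lborel_PairD:
  assumes "AE p in (lborel :: ('a::euclidean_space \<times> 'b::euclidean_space) measure). P p"
  shows "AE x in lborel. AE y in lborel. P (x, y)"
  using assms unfolding lborel_prod[symmetric] by (rule lborel_pair.AE_pair)

lemma lebesgue_measurable_ex_borel:
  fixes f :: "'a::euclidean_space \<Rightarrow> complex"
  assumes "f \<in> borel_measurable lebesgue"
  shows "\<exists>g \<in> borel_measurable borel. AE x in lborel. f x = g x"
proof -
  have re: "(\<lambda>x. Re (f x)) \<in> borel_measurable lebesgue" and im: "(\<lambda>x. Im (f x)) \<in> borel_measurable lebesgue"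
    by (rule measurable_compose[OF assms], intro borel_measurable_continuous_onI continuous_intros)+
  obtain u where u: "u \<in> borel_measurable lborel" "AE x in lborel. Re (f x) = u x"
    using completion_ex_borel_measurable_real[OF re] by blast
  obtain v where v: "v \<in> borel_measurable lborel" "AE x in lborel. Im (f x) = v x"
    using completion_ex_borel_measurable_real[OF im] by blast
  have [measurable]: "u \<in> borel_measurable borel" "v \<in> borel_measurable borel" using u(1) v(1) by simp_all
  show ?thesis
  proof (rule bexI)
    show "AE x in lborel. f x = complex_of_real (u x) + \<i> * complex_of_real (v x)"
      using u(2) v(2) by eventually_elim (simp add: complex_eq_iff)
    show "(\<lambda>x. complex_of_real (u x) + \<i> * complex_of_real (v x)) \<in> borel_measurable borel"
      by measurable
  qed
qed

lemma AE_upperI: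
  assumes "AE Y in lborel. 0 < snd Y \<longrightarrow> P Y"
  shows "AE Y in upper. P Y"
proof -
  have "AE Y in lborel. 0 < ennreal (if 0 < snd Y then 1 / snd Y else 0) \<longrightarrow> P Y"
    using assms by (rule eventually_mono) (simp split: if_splits)
  then show ?thesis unfolding upper_def by (subst AE_density) simp_all
qed

lemma cube_borel [measurable]: "cube a l \<in> sets borel"
proof -
  have "cube a l = (\<Inter>i. {z. a $ i \<le> z $ i} \<inter> {z. z $ i < a $ i + l})" by (auto simp: cube_def)
  moreover have "closed {z. a $ i \<le> z $ i}" "open {z. z $ i < a $ i + l}" for i
    by (intro closed_Collect_le open_Collect_less continuous_intros)+
  then have "(\<Inter>i. {z. a $ i \<le> z $ i} \<inter> {z. z $ i < a $ i + l}) \<in> sets borel"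
    by (intro sets.finite_INT sets.Int borel_closed borel_open) simp_all
  ultimately show ?thesis by simp
qed

text \<open>The Carleson norm carries no factor \<open>\<bar>I\<bar>\<close>, so letting the cube grow bounds the Hilbert-Schmidt norm.\<close>

lemma hilbert_schmidt_of_carleson_norm:
  fixes k :: "real \<Rightarrow> real^'n::finite \<Rightarrow> real^'n \<Rightarrow> complex" and \<kappa> :: "((real^'n) \<times> real) \<times> (real^'n) \<Rightarrow> ennreal"
  assumes [measurable]: "\<kappa> \<in> borel_measurable borel"
    and ae: "AE Y in lborel. 0 < snd Y \<longrightarrow> (AE y in lborel. ennreal ((cmod (k (snd Y) (fst Y) y))\<^sup>2) = \<kappa> (Y, y))"
    and c: "\<And>a l. 0 < l \<Longrightarrow> carleson_norm a l k \<le> ennreal c" and c0: "0 \<le> c"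
  shows "(\<integral>\<^sup>+Y. (\<integral>\<^sup>+y. \<kappa> (Y, y) \<partial>lborel) \<partial>upper) \<le> ennreal (c\<^sup>2)"
proof -
  \<comment> \<open>Cubes of side \<open>2 * (N + 1)\<close> centred at the origin;
    \<open>Suc\<close> keeps the side positive for \<open>N = 0\<close>. The time range below the
    side length grows along with them.\<close>
  define Q where "Q = (\<lambda>N::nat. cube (\<chi> i. - real (Suc N)) (2 * real (Suc N)) :: (real^'n) set)"
  define \<psi> where "\<psi> = (\<lambda>(N::nat) p. indicator (Q N \<times> {0<..<2 * real (Suc N)}) (fst p) * (ennreal (1 / snd (fst p)) * (\<kappa> p * indicator (Q N) (snd p))))"
  have [measurable]: "Q N \<in> sets borel" for N unfolding Q_def by (rule cube_borel)
  have [measurable]: "Q N \<times> {0<..<2 * real (Suc N)} \<in> sets borel" for N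
  proof -
    have "Q N \<times> {0<..<2 * real (Suc N)} \<in> sets (borel \<Otimes>\<^sub>M borel)" by (intro pair_measureI) measurable
    then show ?thesis by (simp only: borel_prod)
  qed
  have [measurable]: "\<kappa> \<in> borel_measurable (borel \<Otimes>\<^sub>M borel)" by (simp add: borel_prod)
  have [measurable]: "\<psi> N \<in> borel_measurable (borel \<Otimes>\<^sub>M borel)" for N
    unfolding \<psi>_def by measurable
  have le: "(\<integral>\<^sup>+p. \<psi> N p \<partial>lborel) \<le> ennreal (c\<^sup>2)" for N
  proof -
    let ?l = "2 * real (Suc N)" and ?a = "\<chi> i. - real (Suc N) :: real^'n"
    have "epowr (\<integral>\<^sup>+(x, t)\<in>Q N \<times> {0<..<?l}. (\<integral>\<^sup>+y\<in>Q N. ennreal ((cmod (k t x y))\<^sup>2 / t) \<partial>lebesgue) \<partial>lebesgue) (1 / 2) \<le> ennreal c"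
      using c[of ?l ?a] unfolding carleson_norm_def Q_def by simp
    then have "(\<integral>\<^sup>+(x, t)\<in>Q N \<times> {0<..<?l}. (\<integral>\<^sup>+y\<in>Q N. ennreal ((cmod (k t x y))\<^sup>2 / t) \<partial>lebesgue) \<partial>lebesgue) \<le> ennreal (c\<^sup>2)"
      using c0 by (simp add: epowr_le_iff epowr_two flip: ennreal_power)
    moreover have "(\<integral>\<^sup>+(x, t)\<in>Q N \<times> {0<..<?l}. (\<integral>\<^sup>+y\<in>Q N. ennreal ((cmod (k t x y))\<^sup>2 / t) \<partial>lebesgue) \<partial>lebesgue)
      = (\<integral>\<^sup>+Y. (\<integral>\<^sup>+y. \<psi> N (Y, y) \<partial>lborel) \<partial>lborel)"
      unfolding nn_integral_completion
    proof (rule nn_integral_cong_AE, use ae in eventually_elim)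
      fix Y :: "(real^'n) \<times> real"
      assume Y: "0 < snd Y \<longrightarrow> (AE y in lborel. ennreal ((cmod (k (snd Y) (fst Y) y))\<^sup>2) = \<kappa> (Y, y))"
      show "(case Y of (x, t) \<Rightarrow> \<integral>\<^sup>+y\<in>Q N. ennreal ((cmod (k t x y))\<^sup>2 / t) \<partial>lborel) * indicator (Q N \<times> {0<..<?l}) Y = (\<integral>\<^sup>+y. \<psi> N (Y, y) \<partial>lborel)"
      proof (cases "Y \<in> Q N \<times> {0<..<?l}")
        case True
        then have t: "0 < snd Y" by auto
        have "(\<integral>\<^sup>+y\<in>Q N. ennreal ((cmod (k (snd Y) (fst Y) y))\<^sup>2 / snd Y) \<partial>lborel) = (\<integral>\<^sup>+y. \<psi> N (Y, y) \<partial>lborel)"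
        proof (rule nn_integral_cong_AE, use Y[rule_format, OF t] in eventually_elim)
          fix y assume "ennreal ((cmod (k (snd Y) (fst Y) y))\<^sup>2) = \<kappa> (Y, y)"
          then show "ennreal ((cmod (k (snd Y) (fst Y) y))\<^sup>2 / snd Y) * indicator (Q N) y = \<psi> N (Y, y)"
            using True t by (simp add: \<psi>_def divide_inverse ennreal_mult ac_simps)
        qed
        then show ?thesis using True by (simp add: split_beta)
      qed (simp add: \<psi>_def)
    qed
    moreover have "(\<integral>\<^sup>+Y. (\<integral>\<^sup>+y. \<psi> N (Y, y) \<partial>lborel) \<partial>lborel) = (\<integral>\<^sup>+p. \<psi> N p \<partial>lborel)"
    proof -
      have "(\<integral>\<^sup>+Y. (\<integral>\<^sup>+y. \<psi> N (Y, y) \<partial>lborel) \<partial>lborel) = (\<integral>\<^sup>+p. \<psi> N p \<partial>(lborel \<Otimes>\<^sub>M lborel))"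
        by (rule lborel.nn_integral_fst) measurable
      then show ?thesis by (simp only: lborel_prod)
    qed
    ultimately show ?thesis by simp
  qed
  have Qi: "z \<in> Q N \<longleftrightarrow> (\<forall>i. - (real N + 1) \<le> z $ i \<and> z $ i < real N + 1)" for z N
    by (simp add: Q_def cube_def algebra_simps)
  have inc: "incseq \<psi>"
  proof (intro incseq_SucI le_funI)
    fix N p
    have "Q N \<subseteq> Q (Suc N)"
    proof
      fix z assume "z \<in> Q N"
      then have *: "- (real N + 1) \<le> z $ i" "z $ i < real N + 1" for i by (simp_all add: Qi)
      have "- (real (Suc N) + 1) \<le> z $ i \<and> z $ i < real (Suc N) + 1" for i using *[of i] by simp
      then show "z \<in> Q (Suc N)" by (simp only: Qi) blast
    qed
    then show "\<psi> N p \<le> \<psi> (Suc N) p" unfolding \<psi>_def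
      by (intro mult_mono) (auto split: split_indicator)
  qed
  have "(\<integral>\<^sup>+Y. (\<integral>\<^sup>+y. \<kappa> (Y, y) \<partial>lborel) \<partial>upper) = (\<integral>\<^sup>+Y. ennreal (if 0 < snd Y then 1 / snd Y else 0) * (\<integral>\<^sup>+y. \<kappa> (Y, y) \<partial>lborel) \<partial>lborel)"
    unfolding upper_def by (intro nn_integral_density) measurable
  also have "\<dots> = (\<integral>\<^sup>+Y. (\<integral>\<^sup>+y. ennreal (if 0 < snd Y then 1 / snd Y else 0) * \<kappa> (Y, y) \<partial>lborel) \<partial>lborel)"
    by (intro nn_integral_cong nn_integral_cmult[symmetric]) measurable
  also have "\<dots> = (\<integral>\<^sup>+p. ennreal (if 0 < snd (fst p) then 1 / snd (fst p) else 0) * \<kappa> p \<partial>(lborel \<Otimes>\<^sub>M lborel))"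
    by (subst lborel.nn_integral_fst[symmetric]) (measurable, simp cong: if_cong)
  also have "\<dots> = (\<integral>\<^sup>+p. (SUP N. \<psi> N p) \<partial>(lborel \<Otimes>\<^sub>M lborel))"
  proof (rule nn_integral_cong)
    fix p :: "((real^'n) \<times> real) \<times> (real^'n)"
    define b where "b = norm (fst (fst p)) + norm (snd p) + \<bar>snd (fst p)\<bar>"
    obtain N where N: "b \<le> real N" using real_arch_simple by blast
    have Q: "z \<in> Q N" if "norm z \<le> b" for z
    proof -
      have "- (real N + 1) \<le> z $ i \<and> z $ i < real N + 1" for i
        using component_le_norm_cart[of z i] that N by linarith
      then show ?thesis by (simp only: Qi) blast
    qed
    have "norm (fst (fst p)) \<le> b" "norm (snd p) \<le> b" "snd (fst p) \<le> real N"
      using N norm_ge_zero[of "fst (fst p)"] norm_ge_zero[of "snd p"] abs_ge_self[of "snd (fst p)"] abs_ge_zero[of "snd (fst p)"]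
      unfolding b_def by linarith+
    then have m: "fst (fst p) \<in> Q N" "snd p \<in> Q N" "snd (fst p) < 2 * real (Suc N)" using Q by auto
    show "ennreal (if 0 < snd (fst p) then 1 / snd (fst p) else 0) * \<kappa> p = (SUP N. \<psi> N p)"
    proof (rule antisym)
      show "ennreal (if 0 < snd (fst p) then 1 / snd (fst p) else 0) * \<kappa> p \<le> (SUP N. \<psi> N p)"
        using m by (intro SUP_upper2[of N]) (auto simp: \<psi>_def mem_Times_iff)
      show "(SUP N. \<psi> N p) \<le> ennreal (if 0 < snd (fst p) then 1 / snd (fst p) else 0) * \<kappa> p"
        by (intro SUP_least) (auto simp: \<psi>_def split: split_indicator)
    qed
  qed
  also have "\<dots> = (SUP N. \<integral>\<^sup>+p. \<psi> N p \<partial>(lborel \<Otimes>\<^sub>M lborel))"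
    by (intro nn_integral_monotone_convergence_SUP inc) measurable
  also have "\<dots> \<le> ennreal (c\<^sup>2)" using le by (intro SUP_least) (simp add: lborel_prod)
  finally show ?thesis .
qed

text \<open>The one-parameter theorem in the first variable with the second frozen, then Tonelli,
  then the theorem in the second variable. Most of the work is joint measurability of the inner
  maximal function.\<close>

lemma strong_maximal:
  assumes q: "1 < q"
  shows "\<exists>K\<ge>0. \<forall>F :: 'a::euclidean_space \<times> 'b::euclidean_space \<Rightarrow> ennreal. F \<in> borel_measurable borel \<longrightarrow>
    (\<lambda>z. strong_max F z) \<in> borel_measurable borel \<and>
    (\<integral>\<^sup>+z. epowr (strong_max F z) q \<partial>lborel) \<le> ennreal K * (\<integral>\<^sup>+z. epowr (F z) q \<partial>lborel)"
proof -
  obtain K1 where K1: "0 \<le> K1" "\<And>F::'a \<Rightarrow> ennreal. F \<in> borel_measurable borel \<Longrightarrow>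
    (\<integral>\<^sup>+x. epowr (hl_max F x) q \<partial>lborel) \<le> ennreal K1 * (\<integral>\<^sup>+x. epowr (F x) q \<partial>lborel)"
    using hl_max_strong_type[OF q, where 'a='a] by blast
  obtain K2 where K2: "0 \<le> K2" "\<And>F::'b \<Rightarrow> ennreal. F \<in> borel_measurable borel \<Longrightarrow>
    (\<integral>\<^sup>+x. epowr (hl_max F x) q \<partial>lborel) \<le> ennreal K2 * (\<integral>\<^sup>+x. epowr (F x) q \<partial>lborel)"
    using hl_max_strong_type[OF q, where 'a='b] by blast
  have "(\<lambda>z. strong_max F z) \<in> borel_measurable borel \<and>
    (\<integral>\<^sup>+z. epowr (strong_max F z) q \<partial>lborel) \<le> ennreal (K1 * K2) * (\<integral>\<^sup>+z. epowr (F z) q \<partial>lborel)"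
    if [measurable]: "F \<in> borel_measurable borel" for F :: "'a \<times> 'b \<Rightarrow> ennreal"
  proof
    have F [measurable]: "F \<in> borel_measurable (borel \<Otimes>\<^sub>M borel)" by (simp add: borel_prod)
    define G where "G = (\<lambda>y1 z2. hl_max (\<lambda>y2. F (y1, y2)) z2)"
    have G: "(\<lambda>(y1, z2). G y1 z2) \<in> borel_measurable (borel \<Otimes>\<^sub>M borel)"
      unfolding G_def split_beta by measurable
    have [measurable]: "(\<lambda>y1. G y1 z2) \<in> borel_measurable borel" "G y1 \<in> borel_measurable borel" for y1 z2
      using measurable_compose[OF measurable_Pair2'[of z2 borel borel] G] measurable_compose[OF measurable_Pair1'[of y1 borel borel] G]
      by simp_all
    have [measurable]: "(\<lambda>(z2, y1). G y1 z2) \<in> borel_measurable (borel \<Otimes>\<^sub>M borel)"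
      using measurable_compose[OF measurable_pair_swap' G] by (simp add: split_beta)
    have H: "(\<lambda>z. hl_max (\<lambda>y1. G y1 (snd z)) (fst z)) \<in> borel_measurable (borel \<Otimes>\<^sub>M borel)"
      by measurable
    then show "(\<lambda>z. strong_max F z) \<in> borel_measurable borel"
      unfolding G_def borel_prod .
    note [measurable] = H
    have "(\<integral>\<^sup>+z. epowr (hl_max (\<lambda>y1. G y1 (snd z)) (fst z)) q \<partial>(lborel \<Otimes>\<^sub>M lborel))
      = (\<integral>\<^sup>+z2. (\<integral>\<^sup>+z1. epowr (hl_max (\<lambda>y1. G y1 z2) z1) q \<partial>lborel) \<partial>lborel)"
      by (subst lborel_pair.nn_integral_snd[symmetric]) simp_all
    also have "\<dots> \<le> (\<integral>\<^sup>+z2. ennreal K1 * (\<integral>\<^sup>+z1. epowr (G z1 z2) q \<partial>lborel) \<partial>lborel)"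
      by (intro nn_integral_mono K1) measurable
    also have "\<dots> = ennreal K1 * (\<integral>\<^sup>+z2. (\<integral>\<^sup>+z1. epowr (G z1 z2) q \<partial>lborel) \<partial>lborel)"
      by (intro nn_integral_cmult) measurable
    also have "(\<integral>\<^sup>+z2. (\<integral>\<^sup>+z1. epowr (G z1 z2) q \<partial>lborel) \<partial>lborel) = (\<integral>\<^sup>+z1. (\<integral>\<^sup>+z2. epowr (G z1 z2) q \<partial>lborel) \<partial>lborel)"
      using G by (intro lborel_pair.Fubini') measurable
    also have "ennreal K1 * \<dots> \<le> ennreal K1 * (\<integral>\<^sup>+z1. ennreal K2 * (\<integral>\<^sup>+z2. epowr (F (z1, z2)) q \<partial>lborel) \<partial>lborel)"
      unfolding G_def by (intro mult_left_mono nn_integral_mono K2) measurable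
    also have "\<dots> = ennreal (K1 * K2) * (\<integral>\<^sup>+z1. (\<integral>\<^sup>+z2. epowr (F (z1, z2)) q \<partial>lborel) \<partial>lborel)"
      using K1(1) K2(1) by (subst nn_integral_cmult) (auto simp: ennreal_mult mult.assoc)
    also have "(\<integral>\<^sup>+z1. (\<integral>\<^sup>+z2. epowr (F (z1, z2)) q \<partial>lborel) \<partial>lborel) = (\<integral>\<^sup>+z. epowr (F z) q \<partial>(lborel \<Otimes>\<^sub>M lborel))"
      by (subst lborel.nn_integral_fst[symmetric]) simp_all
    finally show "(\<integral>\<^sup>+z. epowr (strong_max F z) q \<partial>lborel) \<le> ennreal (K1 * K2) * (\<integral>\<^sup>+z. epowr (F z) q \<partial>lborel)"
      unfolding G_def lborel_prod .
  qed
  moreover have "0 \<le> K1 * K2" using K1(1) K2(1) by simp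
  ultimately show ?thesis by blast
qed

text \<open>Hoelder with exponents \<open>1 - 1 / r\<close> and \<open>1 / r\<close>. The first
  factor retains the square of the kernel, which carries the Hilbert-Schmidt information; the second
  has the kernel only to the power \<open>2 - r > 0\<close>, where the size estimate suffices and
  becomes a kernel with half the exponents.\<close>

lemma kernel_integral_le:
  fixes \<sigma> f :: "(real^'n::finite) \<times> (real^'m::finite) \<Rightarrow> complex" and \<alpha> \<beta> r t1 t2 c :: real
  assumes [measurable]: "\<sigma> \<in> borel_measurable borel" "f \<in> borel_measurable borel"
    and ab: "0 < \<alpha>" "0 < \<beta>" and r: "1 < r" "r < 2" and t: "0 < t1" "0 < t2" and c: "0 \<le> c"
    and r1: "(CARD('n) + \<alpha>) * (r - 1) \<le> \<alpha> / 2" and r2: "(CARD('m) + \<beta>) * (r - 1) \<le> \<beta> / 2"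
    and bd: "AE y in lborel. cmod (\<sigma> y) \<le> c * (size_bound \<alpha> t1 x1 (fst y) * size_bound \<beta> t2 x2 (snd y))"
  shows "(\<integral>\<^sup>+y. ennreal (cmod (\<sigma> y * f y)) \<partial>lborel)
    \<le> 2 * (epowr (ennreal (t1 ^ CARD('n) * t2 ^ CARD('m)) * (\<integral>\<^sup>+y. ennreal ((cmod (\<sigma> y))\<^sup>2) \<partial>lborel)) (1 - 1 / r) *
      epowr (ennreal (c powr (2 - r)) * (\<integral>\<^sup>+y. ennreal (size_bound (\<alpha> / 2) t1 x1 (fst y) * size_bound (\<beta> / 2) t2 x2 (snd y)) * ennreal (cmod (f y) powr r) \<partial>lborel)) (1 / r))"
proof -
  define V where "V = t1 ^ CARD('n) * t2 ^ CARD('m)"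
  have V: "0 < V" using t by (simp add: V_def)
  let ?Z = "\<lambda>y. size_bound (\<alpha> / 2) t1 x1 (fst y) * size_bound (\<beta> / 2) t2 x2 (snd y)"
  \<comment> \<open>The powers of \<open>V\<close> and of \<open>cmod (\<sigma> y)\<close> are
    chosen so that \<open>V\<close> cancels in the product of \<open>\<phi>\<close> to the power
    \<open>1 - 1 / r\<close> and \<open>\<psi>\<close> to the power \<open>1 / r\<close>, while
    \<open>cmod (\<sigma> y * f y)\<close> remains.\<close>
  define \<phi> where "\<phi> = (\<lambda>y. ennreal (V * (cmod (\<sigma> y))\<^sup>2))"
  define \<psi> where "\<psi> = (\<lambda>y. ennreal (V powr (1 - r) * cmod (\<sigma> y) powr (2 - r) * cmod (f y) powr r))"
  have [measurable]: "\<phi> \<in> borel_measurable borel" "\<psi> \<in> borel_measurable borel"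
    unfolding \<phi>_def \<psi>_def by measurable
  have r0: "0 < 1 - 1 / r" "0 < 1 / r" "1 - 1 / r + 1 / r = 1" using r by auto
  have eq: "ennreal (cmod (\<sigma> y * f y)) = epowr (\<phi> y) (1 - 1 / r) * epowr (\<psi> y) (1 / r)" for y
  proof (cases "\<sigma> y = 0")
    case False
    define b where "b = cmod (\<sigma> y)"
    have b: "0 < b" using False by (simp add: b_def)
    have 1: "(V * b\<^sup>2) powr (1 - 1 / r) = V powr (1 - 1 / r) * b powr (2 * (1 - 1 / r))"
    proof -
      have "b\<^sup>2 = b powr 2" using b by (simp add: powr_numeral)
      then show ?thesis using V by (simp only: powr_mult powr_powr)
    qed
    have 2: "(V powr (1 - r) * b powr (2 - r) * cmod (f y) powr r) powr (1 / r) = V powr ((1 - r) * (1 / r)) * b powr ((2 - r) * (1 / r)) * cmod (f y)"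
      using r by (simp add: powr_mult powr_powr)
    have 3: "V powr (1 - 1 / r) * V powr ((1 - r) * (1 / r)) = 1"
    proof -
      have "1 - 1 / r + (1 - r) * (1 / r) = 0" using r by (simp add: field_simps)
      then show ?thesis using V by (simp only: powr_add[symmetric] powr_zero_eq_one)  simp
    qed
    have 4: "b powr (2 * (1 - 1 / r)) * b powr ((2 - r) * (1 / r)) = b"
    proof -
      have "2 * (1 - 1 / r) + (2 - r) * (1 / r) = 1" using r by (simp add: field_simps)
      then show ?thesis using b by (simp only: powr_add[symmetric]) simp
    qed
    have "(V * b\<^sup>2) powr (1 - 1 / r) * (V powr (1 - r) * b powr (2 - r) * cmod (f y) powr r) powr (1 / r)
      = (V powr (1 - 1 / r) * V powr ((1 - r) * (1 / r))) * (b powr (2 * (1 - 1 / r)) * b powr ((2 - r) * (1 / r))) * cmod (f y)"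
      unfolding 1 2 by (simp only: ac_simps)
    also have "\<dots> = cmod (\<sigma> y * f y)" unfolding 3 4 by (simp add: norm_mult b_def)
    finally show ?thesis
      using V by (simp add: \<phi>_def \<psi>_def b_def[symmetric] epowr_ennreal flip: ennreal_mult)
  qed (simp add: \<phi>_def)
  have "(\<integral>\<^sup>+y. ennreal (cmod (\<sigma> y * f y)) \<partial>lborel) \<le> 2 * (epowr (\<integral>\<^sup>+y. \<phi> y \<partial>lborel) (1 - 1 / r) * epowr (\<integral>\<^sup>+y. \<psi> y \<partial>lborel) (1 / r))"
    unfolding eq using r0 by (intro nn_integral_Holder) measurable
  also have "(\<integral>\<^sup>+y. \<phi> y \<partial>lborel) = ennreal V * (\<integral>\<^sup>+y. ennreal ((cmod (\<sigma> y))\<^sup>2) \<partial>lborel)"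
    using V by (simp add: \<phi>_def ennreal_mult nn_integral_cmult)
  also have "epowr (\<integral>\<^sup>+y. \<psi> y \<partial>lborel) (1 / r) \<le> epowr (ennreal (c powr (2 - r)) * (\<integral>\<^sup>+y. ennreal (?Z y) * ennreal (cmod (f y) powr r) \<partial>lborel)) (1 / r)"
  proof (rule epowr_mono)
    have "(\<integral>\<^sup>+y. \<psi> y \<partial>lborel) \<le> (\<integral>\<^sup>+y. ennreal (c powr (2 - r)) * (ennreal (?Z y) * ennreal (cmod (f y) powr r)) \<partial>lborel)"
    proof (rule nn_integral_mono_AE, use bd in eventually_elim)
      fix y assume y: "cmod (\<sigma> y) \<le> c * (size_bound \<alpha> t1 x1 (fst y) * size_bound \<beta> t2 x2 (snd y))"
      let ?a = "size_bound \<alpha> t1 x1 (fst y)" and ?b = "size_bound \<beta> t2 x2 (snd y)"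
      have "cmod (\<sigma> y) powr (2 - r) \<le> (c * (?a * ?b)) powr (2 - r)"
        using y r by (intro powr_mono2) auto
      also have "\<dots> = c powr (2 - r) * (?a powr (2 - r) * ?b powr (2 - r))"
        using c by (simp add: powr_mult size_bound_nonneg)
      finally have "V powr (1 - r) * cmod (\<sigma> y) powr (2 - r) \<le> V powr (1 - r) * (c powr (2 - r) * (?a powr (2 - r) * ?b powr (2 - r)))"
        by (intro mult_left_mono) auto
      also have "\<dots> = c powr (2 - r) * (((t1 ^ CARD('n)) powr (1 - r) * ?a powr (2 - r)) * ((t2 ^ CARD('m)) powr (1 - r) * ?b powr (2 - r)))"
      proof -
        have "V powr (1 - r) = (t1 ^ CARD('n)) powr (1 - r) * (t2 ^ CARD('m)) powr (1 - r)"
          unfolding V_def using t by (simp add: powr_mult)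
        then show ?thesis by (simp only: ac_simps)
      qed
      also have "\<dots> \<le> c powr (2 - r) * ?Z y"
        by (intro mult_left_mono mult_mono size_bound_power_le ab t r r1 r2) (auto simp: size_bound_nonneg)
      finally have "V powr (1 - r) * cmod (\<sigma> y) powr (2 - r) * cmod (f y) powr r
        \<le> c powr (2 - r) * ?Z y * cmod (f y) powr r"
        by (intro mult_right_mono) auto
      then have "\<psi> y \<le> ennreal (c powr (2 - r) * ?Z y * cmod (f y) powr r)"
        unfolding \<psi>_def by (rule ennreal_leI)
      then show "\<psi> y \<le> ennreal (c powr (2 - r)) * (ennreal (?Z y) * ennreal (cmod (f y) powr r))"
        by (simp add: ennreal_mult size_bound_nonneg mult.assoc)
    qed
    also have "\<dots> = ennreal (c powr (2 - r)) * (\<integral>\<^sup>+y. ennreal (?Z y) * ennreal (cmod (f y) powr r) \<partial>lborel)"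
      by (intro nn_integral_cmult) measurable
    finally show "(\<integral>\<^sup>+y. \<psi> y \<partial>lborel) \<le> ennreal (c powr (2 - r)) * (\<integral>\<^sup>+y. ennreal (?Z y) * ennreal (cmod (f y) powr r) \<partial>lborel)" .
  qed (use r in auto)
  finally show ?thesis
    unfolding V_def[symmetric] by (simp add: mult_left_mono)
qed

text \<open>Integrate the hypothesis in \<open>y2\<close>: of the squared size bound, one factor is
  estimated by its peak value, the other integrates to at most \<open>K\<close>. The peak value is
  the inverse of \<open>snd Y2 ^ CARD('m)\<close>, so the result \<open>c\<^sup>2 * K\<close> is
  independent of the scale.\<close>

lemma hilbert_schmidt_weight:
  fixes \<kappa> :: "(real^'m::finite) \<times> real \<Rightarrow> real^'m \<Rightarrow> 'a::euclidean_space \<times> real \<Rightarrow> 'a \<Rightarrow> ennreal" and \<beta> c :: real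
  assumes meas: "\<And>Y2. (\<lambda>p. \<kappa> Y2 (fst (fst p)) (snd (fst p)) (snd p)) \<in> borel_measurable ((borel \<Otimes>\<^sub>M borel) \<Otimes>\<^sub>M borel)"
    and b: "0 < \<beta>" and c: "0 \<le> c"
    and hs: "AE Y2 in lborel. 0 < snd Y2 \<longrightarrow> (AE y2 in lborel. (\<integral>\<^sup>+Y1. (\<integral>\<^sup>+y1. \<kappa> Y2 y2 Y1 y1 \<partial>lborel) \<partial>upper) \<le> ennreal ((c * size_bound \<beta> (snd Y2) (fst Y2) y2)\<^sup>2))"
  shows "\<exists>C\<ge>0. AE Y2 in upper. (\<integral>\<^sup>+Y1. (ennreal (snd Y1 ^ DIM('a) * snd Y2 ^ CARD('m)) * (\<integral>\<^sup>+y2. (\<integral>\<^sup>+y1. \<kappa> Y2 y2 Y1 y1 \<partial>lborel) \<partial>lborel)) * ennreal (1 / snd Y1 ^ DIM('a)) \<partial>upper) \<le> ennreal C"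
proof -
  obtain K where K: "0 \<le> K" "\<And>t (x::real^'m). 0 < t \<Longrightarrow> (\<integral>\<^sup>+y. ennreal (size_bound \<beta> t x y) \<partial>lborel) \<le> ennreal K"
    using size_bound_integral[OF b] by blast
  have "AE Y2 in upper. (\<integral>\<^sup>+Y1. (ennreal (snd Y1 ^ DIM('a) * snd Y2 ^ CARD('m)) * (\<integral>\<^sup>+y2. (\<integral>\<^sup>+y1. \<kappa> Y2 y2 Y1 y1 \<partial>lborel) \<partial>lborel)) * ennreal (1 / snd Y1 ^ DIM('a)) \<partial>upper) \<le> ennreal (c\<^sup>2 * K)"
  proof (rule AE_upperI, use hs in eventually_elim, intro impI)
    fix Y2 :: "(real^'m) \<times> real"
    assume *: "0 < snd Y2 \<longrightarrow> (AE y2 in lborel. (\<integral>\<^sup>+Y1. (\<integral>\<^sup>+y1. \<kappa> Y2 y2 Y1 y1 \<partial>lborel) \<partial>upper) \<le> ennreal ((c * size_bound \<beta> (snd Y2) (fst Y2) y2)\<^sup>2))"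
      and t: "0 < snd Y2"
    define s where "s = snd Y2"
    let ?E = "\<lambda>Y1. \<integral>\<^sup>+y2. (\<integral>\<^sup>+y1. \<kappa> Y2 y2 Y1 y1 \<partial>lborel) \<partial>lborel"
    let ?H = "\<lambda>y2. \<integral>\<^sup>+Y1. (\<integral>\<^sup>+y1. \<kappa> Y2 y2 Y1 y1 \<partial>lborel) \<partial>upper"
    define m where "m = CARD('m)"
    have "sets ((lborel \<Otimes>\<^sub>M upper) \<Otimes>\<^sub>M lborel) = sets (((borel :: (real^'m) measure) \<Otimes>\<^sub>M (borel :: ('a \<times> real) measure)) \<Otimes>\<^sub>M (borel :: 'a measure))"
      by (intro sets_pair_measure_cong sets_lborel sets_upper)
    then have [measurable]: "(\<lambda>p. \<kappa> Y2 (fst (fst p)) (snd (fst p)) (snd p)) \<in> borel_measurable ((lborel \<Otimes>\<^sub>M upper) \<Otimes>\<^sub>M lborel)"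
      using meas[of Y2] measurable_cong_sets[OF _ refl] by blast
    have "(\<lambda>p. \<integral>\<^sup>+y1. \<kappa> Y2 (fst p) (snd p) y1 \<partial>lborel) \<in> borel_measurable (lborel \<Otimes>\<^sub>M upper)"
      by measurable
    then have I [measurable]: "(\<lambda>(y2, Y1). \<integral>\<^sup>+y1. \<kappa> Y2 y2 Y1 y1 \<partial>lborel) \<in> borel_measurable (lborel \<Otimes>\<^sub>M upper)"
      by (simp add: split_beta)
    have I' [measurable]: "(\<lambda>Y1. \<integral>\<^sup>+y2. (\<integral>\<^sup>+y1. \<kappa> Y2 y2 Y1 y1 \<partial>lborel) \<partial>lborel) \<in> borel_measurable upper"
      using measurable_compose[OF measurable_pair_swap' I]
      by (intro lborel.borel_measurable_nn_integral) (simp add: split_beta)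
    have "(\<integral>\<^sup>+Y1. (ennreal (snd Y1 ^ DIM('a) * s ^ m) * ?E Y1) * ennreal (1 / snd Y1 ^ DIM('a)) \<partial>upper)
      = (\<integral>\<^sup>+Y1. ennreal (s ^ m) * ?E Y1 \<partial>upper)"
    proof (rule nn_integral_cong_AE, use AE_upper in eventually_elim)
      fix Y1 :: "'a \<times> real" assume Y1: "0 < snd Y1"
      have "ennreal (snd Y1 ^ DIM('a) * s ^ m) * ennreal (1 / snd Y1 ^ DIM('a)) = ennreal (s ^ m)"
        using Y1 t by (subst ennreal_mult'[symmetric]) (auto simp: s_def)
      then show "(ennreal (snd Y1 ^ DIM('a) * s ^ m) * ?E Y1) * ennreal (1 / snd Y1 ^ DIM('a))
        = ennreal (s ^ m) * ?E Y1"
        by (simp only: mult.assoc[symmetric] mult.commute[of _ "ennreal (1 / snd Y1 ^ DIM('a))"])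
    qed
    also have "\<dots> = ennreal (s ^ m) * (\<integral>\<^sup>+Y1. ?E Y1 \<partial>upper)"
      by (intro nn_integral_cmult I')
    also have "(\<integral>\<^sup>+Y1. ?E Y1 \<partial>upper) = (\<integral>\<^sup>+y2. ?H y2 \<partial>lborel)"
      by (rule nn_integral_swap[OF lborel.sigma_finite_measure_axioms sigma_finite_upper I])
    also have "\<dots> \<le> (\<integral>\<^sup>+y2. ennreal (c\<^sup>2 / s ^ m) * ennreal (size_bound \<beta> s (fst Y2) y2) \<partial>lborel)"
    proof (rule nn_integral_mono_AE, use *[rule_format, OF t] in eventually_elim)
      fix y2
      assume "?H y2 \<le> ennreal ((c * size_bound \<beta> (snd Y2) (fst Y2) y2)\<^sup>2)"
      also have "(c * size_bound \<beta> (snd Y2) (fst Y2) y2)\<^sup>2 = c\<^sup>2 * (size_bound \<beta> s (fst Y2) y2 * size_bound \<beta> s (fst Y2) y2)"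
        by (simp add: s_def power2_eq_square)
      also have "\<dots> \<le> c\<^sup>2 * (1 / s ^ m * size_bound \<beta> s (fst Y2) y2)"
        using size_bound_le[of s \<beta> "fst Y2" y2] t b unfolding s_def m_def
        by (intro mult_left_mono mult_right_mono) (auto simp: size_bound_nonneg)
      finally show "?H y2 \<le> ennreal (c\<^sup>2 / s ^ m) * ennreal (size_bound \<beta> s (fst Y2) y2)"
        using t by (simp add: s_def size_bound_nonneg ennreal_leI flip: ennreal_mult)
    qed
    also have "\<dots> = ennreal (c\<^sup>2 / s ^ m) * (\<integral>\<^sup>+y2. ennreal (size_bound \<beta> s (fst Y2) y2) \<partial>lborel)"
      by (intro nn_integral_cmult) measurable
    also have "\<dots> \<le> ennreal (c\<^sup>2 / s ^ m) * ennreal K"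
      using t by (intro mult_left_mono K) (auto simp: s_def)
    also have "ennreal (s ^ m) * (ennreal (c\<^sup>2 / s ^ m) * ennreal K) = ennreal (c\<^sup>2 * K)"
      using t K(1) by (simp add: s_def flip: ennreal_mult)
    finally show "(\<integral>\<^sup>+Y1. (ennreal (snd Y1 ^ DIM('a) * snd Y2 ^ CARD('m)) * ?E Y1) * ennreal (1 / snd Y1 ^ DIM('a)) \<partial>upper) \<le> ennreal (c\<^sup>2 * K)"
      by (simp add: s_def m_def mult_left_mono)
  qed
  moreover have "0 \<le> c\<^sup>2 * K" using K(1) by simp
  ultimately show ?thesis by blast
qed

text \<open>Tonelli only. It identifies the integral over \<open>x\<close> of a weighted integral
  over both times, in the order used by \<open>square_function\<close>, with an integral over all
  boxes.\<close>

lemma nn_integral_upper_pair_eq: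
  fixes h :: "('a::euclidean_space \<times> real) \<times> ('b::euclidean_space \<times> real) \<Rightarrow> ennreal"
  assumes h: "h \<in> borel_measurable borel"
  shows "(\<integral>\<^sup>+x. (\<integral>\<^sup>+t2\<in>{0<..}. (\<integral>\<^sup>+t1\<in>{0<..}. ennreal (1 / (t1 * t2)) * h ((fst x, t1), (snd x, t2)) \<partial>lborel) \<partial>lborel) \<partial>lborel)
    = (\<integral>\<^sup>+X. h X \<partial>(upper \<Otimes>\<^sub>M upper))"
proof -
  have h': "(\<lambda>p. h ((fst (fst (fst p)), snd p), (snd (fst (fst p)), snd (fst p)))) \<in> borel_measurable (((borel \<Otimes>\<^sub>M borel) \<Otimes>\<^sub>M borel) \<Otimes>\<^sub>M borel)"
    unfolding borel_prod
    by (rule borel_measurable_continuous_compose[OF h]) (intro continuous_intros)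
  define J where "J = (\<lambda>x1 x2 t2. \<integral>\<^sup>+t1\<in>{0<..}. ennreal (1 / t1) * h ((x1, t1), (x2, t2)) \<partial>lborel)"
  have "(\<lambda>p. \<integral>\<^sup>+t1\<in>{0<..}. ennreal (1 / t1) * h ((fst (fst p), t1), (snd (fst p), snd p)) \<partial>lborel) \<in> borel_measurable ((borel \<Otimes>\<^sub>M borel) \<Otimes>\<^sub>M borel)"
    using h' by measurable
  then have J: "(\<lambda>p. J (fst (fst p)) (snd (fst p)) (snd p)) \<in> borel_measurable ((borel \<Otimes>\<^sub>M borel) \<Otimes>\<^sub>M borel)"
    by (simp add: J_def)
  have J1: "(\<lambda>(x1, t2). J x1 x2 t2) \<in> borel_measurable (borel \<Otimes>\<^sub>M borel)" for x2
  proof -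
    have "(\<lambda>q. ((fst q, x2), snd q)) \<in> (borel \<Otimes>\<^sub>M borel) \<rightarrow>\<^sub>M ((borel \<Otimes>\<^sub>M borel) \<Otimes>\<^sub>M borel)" by measurable
    from measurable_compose[OF this J] show ?thesis by (simp add: split_beta)
  qed
  have J2: "(\<lambda>t2. J x1 x2 t2) \<in> borel_measurable borel" for x1 x2
  proof -
    have "(\<lambda>t2. ((x1, x2), t2)) \<in> borel \<rightarrow>\<^sub>M ((borel \<Otimes>\<^sub>M borel) \<Otimes>\<^sub>M borel)" by measurable
    from measurable_compose[OF this J] show ?thesis by simp
  qed
  have inner: "(\<integral>\<^sup>+t2\<in>{0<..}. (\<integral>\<^sup>+t1\<in>{0<..}. ennreal (1 / (t1 * t2)) * h ((x1, t1), (x2, t2)) \<partial>lborel) \<partial>lborel) = (\<integral>\<^sup>+t2\<in>{0<..}. ennreal (1 / t2) * J x1 x2 t2 \<partial>lborel)" for x1 x2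
  proof (rule nn_integral_cong)
    fix t2 :: real
    show "(\<integral>\<^sup>+t1\<in>{0<..}. ennreal (1 / (t1 * t2)) * h ((x1, t1), (x2, t2)) \<partial>lborel) * indicator {0<..} t2 = ennreal (1 / t2) * J x1 x2 t2 * indicator {0<..} t2"
    proof (cases "0 < t2")
      case True
      have [measurable]: "(\<lambda>t1. h ((x1, t1), (x2, t2))) \<in> borel_measurable borel"
        by (rule borel_measurable_continuous_compose[OF h]) (intro continuous_intros)
      have "(\<integral>\<^sup>+t1\<in>{0<..}. ennreal (1 / (t1 * t2)) * h ((x1, t1), (x2, t2)) \<partial>lborel)
        = (\<integral>\<^sup>+t1. ennreal (1 / t2) * (ennreal (1 / t1) * h ((x1, t1), (x2, t2)) * indicator {0<..} t1) \<partial>lborel)"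
      proof (rule nn_integral_cong)
        fix t1 :: real
        show "ennreal (1 / (t1 * t2)) * h ((x1, t1), (x2, t2)) * indicator {0<..} t1 = ennreal (1 / t2) * (ennreal (1 / t1) * h ((x1, t1), (x2, t2)) * indicator {0<..} t1)"
        proof (cases "0 < t1")
          case t1: True
          have "ennreal (1 / (t1 * t2)) = ennreal (1 / t2) * ennreal (1 / t1)"
            using True t1 by (subst ennreal_mult[symmetric]) (auto simp: mult.commute)
          then show ?thesis by (simp only: ac_simps)
        qed simp
      qed
      also have "\<dots> = ennreal (1 / t2) * J x1 x2 t2" unfolding J_def by (intro nn_integral_cmult) measurable
      finally show ?thesis by simp
    qed simp
  qed
  have M: "(\<lambda>p. \<integral>\<^sup>+t2\<in>{0<..}. ennreal (1 / t2) * J (fst p) (snd p) t2 \<partial>lborel) \<in> borel_measurable (borel \<Otimes>\<^sub>M borel)"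
    using J by measurable
  have "(\<integral>\<^sup>+x. (\<integral>\<^sup>+t2\<in>{0<..}. (\<integral>\<^sup>+t1\<in>{0<..}. ennreal (1 / (t1 * t2)) * h ((fst x, t1), (snd x, t2)) \<partial>lborel) \<partial>lborel) \<partial>lborel)
    = (\<integral>\<^sup>+x. (\<integral>\<^sup>+t2\<in>{0<..}. ennreal (1 / t2) * J (fst x) (snd x) t2 \<partial>lborel) \<partial>(lborel \<Otimes>\<^sub>M lborel))"
    unfolding inner lborel_prod ..
  also have "\<dots> = (\<integral>\<^sup>+x2. (\<integral>\<^sup>+x1. (\<integral>\<^sup>+t2. ennreal (1 / t2) * J x1 x2 t2 * indicator {0<..} t2 \<partial>lborel) \<partial>lborel) \<partial>lborel)"
    using M by (subst lborel_pair.nn_integral_snd[symmetric]) simp_all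
  also have "\<dots> = (\<integral>\<^sup>+x2. (\<integral>\<^sup>+t2. (\<integral>\<^sup>+x1. ennreal (1 / t2) * J x1 x2 t2 * indicator {0<..} t2 \<partial>lborel) \<partial>lborel) \<partial>lborel)"
  proof (intro nn_integral_cong lborel_pair.Fubini'[symmetric])
    fix x2
    have [measurable]: "(\<lambda>p. J (fst p) x2 (snd p)) \<in> borel_measurable (lborel \<Otimes>\<^sub>M lborel)"
      using J1[of x2] by (simp add: split_beta cong: measurable_cong_sets sets_pair_measure_cong)
    have "(\<lambda>p. ennreal (1 / snd p) * J (fst p) x2 (snd p) * indicator {0<..} (snd p)) \<in> borel_measurable (lborel \<Otimes>\<^sub>M lborel)"
      by measurable
    then show "(\<lambda>(x1, t2). ennreal (1 / t2) * J x1 x2 t2 * indicator {0<..} t2) \<in> borel_measurable (lborel \<Otimes>\<^sub>M lborel)"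
      by (simp add: split_beta)
  qed
  also have "\<dots> = (\<integral>\<^sup>+x2. (\<integral>\<^sup>+t2\<in>{0<..}. ennreal (1 / t2) * (\<integral>\<^sup>+Y1. h (Y1, (x2, t2)) \<partial>upper) \<partial>lborel) \<partial>lborel)"
  proof (intro nn_integral_cong)
    fix x2 t2
    have hs [measurable]: "(\<lambda>Y1. h (Y1, (x2, t2))) \<in> borel_measurable borel"
      by (rule borel_measurable_continuous_compose[OF h]) (intro continuous_intros)
    have Jx [measurable]: "(\<lambda>x1. J x1 x2 t2) \<in> borel_measurable borel"
    proof -
      have "(\<lambda>x1. ((x1, x2), t2)) \<in> borel \<rightarrow>\<^sub>M ((borel \<Otimes>\<^sub>M borel) \<Otimes>\<^sub>M borel)" by measurable
      from measurable_compose[OF this J] show ?thesis by simp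
    qed
    have "(\<integral>\<^sup>+x1. ennreal (1 / t2) * J x1 x2 t2 * indicator {0<..} t2 \<partial>lborel) = (\<integral>\<^sup>+x1. (ennreal (1 / t2) * indicator {0<..} t2) * J x1 x2 t2 \<partial>lborel)"
      by (intro nn_integral_cong) (simp only: ac_simps)
    also have "\<dots> = (ennreal (1 / t2) * indicator {0<..} t2) * (\<integral>\<^sup>+x1. J x1 x2 t2 \<partial>lborel)"
      by (intro nn_integral_cmult) measurable
    also have "(\<integral>\<^sup>+x1. J x1 x2 t2 \<partial>lborel) = (\<integral>\<^sup>+Y1. h (Y1, (x2, t2)) \<partial>upper)"
      unfolding J_def by (subst nn_integral_upper[OF hs]) simp
    finally show "(\<integral>\<^sup>+x1. ennreal (1 / t2) * J x1 x2 t2 * indicator {0<..} t2 \<partial>lborel) = ennreal (1 / t2) * (\<integral>\<^sup>+Y1. h (Y1, (x2, t2)) \<partial>upper) * indicator {0<..} t2"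
      by (simp only: ac_simps)
  qed
  also have "\<dots> = (\<integral>\<^sup>+Y2. (\<integral>\<^sup>+Y1. h (Y1, Y2) \<partial>upper) \<partial>upper)"
  proof -
    have "(\<lambda>(Y2, Y1). h (Y1, Y2)) \<in> borel_measurable (borel \<Otimes>\<^sub>M upper)"
    proof -
      have "(\<lambda>p. h (snd p, fst p)) \<in> borel_measurable (borel \<Otimes>\<^sub>M borel)"
        unfolding borel_prod by (rule borel_measurable_continuous_compose[OF h]) (intro continuous_intros)
      then show ?thesis by (simp add: split_beta cong: measurable_cong_sets sets_pair_measure_cong)
    qed
    then have "(\<lambda>Y2. \<integral>\<^sup>+Y1. h (Y1, Y2) \<partial>upper) \<in> borel_measurable borel"
      by (rule upper.borel_measurable_nn_integral)
    then show ?thesis by (rule nn_integral_upper[symmetric])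
  qed
  also have "\<dots> = (\<integral>\<^sup>+X. h X \<partial>(upper \<Otimes>\<^sub>M upper))" by (rule nn_integral_upper_pair[OF h, symmetric])
  finally show ?thesis .
qed

section \<open>Borel versions of the kernel and its energy\<close>

lemma AE_lborel_PairD4:
  assumes "AE q in (lborel :: ('a::euclidean_space \<times> 'b::euclidean_space \<times> 'c::euclidean_space \<times> 'd::euclidean_space) measure). P q"
  shows "AE a in lborel. AE b in lborel. AE c in lborel. AE d in lborel. P (a, b, c, d)"
proof -
  have 1: "AE c in lborel. AE d in lborel. P (a, b, c, d)"
    if "AE q in (lborel :: ('c \<times> 'd) measure). P (a, b, q)" for a b
    using AE_lborel_PairD[OF that] .
  have 2: "AE b in lborel. AE c in lborel. AE d in lborel. P (a, b, c, d)"
    if "AE q in (lborel :: ('b \<times> 'c \<times> 'd) measure). P (a, q)" for a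
    using AE_lborel_PairD[OF that] by (rule eventually_mono) (rule 1)
  show ?thesis
    using AE_lborel_PairD[OF assms] by (rule eventually_mono) (rule 2)
qed

text \<open>Integrability is not an issue: the Bochner integral of a function that is not integrable
  is 0 by convention.\<close>

lemma norm_integral_le_nn_integral:
  fixes f :: "'a \<Rightarrow> 'b::{banach, second_countable_topology}"
  shows "ennreal (norm (\<integral>x. f x \<partial>M)) \<le> (\<integral>\<^sup>+x. ennreal (norm (f x)) \<partial>M)"
  by (cases "integrable M f") (auto simp: integral_norm_bound_ennreal not_integrable_integral_eq)

text \<open>Agreement is asked for at positive times only, since joint measurability of the kernel
  says nothing about the others.\<close>

abbreviation borel_version ::
  "(real \<times> real \<times> ((real^'n) \<times> (real^'m)) \<times> ((real^'n) \<times> (real^'m)) \<Rightarrow> complex) \<Rightarrow> ('n::finite, 'm::finite) kernel \<Rightarrow> bool"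
  where "borel_version s' s \<equiv> AE p in lborel. 0 < fst p \<and> 0 < fst (snd p) \<longrightarrow>
    s' p = s (fst p) (fst (snd p)) (fst (snd (snd p))) (snd (snd (snd p)))"

lemma jointly_measurable_ex_borel:
  fixes s :: "('n::finite, 'm::finite) kernel"
  assumes "jointly_measurable s"
  shows "\<exists>s' \<in> borel_measurable borel. borel_version s' s"
proof -
  define D where "D = ({0<..} \<times> {0<..} \<times> UNIV :: (real \<times> real \<times> ((real^'n) \<times> (real^'m)) \<times> ((real^'n) \<times> (real^'m))) set)"
  define f where "f = (\<lambda>(t1, t2, x, y). s t1 t2 x y)"
  have "open D" unfolding D_def by (intro open_Times open_greaterThan open_UNIV)
  then have "D \<in> sets lebesgue" by auto
  moreover have "f \<in> borel_measurable (lebesgue_on D)"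
    using assms unfolding jointly_measurable_def f_def D_def .
  ultimately have "(\<lambda>p. if p \<in> D then f p else 0) \<in> borel_measurable lebesgue"
    by (simp only: borel_measurable_if)
  from lebesgue_measurable_ex_borel[OF this] obtain s' where s': "s' \<in> borel_measurable borel"
    "AE p in lborel. (if p \<in> D then f p else 0) = s' p" by blast
  show ?thesis
  proof (rule bexI[OF _ s'(1)])
    show "borel_version s' s"
      using s'(2) by (rule eventually_mono) (auto simp: D_def f_def)
  qed
qed

text \<open>The function \<open>A\<close> of the overview, for a kernel with uncurried arguments;
  \<open>X\<close> is the pair of \<open>(x1, t1)\<close> and \<open>(x2, t2)\<close>.\<close>

definition energy :: "(real \<times> real \<times> ((real^'n::finite) \<times> (real^'m::finite)) \<times> ((real^'n) \<times> (real^'m)) \<Rightarrow> complex) \<Rightarrow>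
    ((real^'n) \<times> real) \<times> ((real^'m) \<times> real) \<Rightarrow> ennreal" where
  "energy s X = ennreal (snd (fst X) ^ CARD('n) * snd (snd X) ^ CARD('m)) *
     (\<integral>\<^sup>+y. ennreal ((cmod (s (snd (fst X), snd (snd X), (fst (fst X), fst (snd X)), y)))\<^sup>2) \<partial>lborel)"

lemma energy_measurable:
  assumes s: "s \<in> borel_measurable borel"
  shows "energy s \<in> borel_measurable borel"
proof -
  have "(\<lambda>p. s (snd (fst (fst p)), snd (snd (fst p)), (fst (fst (fst p)), fst (snd (fst p))), snd p)) \<in> borel_measurable (borel \<Otimes>\<^sub>M borel)"
    unfolding borel_prod by (rule borel_measurable_continuous_compose[OF s]) (intro continuous_intros)
  then have [measurable]: "(\<lambda>p. s (snd (fst (fst p)), snd (snd (fst p)), (fst (fst (fst p)), fst (snd (fst p))), snd p)) \<in> borel_measurable (borel \<Otimes>\<^sub>M lborel)"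
    by (simp cong: measurable_cong_sets sets_pair_measure_cong)
  have "(\<lambda>X. ennreal (snd (fst X) ^ CARD('a) * snd (snd X) ^ CARD('b))) \<in> borel_measurable (borel :: (((real^'a) \<times> real) \<times> ((real^'b) \<times> real)) measure)"
    by (intro measurable_compose[OF _ measurable_ennreal] borel_measurable_continuous_onI continuous_intros)
  then show ?thesis unfolding energy_def by measurable
qed

text \<open>For almost every frozen \<open>(Y2, y2)\<close>, the Carleson estimate bounds the
  Hilbert-Schmidt norm in the first variable; \<open>hilbert_schmidt_weight\<close> integrates this
  over \<open>y2\<close>.\<close>

lemma energy_carleson1:
  fixes s :: "('n::finite, 'm::finite) kernel"
  assumes s': "s' \<in> borel_measurable borel"
    and ae: "borel_version s' s"
    and b: "0 < \<beta>" and B: "\<And>a l t2 x2 y2. 0 < l \<Longrightarrow> 0 < t2 \<Longrightarrow>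
       carleson_norm a l (\<lambda>t1 x1 y1. s t1 t2 (x1, x2) (y1, y2)) \<le> ennreal (C * size_bound \<beta> t2 x2 y2)"
  shows "\<exists>K\<ge>0. AE Y2 in upper. (\<integral>\<^sup>+Y1. energy s' (Y1, Y2) * ennreal (1 / snd Y1 ^ DIM(real^'n)) \<partial>upper) \<le> ennreal K"
proof -
  define \<kappa> where "\<kappa> = (\<lambda>(Y2 :: (real^'m) \<times> real) (y2 :: real^'m) (Y1 :: (real^'n) \<times> real) (y1 :: real^'n).
    ennreal ((cmod (s' (snd Y1, snd Y2, (fst Y1, fst Y2), (y1, y2))))\<^sup>2))"
  have "AE q in lborel. (\<lambda>p. 0 < fst p \<and> 0 < fst (snd p) \<longrightarrow>
      s' p = s (fst p) (fst (snd p)) (fst (snd (snd p))) (snd (snd (snd p))))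
      ((\<lambda>(Y2, y2, Y1, y1). (snd Y1, snd Y2, (fst Y1, fst Y2), (y1, y2))) q)"
    by (rule AE_lborel_linear[OF ae, where f = "\<lambda>(t1, t2, (x1, x2), (y1, y2)). ((x2, t2), y2, (x1, t1), y1)"])
      (auto intro!: linearI)
  from AE_lborel_PairD4[OF this]
  have ae2: "AE Y2 in lborel. AE y2 in lborel. AE Y1 in lborel. AE y1 in lborel. 0 < snd Y1 \<and> 0 < snd Y2 \<longrightarrow>
      s' (snd Y1, snd Y2, (fst Y1, fst Y2), (y1, y2)) = s (snd Y1) (snd Y2) (fst Y1, fst Y2) (y1, y2)"
    by simp
  have m1: "(\<lambda>p. \<kappa> Y2 y2 (fst p) (snd p)) \<in> borel_measurable borel" for Y2 y2
  proof -
    have [measurable]: "(\<lambda>p. s' (snd (fst p), snd Y2, (fst (fst p), fst Y2), (snd p, y2))) \<in> borel_measurable borel"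
      by (rule borel_measurable_continuous_compose[OF s']) (intro continuous_intros)
    show ?thesis unfolding \<kappa>_def by measurable
  qed
  have m2: "(\<lambda>p. \<kappa> Y2 (fst (fst p)) (snd (fst p)) (snd p)) \<in> borel_measurable ((borel \<Otimes>\<^sub>M borel) \<Otimes>\<^sub>M borel)" for Y2
  proof -
    have [measurable]: "(\<lambda>p. s' (snd (snd (fst p)), snd Y2, (fst (snd (fst p)), fst Y2), (snd p, fst (fst p)))) \<in> borel_measurable borel"
      by (rule borel_measurable_continuous_compose[OF s']) (intro continuous_intros)
    show ?thesis unfolding \<kappa>_def borel_prod by measurable
  qed
  \<comment> \<open>The constant is an arbitrary real, whereas the Hilbert-Schmidt bound squares it
    and requires it to be nonnegative; hence the absolute value.\<close>
  have hs: "AE Y2 in lborel. 0 < snd Y2 \<longrightarrow> (AE y2 in lborel. (\<integral>\<^sup>+Y1. (\<integral>\<^sup>+y1. \<kappa> Y2 y2 Y1 y1 \<partial>lborel) \<partial>upper)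
      \<le> ennreal ((\<bar>C\<bar> * size_bound \<beta> (snd Y2) (fst Y2) y2)\<^sup>2))"
  proof (use ae2 in eventually_elim, intro impI)
    fix Y2 :: "(real^'m) \<times> real"
    assume *: "AE y2 in lborel. AE Y1 in lborel. AE y1 in lborel. 0 < snd Y1 \<and> 0 < snd Y2 \<longrightarrow>
      s' (snd Y1, snd Y2, (fst Y1, fst Y2), (y1, y2)) = s (snd Y1) (snd Y2) (fst Y1, fst Y2) (y1, y2)"
      and t: "0 < snd Y2"
    show "AE y2 in lborel. (\<integral>\<^sup>+Y1. (\<integral>\<^sup>+y1. \<kappa> Y2 y2 Y1 y1 \<partial>lborel) \<partial>upper) \<le> ennreal ((\<bar>C\<bar> * size_bound \<beta> (snd Y2) (fst Y2) y2)\<^sup>2)"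
      using *
    proof (rule eventually_mono)
      fix y2
      assume **: "AE Y1 in lborel. AE y1 in lborel. 0 < snd Y1 \<and> 0 < snd Y2 \<longrightarrow>
        s' (snd Y1, snd Y2, (fst Y1, fst Y2), (y1, y2)) = s (snd Y1) (snd Y2) (fst Y1, fst Y2) (y1, y2)"
      have k: "AE Y in lborel. 0 < snd Y \<longrightarrow> (AE y in lborel.
        ennreal ((cmod (s (snd Y) (snd Y2) (fst Y, fst Y2) (y, y2)))\<^sup>2) = \<kappa> Y2 y2 (fst (Y, y)) (snd (Y, y)))"
        using **
      proof (rule eventually_mono, intro impI)
        fix Y :: "(real^'n) \<times> real"
        assume h: "AE y1 in lborel. 0 < snd Y \<and> 0 < snd Y2 \<longrightarrow>
          s' (snd Y, snd Y2, (fst Y, fst Y2), (y1, y2)) = s (snd Y) (snd Y2) (fst Y, fst Y2) (y1, y2)"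
          and "0 < snd Y"
        show "AE y in lborel. ennreal ((cmod (s (snd Y) (snd Y2) (fst Y, fst Y2) (y, y2)))\<^sup>2) = \<kappa> Y2 y2 (fst (Y, y)) (snd (Y, y))"
          using h by (rule eventually_mono) (simp add: \<kappa>_def t \<open>0 < snd Y\<close>)
      qed
      have "(\<integral>\<^sup>+Y. (\<integral>\<^sup>+y. \<kappa> Y2 y2 (fst (Y, y)) (snd (Y, y)) \<partial>lborel) \<partial>upper) \<le> ennreal ((\<bar>C\<bar> * size_bound \<beta> (snd Y2) (fst Y2) y2)\<^sup>2)"
      proof (rule hilbert_schmidt_of_carleson_norm[OF m1 k])
        fix a and l :: real assume "0 < l"
        have "carleson_norm a l (\<lambda>t1 x1 y1. s t1 (snd Y2) (x1, fst Y2) (y1, y2)) \<le> ennreal (C * size_bound \<beta> (snd Y2) (fst Y2) y2)"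
          using B \<open>0 < l\<close> t by blast
        also have "\<dots> \<le> ennreal (\<bar>C\<bar> * size_bound \<beta> (snd Y2) (fst Y2) y2)"
          by (intro ennreal_leI mult_right_mono size_bound_nonneg) auto
        finally show "carleson_norm a l (\<lambda>t1 x1 y1. s t1 (snd Y2) (x1, fst Y2) (y1, y2)) \<le> ennreal (\<bar>C\<bar> * size_bound \<beta> (snd Y2) (fst Y2) y2)" .
      qed (simp add: size_bound_nonneg)
      then show "(\<integral>\<^sup>+Y1. (\<integral>\<^sup>+y1. \<kappa> Y2 y2 Y1 y1 \<partial>lborel) \<partial>upper) \<le> ennreal ((\<bar>C\<bar> * size_bound \<beta> (snd Y2) (fst Y2) y2)\<^sup>2)"
        by simp
    qed
  qed
  have eq: "energy s' (Y1, Y2) = ennreal (snd Y1 ^ DIM(real^'n) * snd Y2 ^ CARD('m)) * (\<integral>\<^sup>+y2. (\<integral>\<^sup>+y1. \<kappa> Y2 y2 Y1 y1 \<partial>lborel) \<partial>lborel)" for Y1 Y2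
  proof -
    have [measurable]: "(\<lambda>y. s' (snd Y1, snd Y2, (fst Y1, fst Y2), y)) \<in> borel_measurable borel"
      by (rule borel_measurable_continuous_compose[OF s']) (intro continuous_intros)
    have "(\<lambda>y. ennreal ((cmod (s' (snd Y1, snd Y2, (fst Y1, fst Y2), y)))\<^sup>2)) \<in> borel_measurable (lborel \<Otimes>\<^sub>M lborel)"
      unfolding lborel_prod by measurable
    from lborel_pair.nn_integral_snd[OF this] show ?thesis
      by (simp add: energy_def \<kappa>_def lborel_prod)
  qed
  show ?thesis unfolding eq by (rule hilbert_schmidt_weight[OF m2 b _ hs]) simp
qed

text \<open>The previous lemma for the kernel with its two factors interchanged, whose energy is the
  same function up to the order of the arguments.\<close>

lemma energy_carleson2:
  fixes s :: "('n::finite, 'm::finite) kernel"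
  assumes s': "s' \<in> borel_measurable borel"
    and ae: "borel_version s' s"
    and b: "0 < \<alpha>" and B: "\<And>a l t1 x1 y1. 0 < l \<Longrightarrow> 0 < t1 \<Longrightarrow>
       carleson_norm a l (\<lambda>t2 x2 y2. s t1 t2 (x1, x2) (y1, y2)) \<le> ennreal (C * size_bound \<alpha> t1 x1 y1)"
  shows "\<exists>K\<ge>0. AE Y1 in upper. (\<integral>\<^sup>+Y2. energy s' (Y1, Y2) * ennreal (1 / snd Y2 ^ DIM(real^'m)) \<partial>upper) \<le> ennreal K"
proof -
  define \<sigma> where "\<sigma> = (\<lambda>p. s' (fst (snd p), fst p, (snd (fst (snd (snd p))), fst (fst (snd (snd p)))),
    (snd (snd (snd (snd p))), fst (snd (snd (snd p))))))"
  have \<sigma>: "\<sigma> \<in> borel_measurable borel" unfolding \<sigma>_def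
    by (rule borel_measurable_continuous_compose[OF s']) (intro continuous_intros)
  have "AE q in lborel. (\<lambda>p. 0 < fst p \<and> 0 < fst (snd p) \<longrightarrow>
      s' p = s (fst p) (fst (snd p)) (fst (snd (snd p))) (snd (snd (snd p))))
      ((\<lambda>(t2, t1, (x2, x1), (y2, y1)). (t1, t2, (x1, x2), (y1, y2))) q)"
    by (rule AE_lborel_linear[OF ae, where f = "\<lambda>(t1, t2, (x1, x2), (y1, y2)). (t2, t1, (x2, x1), (y2, y1))"])
      (auto intro!: linearI)
  then have ae': "AE p in lborel. 0 < fst p \<and> 0 < fst (snd p) \<longrightarrow>
      \<sigma> p = (\<lambda>t2 t1 x y. s t1 t2 (snd x, fst x) (snd y, fst y)) (fst p) (fst (snd p)) (fst (snd (snd p))) (snd (snd (snd p)))"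
    by (simp add: \<sigma>_def split_beta conj_commute)
  obtain K where K: "0 \<le> K" "AE Y1 in upper. (\<integral>\<^sup>+Y2. energy \<sigma> (Y2, Y1) * ennreal (1 / snd Y2 ^ DIM(real^'m)) \<partial>upper) \<le> ennreal K"
    using energy_carleson1[OF \<sigma> ae' b, of C] B by auto
  have "energy \<sigma> (Y2, Y1) = energy s' (Y1, Y2)" for Y1 :: "(real^'n) \<times> real" and Y2 :: "(real^'m) \<times> real"
  proof -
    have [measurable]: "(\<lambda>y. s' (snd Y1, snd Y2, (fst Y1, fst Y2), y)) \<in> borel_measurable borel"
      by (rule borel_measurable_continuous_compose[OF s']) (intro continuous_intros)
    have m: "(\<lambda>y. ennreal ((cmod (s' (snd Y1, snd Y2, (fst Y1, fst Y2), y)))\<^sup>2)) \<in> borel_measurable (lborel \<Otimes>\<^sub>M lborel)"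
      unfolding lborel_prod by measurable
    have [measurable]: "(\<lambda>y. s' (snd Y1, snd Y2, (fst Y1, fst Y2), (snd y, fst y))) \<in> borel_measurable borel"
      by (rule borel_measurable_continuous_compose[OF s']) (intro continuous_intros)
    have m': "(\<lambda>y. ennreal ((cmod (s' (snd Y1, snd Y2, (fst Y1, fst Y2), (snd y, fst y))))\<^sup>2)) \<in> borel_measurable (lborel \<Otimes>\<^sub>M lborel)"
      unfolding lborel_prod by measurable
    have "(\<integral>\<^sup>+y. ennreal ((cmod (s' (snd Y1, snd Y2, (fst Y1, fst Y2), (snd y, fst y))))\<^sup>2) \<partial>(lborel \<Otimes>\<^sub>M lborel))
      = (\<integral>\<^sup>+y. ennreal ((cmod (s' (snd Y1, snd Y2, (fst Y1, fst Y2), y)))\<^sup>2) \<partial>(lborel \<Otimes>\<^sub>M lborel))"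
      unfolding lborel.nn_integral_fst[OF m', symmetric] lborel_pair.nn_integral_snd[OF m, symmetric] by simp
    then show ?thesis
      by (simp add: energy_def \<sigma>_def split_beta lborel_prod mult.commute)
  qed
  then show ?thesis using K by auto
qed

section \<open>The square function\<close>

text \<open>For almost all frozen \<open>(x, t2, t1)\<close> the two kernels agree at almost every
  \<open>y\<close>, hence \<open>theta\<close> can be computed from the Borel data. The nesting of
  the quantifiers follows the iterated integrals in \<open>square_function\<close>.\<close>

lemma square_function_AE_eq:
  fixes s :: "('n::finite, 'm::finite) kernel"
  assumes s': "s' \<in> borel_measurable borel"
    and ae: "borel_version s' s"
    and f' [measurable]: "f' \<in> borel_measurable borel" and f: "AE y in lborel. f y = f' y"
  shows "AE x in lborel. AE t2 in lborel. AE t1 in lborel. 0 < t1 \<and> 0 < t2 \<longrightarrow>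
      (AE y in lborel. s' (t1, t2, x, y) = s t1 t2 x y) \<and> theta s t1 t2 f x = (\<integral>y. s' (t1, t2, x, y) * f' y \<partial>lborel)"
proof -
  have "AE q in lborel. (\<lambda>p. 0 < fst p \<and> 0 < fst (snd p) \<longrightarrow>
      s' p = s (fst p) (fst (snd p)) (fst (snd (snd p))) (snd (snd (snd p))))
      ((\<lambda>(x, t2, t1, y). (t1, t2, x, y)) q)"
    by (rule AE_lborel_linear[OF ae, where f = "\<lambda>(t1, t2, x, y). (x, t2, t1, y)"]) (auto intro!: linearI)
  from AE_lborel_PairD4[OF this]
  have ae1: "AE x in lborel. AE t2 in lborel. AE t1 in lborel. AE y in lborel. 0 < t1 \<and> 0 < t2 \<longrightarrow> s' (t1, t2, x, y) = s t1 t2 x y"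
    by simp
  have 1: "0 < t1 \<and> 0 < t2 \<longrightarrow>
      (AE y in lborel. s' (t1, t2, x, y) = s t1 t2 x y) \<and> theta s t1 t2 f x = (\<integral>y. s' (t1, t2, x, y) * f' y \<partial>lborel)"
    if h: "AE y in lborel. 0 < t1 \<and> 0 < t2 \<longrightarrow> s' (t1, t2, x, y) = s t1 t2 x y" for t1 t2 x
  proof (intro impI conjI)
    assume t: "0 < t1 \<and> 0 < t2"
    show h': "AE y in lborel. s' (t1, t2, x, y) = s t1 t2 x y"
      using h by (rule eventually_mono) (use t in blast)
    have [measurable]: "(\<lambda>y. s' (t1, t2, x, y)) \<in> borel_measurable borel"
      by (rule borel_measurable_continuous_compose[OF s']) (intro continuous_intros)
    have m: "(\<lambda>y. s' (t1, t2, x, y) * f' y) \<in> borel_measurable lborel" by measurable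
    have "AE y in lborel. s' (t1, t2, x, y) * f' y = s t1 t2 x y * f y"
      using h' f by eventually_elim simp
    then have eq: "AE y in lebesgue. s' (t1, t2, x, y) * f' y = s t1 t2 x y * f y"
      by (rule AE_completion)
    have m': "(\<lambda>y. s' (t1, t2, x, y) * f' y) \<in> borel_measurable lebesgue"
      using m by (rule measurable_completion)
    have "theta s t1 t2 f x = (\<integral>y. s' (t1, t2, x, y) * f' y \<partial>lebesgue)"
      unfolding theta_def using eq borel_measurable_AE[OF m' eq] m'
      by (intro integral_cong_AE) (auto elim: eventually_mono)
    also have "\<dots> = (\<integral>y. s' (t1, t2, x, y) * f' y \<partial>lborel)"
      by (rule integral_completion[OF m])
    finally show "theta s t1 t2 f x = (\<integral>y. s' (t1, t2, x, y) * f' y \<partial>lborel)" .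
  qed
  show ?thesis
    using ae1 by (rule eventually_mono, elim eventually_mono) (rule 1)
qed

lemma square_function_borel:
  fixes s' :: "real \<times> real \<times> ((real^'n::finite) \<times> (real^'m::finite)) \<times> ((real^'n) \<times> (real^'m)) \<Rightarrow> complex"
  assumes s': "s' \<in> borel_measurable borel" and f' [measurable]: "f' \<in> borel_measurable borel"
  shows "(\<lambda>x. \<integral>\<^sup>+t2\<in>{0<..}. (\<integral>\<^sup>+t1\<in>{0<..}. ennreal ((cmod (\<integral>y. s' (t1, t2, x, y) * f' y \<partial>lborel))\<^sup>2 / (t1 * t2)) \<partial>lborel) \<partial>lborel)
    \<in> borel_measurable borel"
proof -
  define \<Theta> where "\<Theta> = (\<lambda>p. \<integral>y. s' (snd p, snd (fst p), fst (fst p), y) * f' y \<partial>(lborel :: ((real^'n) \<times> (real^'m)) measure))"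
  have "(\<lambda>q. s' (snd (fst q), snd (fst (fst q)), fst (fst (fst q)), snd q)) \<in> borel_measurable (((borel \<Otimes>\<^sub>M borel) \<Otimes>\<^sub>M borel) \<Otimes>\<^sub>M borel)"
    unfolding borel_prod by (rule borel_measurable_continuous_compose[OF s']) (intro continuous_intros)
  then have [measurable]: "(\<lambda>q. s' (snd (fst q), snd (fst (fst q)), fst (fst (fst q)), snd q)) \<in> borel_measurable (((borel \<Otimes>\<^sub>M borel) \<Otimes>\<^sub>M borel) \<Otimes>\<^sub>M lborel)"
    by (simp cong: measurable_cong_sets sets_pair_measure_cong)
  have [measurable]: "\<Theta> \<in> borel_measurable ((borel \<Otimes>\<^sub>M borel) \<Otimes>\<^sub>M borel)"
    unfolding \<Theta>_def by measurable
  have "(\<lambda>x. \<integral>\<^sup>+t2\<in>{0<..}. (\<integral>\<^sup>+t1\<in>{0<..}. ennreal ((cmod (\<Theta> ((x, t2), t1)))\<^sup>2 / (t1 * t2)) \<partial>lborel) \<partial>lborel) \<in> borel_measurable borel"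
    by measurable
  then show ?thesis by (simp add: \<Theta>_def)
qed

text \<open>Preimages change by subsets of null sets, which the completion contains. It gives
  measurability of the square function, known only to agree almost everywhere with a Borel
  function.\<close>

lemma measurable_completion_AE_cong:
  assumes f: "f \<in> measurable (completion M) N" and ae: "AE x in completion M. f x = g x"
    and g: "\<And>x. x \<in> space M \<Longrightarrow> g x \<in> space N"
  shows "g \<in> measurable (completion M) N"
proof (rule measurableI)
  fix A assume A: "A \<in> sets N"
  show "g -` A \<inter> space (completion M) \<in> sets (completion M)"
  proof (rule completion.in_sets_AE)
    show "f -` A \<inter> space (completion M) \<in> sets (completion M)" using f A by (rule measurable_sets)
    show "AE x in completion M. (x \<in> f -` A \<inter> space (completion M)) = (x \<in> g -` A \<inter> space (completion M))"
      using ae by eventually_elim auto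
  qed auto
qed (use g in simp)

text \<open>The one-parameter bound in \<open>y2\<close> and then in \<open>y1\<close>, matching the
  order of iteration in \<open>strong_max\<close>. Here \<open>z\<close> is any point of the box
  with centre \<open>x\<close> and radii \<open>t1\<close>, \<open>t2\<close>, as the Carleson
  embedding requires.\<close>

lemma smoothed_le_strong_maximal:
  assumes a: "0 < a" "0 < b"
  shows "\<exists>K\<ge>0. \<forall>F t1 t2 x z. (F :: (real^'n::finite) \<times> (real^'m::finite) \<Rightarrow> ennreal) \<in> borel_measurable borel \<longrightarrow> dist (fst x) (fst z) < t1 \<longrightarrow> dist (snd x) (snd z) < t2 \<longrightarrow>
    (\<integral>\<^sup>+y. ennreal (size_bound a t1 (fst x) (fst y) * size_bound b t2 (snd x) (snd y)) * F y \<partial>lborel)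
      \<le> ennreal K * strong_max F z"
proof -
  obtain Ka where Ka: "0 \<le> Ka" "\<And>(F::real^'n \<Rightarrow> ennreal) t x z. F \<in> borel_measurable borel \<Longrightarrow> 0 < t \<Longrightarrow> dist x z < t \<Longrightarrow>
    (\<integral>\<^sup>+y. ennreal (size_bound a t x y) * F y \<partial>lborel) \<le> ennreal Ka * hl_max F z"
    using size_bound_le_hl_max[OF a(1), where 'n='n] by blast
  obtain Kb where Kb: "0 \<le> Kb" "\<And>(F::real^'m \<Rightarrow> ennreal) t x z. F \<in> borel_measurable borel \<Longrightarrow> 0 < t \<Longrightarrow> dist x z < t \<Longrightarrow>
    (\<integral>\<^sup>+y. ennreal (size_bound b t x y) * F y \<partial>lborel) \<le> ennreal Kb * hl_max F z"
    using size_bound_le_hl_max[OF a(2), where 'n='m] by blast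
  have "(\<integral>\<^sup>+y. ennreal (size_bound a t1 (fst x) (fst y) * size_bound b t2 (snd x) (snd y)) * F y \<partial>lborel)
      \<le> ennreal (Kb * Ka) * strong_max F z"
    if F [measurable]: "F \<in> borel_measurable borel" and d1: "dist (fst x) (fst z) < t1" and d2: "dist (snd x) (snd z) < t2"
    for F :: "(real^'n) \<times> (real^'m) \<Rightarrow> ennreal" and t1 t2 x z
  proof -
    have t: "0 < t1" "0 < t2" using d1 d2 zero_le_dist[of "fst x" "fst z"] zero_le_dist[of "snd x" "snd z"] by linarith+
    have F' [measurable]: "F \<in> borel_measurable (borel \<Otimes>\<^sub>M borel)" by (simp add: borel_prod)
    have F1 [measurable]: "(\<lambda>y2. F (y1, y2)) \<in> borel_measurable borel" for y1
      using measurable_compose[OF measurable_Pair1'[of y1 borel borel] F'] by simp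
    define G where "G = (\<lambda>y1. hl_max (\<lambda>y2. F (y1, y2)) (snd z))"
    have G [measurable]: "G \<in> borel_measurable borel"
      unfolding G_def by (rule hl_max_measurable) (simp_all add: split_beta)
    have "(\<integral>\<^sup>+y. ennreal (size_bound a t1 (fst x) (fst y) * size_bound b t2 (snd x) (snd y)) * F y \<partial>(lborel \<Otimes>\<^sub>M lborel))
      = (\<integral>\<^sup>+y1. (\<integral>\<^sup>+y2. ennreal (size_bound a t1 (fst x) y1 * size_bound b t2 (snd x) y2) * F (y1, y2) \<partial>lborel) \<partial>lborel)"
      by (subst lborel.nn_integral_fst[symmetric]) simp_all
    also have "\<dots> = (\<integral>\<^sup>+y1. ennreal (size_bound a t1 (fst x) y1) * (\<integral>\<^sup>+y2. ennreal (size_bound b t2 (snd x) y2) * F (y1, y2) \<partial>lborel) \<partial>lborel)"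
      by (intro nn_integral_cong, subst nn_integral_cmult[symmetric]) (simp_all add: ennreal_mult size_bound_nonneg mult.assoc)
    also have "\<dots> \<le> (\<integral>\<^sup>+y1. ennreal (size_bound a t1 (fst x) y1) * (ennreal Kb * G y1) \<partial>lborel)"
      unfolding G_def using t d2 by (intro nn_integral_mono mult_left_mono Kb F1) auto
    also have "\<dots> = ennreal Kb * (\<integral>\<^sup>+y1. ennreal (size_bound a t1 (fst x) y1) * G y1 \<partial>lborel)"
      by (subst nn_integral_cmult[symmetric]) (simp_all add: mult.left_commute)
    also have "\<dots> \<le> ennreal Kb * (ennreal Ka * hl_max G (fst z))"
      using t d1 by (intro mult_left_mono Ka G) auto
    finally show ?thesis
      using Ka(1) Kb(1) by (simp add: lborel_prod G_def ennreal_mult mult.assoc)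
  qed
  moreover have "0 \<le> Kb * Ka" using Ka(1) Kb(1) by simp
  ultimately show ?thesis by blast
qed

theorem corollary1p3:
  fixes s :: "('n::finite, 'm::finite) kernel"
    and \<alpha> \<beta> p :: real
  assumes "\<alpha> > 0" and "\<beta> > 0"
    and "jointly_measurable s"
    and "standard_estimates \<alpha> \<beta> s"
    and "carleson_standard_estimates \<alpha> \<beta> s"
    and "biparameter_carleson s"
    and "1 < p" and "p < 2"
  shows "bounded_on_Lp (square_function s) p"
proof -
  note \<alpha> = assms(1) and \<beta> = assms(2) and p = assms(7,8)
  obtain s' where s': "s' \<in> borel_measurable borel" and ae: "borel_version s' s"
    using jointly_measurable_ex_borel[OF assms(3)] by (rule bexE)
  obtain C0 where "\<forall>t1>0. \<forall>t2>0. \<forall>x1 x2 y1 y2.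
      cmod (s t1 t2 (x1, x2) (y1, y2)) \<le> C0 * (size_bound \<alpha> t1 x1 y1 * size_bound \<beta> t2 x2 y2)"
    using assms(4)[unfolded standard_estimates_def, THEN conjunct1] by (rule exE)
  note C0 = this[rule_format]
  obtain C1 where "\<forall>a. \<forall>l>0. \<forall>t2>0. \<forall>x2 y2.
       carleson_norm a l (\<lambda>t1 x1 y1. s t1 t2 (x1, x2) (y1, y2)) \<le> ennreal (C1 * size_bound \<beta> t2 x2 y2)"
    using assms(5)[unfolded carleson_standard_estimates_def, THEN conjunct1] by (rule exE)
  note C1 = this[rule_format]
  obtain C2 where "\<forall>a. \<forall>l>0. \<forall>t1>0. \<forall>x1 y1.
       carleson_norm a l (\<lambda>t2 x2 y2. s t1 t2 (x1, x2) (y1, y2)) \<le> ennreal (C2 * size_bound \<alpha> t1 x1 y1)"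
    using assms(5)[unfolded carleson_standard_estimates_def, THEN conjunct2, THEN conjunct1] by (rule exE)
  note C2 = this[rule_format]
  have "\<exists>K\<ge>0. AE Y2 in upper. (\<integral>\<^sup>+Y1. energy s' (Y1, Y2) * ennreal (1 / snd Y1 ^ DIM(real^'n)) \<partial>upper) \<le> ennreal K"
    by (rule energy_carleson1[OF s' ae \<beta>]) (rule C1)
  then obtain H1 where H1: "0 \<le> H1" "AE Y2 in upper. (\<integral>\<^sup>+Y1. energy s' (Y1, Y2) * ennreal (1 / snd Y1 ^ DIM(real^'n)) \<partial>upper) \<le> ennreal H1"
    by (elim exE conjE)
  have "\<exists>K\<ge>0. AE Y1 in upper. (\<integral>\<^sup>+Y2. energy s' (Y1, Y2) * ennreal (1 / snd Y2 ^ DIM(real^'m)) \<partial>upper) \<le> ennreal K"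
    by (rule energy_carleson2[OF s' ae \<alpha>]) (rule C2)
  then obtain H2 where H2: "0 \<le> H2" "AE Y1 in upper. (\<integral>\<^sup>+Y2. energy s' (Y1, Y2) * ennreal (1 / snd Y2 ^ DIM(real^'m)) \<partial>upper) \<le> ennreal H2"
    by (elim exE conjE)
  \<comment> \<open>Three constraints on \<open>r = 1 + d\<close>: half of \<open>p - 1\<close>
    keeps \<open>r\<close> below \<open>p\<close>, and the other two bounds are the conditions of
    \<open>size_bound_power_le\<close> in each variable.\<close>
  define d where "d = min ((p - 1) / 2) (min (\<alpha> / 2 / (CARD('n) + \<alpha>)) (\<beta> / 2 / (CARD('m) + \<beta>)))"
  have d: "0 < d" "d < p - 1" "d \<le> \<alpha> / 2 / (CARD('n) + \<alpha>)" "d \<le> \<beta> / 2 / (CARD('m) + \<beta>)"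
    using p \<alpha> \<beta> by (auto simp: d_def min_less_iff_disj add_pos_pos)
  define r where "r = 1 + d"
  have r: "1 < r" "r < p" "r < 2" using d p by (auto simp: r_def)
  have le: "(N + a) * (r - 1) \<le> a / 2" if "0 \<le> N" "0 < a" "d \<le> a / 2 / (N + a)" for N a :: real
  proof -
    have "0 < N + a" using that by simp
    then have "d * (N + a) \<le> a / 2" using that(3) by (simp only: pos_le_divide_eq)
    moreover have "r - 1 = d" by (simp add: r_def)
    ultimately show ?thesis by (simp only: mult.commute)
  qed
  have r1: "(CARD('n) + \<alpha>) * (r - 1) \<le> \<alpha> / 2" and r2: "(CARD('m) + \<beta>) * (r - 1) \<le> \<beta> / 2"
    by (rule le[OF _ \<alpha> d(3)], simp) (rule le[OF _ \<beta> d(4)], simp)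
  define q where "q = p / r"
  have q: "1 < q" using r by (simp add: q_def)
  \<comment> \<open>The exponent \<open>1 - 1 / r\<close> of the energy in Hoelder's inequality,
    doubled by squaring; \<open>r < 2\<close> makes it less than 1.\<close>
  define e where "e = 2 * (1 - 1 / r)"
  have e: "0 < e" "e < 1" using r by (auto simp: e_def field_simps)
  define c where "c = \<bar>C0\<bar>"
  have c: "0 \<le> c" by (simp add: c_def)
  note [measurable] = energy_measurable[OF s']
  obtain Kc where Kc: "0 \<le> Kc" "\<And>P H. P \<in> borel_measurable borel \<Longrightarrow> H \<in> borel_measurable borel \<Longrightarrow>
    (\<And>X z. dist (fst (fst X)) (fst z) < snd (fst X) \<Longrightarrow> dist (fst (snd X)) (snd z) < snd (snd X) \<Longrightarrow> P X \<le> H z) \<Longrightarrow>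
    (\<integral>\<^sup>+X. epowr (energy s' X) e * epowr (P X) q \<partial>(upper \<Otimes>\<^sub>M upper)) \<le> ennreal Kc * (\<integral>\<^sup>+z. epowr (H z) q \<partial>lborel)"
  proof -
    have 1: "AE Y2 in upper. (\<integral>\<^sup>+Y1. energy s' (Y1, Y2) * ennreal (1 / snd Y1 ^ DIM(real^'n)) \<partial>upper) \<le> ennreal (H1 + H2)"
      using H1(2) by (rule eventually_mono) (use H2(1) in \<open>auto elim!: order_trans intro: ennreal_leI simp del: ennreal_plus\<close>)
    have 2: "AE Y1 in upper. (\<integral>\<^sup>+Y2. energy s' (Y1, Y2) * ennreal (1 / snd Y2 ^ DIM(real^'m)) \<partial>upper) \<le> ennreal (H1 + H2)"
      using H2(2) by (rule eventually_mono) (use H1(1) in \<open>auto elim!: order_trans intro: ennreal_leI simp del: ennreal_plus\<close>)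
    have "0 \<le> H1 + H2" "0 < q" using H1(1) H2(1) q by auto
    from carleson_embedding[OF energy_measurable[OF s'] e this 1 2] obtain K where "0 \<le> K \<and> (\<forall>P H. P \<in> borel_measurable borel \<longrightarrow> H \<in> borel_measurable borel \<longrightarrow>
      (\<forall>X z. dist (fst (fst X)) (fst z) < snd (fst X) \<longrightarrow> dist (fst (snd X)) (snd z) < snd (snd X) \<longrightarrow> P X \<le> H z) \<longrightarrow>
      (\<integral>\<^sup>+X. epowr (energy s' X) e * epowr (P X) q \<partial>(upper \<Otimes>\<^sub>M upper)) \<le> ennreal K * (\<integral>\<^sup>+z. epowr (H z) q \<partial>lborel))"
      by (rule exE)
    then show thesis by (intro that[of K]) blast+
  qed
  obtain Ks where Ks: "0 \<le> Ks" "\<And>F :: (real^'n) \<times> (real^'m) \<Rightarrow> ennreal. F \<in> borel_measurable borel \<Longrightarrow>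
    (\<lambda>z. strong_max F z) \<in> borel_measurable borel"
    "\<And>F :: (real^'n) \<times> (real^'m) \<Rightarrow> ennreal. F \<in> borel_measurable borel \<Longrightarrow>
    (\<integral>\<^sup>+z. epowr (strong_max F z) q \<partial>lborel) \<le> ennreal Ks * (\<integral>\<^sup>+z. epowr (F z) q \<partial>lborel)"
    using strong_maximal[OF q, where 'a="real^'n" and 'b="real^'m"] by blast
  have "0 < \<alpha> / 2" "0 < \<beta> / 2" using \<alpha> \<beta> by auto
  then obtain Km where Km: "0 \<le> Km" "\<And>(F :: (real^'n) \<times> (real^'m) \<Rightarrow> ennreal) t1 t2 x z. F \<in> borel_measurable borel \<Longrightarrow> dist (fst x) (fst z) < t1 \<Longrightarrow> dist (snd x) (snd z) < t2 \<Longrightarrow>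
    (\<integral>\<^sup>+y. ennreal (size_bound (\<alpha> / 2) t1 (fst x) (fst y) * size_bound (\<beta> / 2) t2 (snd x) (snd y)) * F y \<partial>lborel)
      \<le> ennreal Km * strong_max F z"
    using smoothed_le_strong_maximal by blast
  \<comment> \<open>The factor 2 and the power of \<open>c\<close> in
    \<open>kernel_integral_le\<close>, both squared.\<close>
  define c2 where "c2 = 4 * (c powr (2 - r)) powr (2 / r)"
  have c2: "0 \<le> c2" by (simp add: c2_def)
  \<comment> \<open>The power of \<open>c2\<close> arises on raising \<open>S\<close> to
    \<open>p / 2\<close>, the two summands of \<open>1 + Kc\<close> belong to \<open>H\<close> and
    \<open>W\<close>, and the last factor passes from \<open>H\<close> to the strong maximal
    function and on to \<open>f\<close>.\<close>
  define K where "K = c2 powr (p / 2) * ((1 + Kc) * (Km powr q * Ks))"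
  have main: "square_function s f \<in> borel_measurable lebesgue \<and>
      (\<integral>\<^sup>+x. epowr (square_function s f x) p \<partial>lebesgue) \<le> ennreal K * (\<integral>\<^sup>+x. epowr (ennreal (cmod (f x))) p \<partial>lebesgue)"
    if f: "f \<in> borel_measurable lebesgue" for f
  proof
    obtain f' where f' [measurable]: "f' \<in> borel_measurable borel" and ff': "AE y in lborel. f y = f' y"
      using lebesgue_measurable_ex_borel[OF f] by blast
    let ?T = "\<lambda>t1 t2 x. \<integral>y. s' (t1, t2, x, y) * f' y \<partial>lborel"
    let ?ok = "\<lambda>t1 t2 x. 0 < t1 \<and> 0 < t2 \<longrightarrow> (AE y in lborel. s' (t1, t2, x, y) = s t1 t2 x y) \<and> theta s t1 t2 f x = ?T t1 t2 x"
    define F where "F = (\<lambda>y. ennreal (cmod (f' y) powr r))"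
    have F [measurable]: "F \<in> borel_measurable borel" unfolding F_def by measurable
    \<comment> \<open>The constant \<open>Km\<close> is absorbed here because the Carleson embedding
      expects \<open>P X \<le> H z\<close> without a factor.\<close>
    define H where "H = (\<lambda>z. ennreal Km * strong_max F z)"
    have H [measurable]: "H \<in> borel_measurable borel"
      unfolding H_def using Ks(2)[OF F] by (intro borel_measurable_times_ennreal) auto
    define P where "P = (\<lambda>X :: ((real^'n) \<times> real) \<times> ((real^'m) \<times> real). \<integral>\<^sup>+y. ennreal (size_bound (\<alpha> / 2) (snd (fst X)) (fst (fst X)) (fst y) * size_bound (\<beta> / 2) (snd (snd X)) (fst (snd X)) (snd y)) * F y \<partial>lborel)"
    have P [measurable]: "P \<in> borel_measurable borel" unfolding P_def by measurable
    have PH: "P X \<le> H z" if "dist (fst (fst X)) (fst z) < snd (fst X)" "dist (fst (snd X)) (snd z) < snd (snd X)" for X z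
      unfolding P_def H_def using Km(2)[OF F, of "(fst (fst X), fst (snd X))" z] that by simp
    define h where "h = (\<lambda>X. epowr (energy s' X) e * epowr (P X) q)"
    have h [measurable]: "h \<in> borel_measurable borel" unfolding h_def by measurable
    define W where "W = (\<lambda>x. \<integral>\<^sup>+t2\<in>{0<..}. (\<integral>\<^sup>+t1\<in>{0<..}. ennreal (1 / (t1 * t2)) * h ((fst x, t1), (snd x, t2)) \<partial>lborel) \<partial>lborel)"
    have intW: "(\<integral>\<^sup>+x. W x \<partial>lborel) \<le> ennreal Kc * (\<integral>\<^sup>+z. epowr (H z) q \<partial>lborel)"
      unfolding W_def nn_integral_upper_pair_eq[OF h] unfolding h_def by (rule Kc(2)[OF P H PH])
    define S where "S = (\<lambda>x. \<integral>\<^sup>+t2\<in>{0<..}. (\<integral>\<^sup>+t1\<in>{0<..}. ennreal ((cmod (?T t1 t2 x))\<^sup>2 / (t1 * t2)) \<partial>lborel) \<partial>lborel)"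
    have S [measurable]: "S \<in> borel_measurable borel"
      unfolding S_def by (rule square_function_borel[OF s' f'])
    have hx: "(\<lambda>(t2, t1). ennreal (1 / (t1 * t2)) * h ((fst x, t1), (snd x, t2))) \<in> borel_measurable (borel \<Otimes>\<^sub>M borel)" for x
    proof -
      have "(\<lambda>p. h ((fst x, snd p), (snd x, fst p))) \<in> borel_measurable (borel \<Otimes>\<^sub>M borel)"
        unfolding borel_prod by (rule borel_measurable_continuous_compose[OF h]) (intro continuous_intros)
      then show ?thesis by (simp add: split_beta)
    qed
    have pt: "ennreal ((cmod (?T t1 t2 x))\<^sup>2 / (t1 * t2))
        \<le> (ennreal c2 * epowr (H x) ((2 - p) / r)) * (ennreal (1 / (t1 * t2)) * h ((fst x, t1), (snd x, t2)))"
      if t: "0 < t1" "0 < t2" and eq: "AE y in lborel. s' (t1, t2, x, y) = s t1 t2 x y" for t1 t2 x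
    proof -
      let ?X = "((fst x, t1), (snd x, t2))"
      have \<sigma> [measurable]: "(\<lambda>y. s' (t1, t2, x, y)) \<in> borel_measurable borel"
        by (rule borel_measurable_continuous_compose[OF s']) (intro continuous_intros)
      have bd: "AE y in lborel. cmod (s' (t1, t2, x, y)) \<le> c * (size_bound \<alpha> t1 (fst x) (fst y) * size_bound \<beta> t2 (snd x) (snd y))"
        using eq
      proof (rule eventually_mono)
        fix y assume "s' (t1, t2, x, y) = s t1 t2 x y"
        then have "cmod (s' (t1, t2, x, y)) \<le> C0 * (size_bound \<alpha> t1 (fst x) (fst y) * size_bound \<beta> t2 (snd x) (snd y))"
          using C0[OF t, of "fst x" "snd x" "fst y" "snd y"] by simp
        also have "\<dots> \<le> c * (size_bound \<alpha> t1 (fst x) (fst y) * size_bound \<beta> t2 (snd x) (snd y))"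
          unfolding c_def by (intro mult_right_mono mult_nonneg_nonneg size_bound_nonneg) auto
        finally show "cmod (s' (t1, t2, x, y)) \<le> c * (size_bound \<alpha> t1 (fst x) (fst y) * size_bound \<beta> t2 (snd x) (snd y))" .
      qed
      have "ennreal (cmod (?T t1 t2 x)) \<le> (\<integral>\<^sup>+y. ennreal (cmod (s' (t1, t2, x, y) * f' y)) \<partial>lborel)"
        by (rule norm_integral_le_nn_integral)
      also have "\<dots> \<le> 2 * (epowr (energy s' ?X) (1 - 1 / r) * epowr (ennreal (c powr (2 - r)) * P ?X) (1 / r))"
        using kernel_integral_le[OF \<sigma> f' \<alpha> \<beta> r(1,3) t c r1 r2 bd] by (simp add: energy_def P_def F_def)
      finally have "(ennreal (cmod (?T t1 t2 x)))\<^sup>2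
        \<le> (2 * (epowr (energy s' ?X) (1 - 1 / r) * epowr (ennreal (c powr (2 - r)) * P ?X) (1 / r)))\<^sup>2"
        by (rule power_mono) simp
      also have "\<dots> = ennreal c2 * (epowr (energy s' ?X) e * epowr (P ?X) (2 / r))"
      proof -
        have 1: "(epowr (energy s' ?X) (1 - 1 / r))\<^sup>2 = epowr (energy s' ?X) e"
          unfolding epowr_two[symmetric] epowr_epowr e_def by (simp add: mult.commute)
        have 2: "(epowr (ennreal (c powr (2 - r)) * P ?X) (1 / r))\<^sup>2 = ennreal ((c powr (2 - r)) powr (2 / r)) * epowr (P ?X) (2 / r)"
          unfolding epowr_two[symmetric] epowr_epowr by (simp add: epowr_mult epowr_ennreal)
        have 3: "ennreal c2 = 4 * ennreal ((c powr (2 - r)) powr (2 / r))"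
          unfolding c2_def by (simp add: ennreal_mult)
        show ?thesis unfolding power_mult_distrib 1 2 3 by (simp add: ac_simps)
      qed
      \<comment> \<open>The power \<open>q = p / r\<close> is reserved for the Carleson embedding.
        The remaining exponent \<open>(2 - p) / r\<close> is positive because \<open>p < 2\<close>,
        and that factor is bounded by \<open>H\<close> at the centre \<open>x\<close> of the box, so
        it leaves the integral over \<open>t\<close>.\<close>
      also have "epowr (P ?X) (2 / r) = epowr (P ?X) q * epowr (P ?X) ((2 - p) / r)"
      proof -
        have "2 / r = q + (2 - p) / r" by (simp add: q_def diff_divide_distrib)
        then show ?thesis using q p r by (simp add: epowr_add)
      qed
      also have "ennreal c2 * (epowr (energy s' ?X) e * (epowr (P ?X) q * epowr (P ?X) ((2 - p) / r)))
        \<le> ennreal c2 * (epowr (energy s' ?X) e * (epowr (P ?X) q * epowr (H x) ((2 - p) / r)))"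
        using t p r by (intro mult_left_mono epowr_mono PH) auto
      finally have *: "(ennreal (cmod (?T t1 t2 x)))\<^sup>2
        \<le> ennreal c2 * (epowr (energy s' ?X) e * (epowr (P ?X) q * epowr (H x) ((2 - p) / r)))" .
      have "ennreal ((cmod (?T t1 t2 x))\<^sup>2 / (t1 * t2))
        = ennreal (1 / (t1 * t2)) * (ennreal (cmod (?T t1 t2 x)))\<^sup>2"
        using t by (simp add: ennreal_power flip: ennreal_mult)
      also have "\<dots> \<le> ennreal (1 / (t1 * t2)) * (ennreal c2 * (epowr (energy s' ?X) e * (epowr (P ?X) q * epowr (H x) ((2 - p) / r))))"
        by (intro mult_left_mono *) auto
      finally show ?thesis by (simp add: h_def ac_simps)
    qed
    note aes = square_function_AE_eq[OF s' ae f' ff']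
    have sq: "AE x in lborel. square_function s f x = epowr (S x) (1 / 2)"
      using aes
    proof (rule eventually_mono)
      fix x :: "(real^'n) \<times> (real^'m)"
      assume *: "AE t2 in lborel. AE t1 in lborel. ?ok t1 t2 x"
      have "(\<integral>\<^sup>+t2\<in>{0<..}. (\<integral>\<^sup>+t1\<in>{0<..}. ennreal ((cmod (theta s t1 t2 f x))\<^sup>2 / (t1 * t2)) \<partial>lborel) \<partial>lborel) = S x"
        unfolding S_def
      proof (rule nn_integral_cong_AE, use * in eventually_elim)
        fix t2 :: real
        assume **: "AE t1 in lborel. ?ok t1 t2 x"
        show "(\<integral>\<^sup>+t1\<in>{0<..}. ennreal ((cmod (theta s t1 t2 f x))\<^sup>2 / (t1 * t2)) \<partial>lborel) * indicator {0<..} t2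
          = (\<integral>\<^sup>+t1\<in>{0<..}. ennreal ((cmod (?T t1 t2 x))\<^sup>2 / (t1 * t2)) \<partial>lborel) * indicator {0<..} t2"
        proof (cases "0 < t2")
          case True
          have "(\<integral>\<^sup>+t1\<in>{0<..}. ennreal ((cmod (theta s t1 t2 f x))\<^sup>2 / (t1 * t2)) \<partial>lborel)
            = (\<integral>\<^sup>+t1\<in>{0<..}. ennreal ((cmod (?T t1 t2 x))\<^sup>2 / (t1 * t2)) \<partial>lborel)"
          proof (rule nn_integral_cong_AE, rule eventually_mono[OF **])
            fix t1 :: real
            assume "?ok t1 t2 x"
            then show "ennreal ((cmod (theta s t1 t2 f x))\<^sup>2 / (t1 * t2)) * indicator {0<..} t1
              = ennreal ((cmod (?T t1 t2 x))\<^sup>2 / (t1 * t2)) * indicator {0<..} t1"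
              using True by (cases "0 < t1") simp_all
          qed
          then show ?thesis by simp
        qed simp
      qed
      then show "square_function s f x = epowr (S x) (1 / 2)"
        by (simp add: square_function_def nn_integral_completion)
    qed
    have SW: "AE x in lborel. S x \<le> ennreal c2 * epowr (H x) ((2 - p) / r) * W x"
      using aes
    proof (rule eventually_mono)
      fix x :: "(real^'n) \<times> (real^'m)"
      assume *: "AE t2 in lborel. AE t1 in lborel. ?ok t1 t2 x"
      let ?k = "ennreal c2 * epowr (H x) ((2 - p) / r)"
      let ?u = "\<lambda>t2 t1. ennreal (1 / (t1 * t2)) * h ((fst x, t1), (snd x, t2)) * indicator {0<..} t1"
      have u: "(\<lambda>(t2, t1). ?u t2 t1) \<in> borel_measurable (borel \<Otimes>\<^sub>M borel)"
        using hx[of x] by (simp add: split_beta)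
      have u1 [measurable]: "?u t2 \<in> borel_measurable borel" for t2
        using measurable_compose[OF measurable_Pair1'[of t2 borel borel] u] by simp
      have u2 [measurable]: "(\<lambda>t2. \<integral>\<^sup>+t1. ?u t2 t1 \<partial>lborel) \<in> borel_measurable borel"
        using u by (intro lborel.borel_measurable_nn_integral) (simp cong: measurable_cong_sets sets_pair_measure_cong)
      have "S x \<le> (\<integral>\<^sup>+t2. ?k * ((\<integral>\<^sup>+t1. ?u t2 t1 \<partial>lborel) * indicator {0<..} t2) \<partial>lborel)"
        unfolding S_def
      proof (rule nn_integral_mono_AE, rule eventually_mono[OF *])
        fix t2 :: real
        assume **: "AE t1 in lborel. ?ok t1 t2 x"
        show "(\<integral>\<^sup>+t1\<in>{0<..}. ennreal ((cmod (?T t1 t2 x))\<^sup>2 / (t1 * t2)) \<partial>lborel) * indicator {0<..} t2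
          \<le> ?k * ((\<integral>\<^sup>+t1. ?u t2 t1 \<partial>lborel) * indicator {0<..} t2)"
        proof (cases "0 < t2")
          case True
          have "(\<integral>\<^sup>+t1\<in>{0<..}. ennreal ((cmod (?T t1 t2 x))\<^sup>2 / (t1 * t2)) \<partial>lborel)
            \<le> (\<integral>\<^sup>+t1. ?k * ?u t2 t1 \<partial>lborel)"
          proof (rule nn_integral_mono_AE, rule eventually_mono[OF **])
            fix t1 :: real
            assume "?ok t1 t2 x"
            then show "ennreal ((cmod (?T t1 t2 x))\<^sup>2 / (t1 * t2)) * indicator {0<..} t1 \<le> ?k * ?u t2 t1"
              using True pt[of t1 t2 x] by (cases "0 < t1") simp_all
          qed
          also have "\<dots> = ?k * (\<integral>\<^sup>+t1. ?u t2 t1 \<partial>lborel)" by (intro nn_integral_cmult) measurable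
          finally show ?thesis using True by simp
        qed simp
      qed
      also have "\<dots> = ?k * W x"
        unfolding W_def by (intro nn_integral_cmult) measurable
      finally show "S x \<le> ?k * W x" .
    qed
    have Gp: "AE x in lborel. epowr (square_function s f x) p \<le> ennreal (c2 powr (p / 2)) * (epowr (H x) q + W x)"
      using sq SW
    proof eventually_elim
      fix x :: "(real^'n) \<times> (real^'m)"
      assume 1: "square_function s f x = epowr (S x) (1 / 2)" and 2: "S x \<le> ennreal c2 * epowr (H x) ((2 - p) / r) * W x"
      have "epowr (square_function s f x) p = epowr (S x) (p / 2)" by (simp add: 1 epowr_epowr)
      also have "\<dots> \<le> epowr (ennreal c2 * epowr (H x) ((2 - p) / r) * W x) (p / 2)"
        using p by (intro epowr_mono 2) auto
      \<comment> \<open>The exponent of \<open>H x\<close> becomes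
        \<open>(2 - p) / r * (p / 2) = q * (1 - p / 2)\<close>. The weights \<open>1 - p / 2\<close>
        and \<open>p / 2\<close> add up to 1, so the product is a weighted geometric mean of
        \<open>epowr (H x) q\<close> and \<open>W x\<close>.\<close>
      also have "\<dots> = ennreal (c2 powr (p / 2)) * (epowr (epowr (H x) q) (1 - p / 2) * epowr (W x) (p / 2))"
      proof -
        have "(2 - p) / r * (p / 2) = q * (1 - p / 2)" using r by (simp add: q_def field_simps)
        then show ?thesis using c2 by (simp only: epowr_mult epowr_epowr epowr_ennreal mult.assoc)
      qed
      also have "\<dots> \<le> ennreal (c2 powr (p / 2)) * (epowr (H x) q + W x)"
        using p by (intro mult_left_mono order_trans[OF epowr_interpolate_le]) (auto simp: add_increasing add_increasing2)
      finally show "epowr (square_function s f x) p \<le> ennreal (c2 powr (p / 2)) * (epowr (H x) q + W x)" .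
    qed
    have Se: "AE x in lebesgue. epowr (S x) (1 / 2) = square_function s f x"
      using AE_completion[OF sq] by (rule eventually_mono) simp
    have "(\<lambda>x. epowr (S x) (1 / 2)) \<in> borel_measurable lborel" by measurable
    then have "(\<lambda>x. epowr (S x) (1 / 2)) \<in> borel_measurable lebesgue"
      by (rule measurable_completion)
    then show "square_function s f \<in> borel_measurable lebesgue"
      using Se by (rule measurable_completion_AE_cong) simp
    have W [measurable]: "W \<in> borel_measurable borel"
    proof -
      have "(\<lambda>p. h ((fst (fst (fst p)), snd p), (snd (fst (fst p)), snd (fst p)))) \<in> borel_measurable ((borel \<Otimes>\<^sub>M borel) \<Otimes>\<^sub>M borel)"
        unfolding borel_prod by (rule borel_measurable_continuous_compose[OF h]) (intro continuous_intros)
      then show ?thesis unfolding W_def by measurable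
    qed
    have "(\<integral>\<^sup>+x. epowr (square_function s f x) p \<partial>lebesgue) \<le> (\<integral>\<^sup>+x. ennreal (c2 powr (p / 2)) * (epowr (H x) q + W x) \<partial>lborel)"
      unfolding nn_integral_completion by (rule nn_integral_mono_AE[OF Gp])
    also have "\<dots> = ennreal (c2 powr (p / 2)) * ((\<integral>\<^sup>+x. epowr (H x) q \<partial>lborel) + (\<integral>\<^sup>+x. W x \<partial>lborel))"
      by (simp add: nn_integral_cmult nn_integral_add)
    also have "\<dots> \<le> ennreal (c2 powr (p / 2)) * ((\<integral>\<^sup>+x. epowr (H x) q \<partial>lborel) + ennreal Kc * (\<integral>\<^sup>+x. epowr (H x) q \<partial>lborel))"
      by (intro mult_left_mono add_left_mono intW) auto
    also have "\<dots> = ennreal (c2 powr (p / 2)) * (ennreal (1 + Kc) * (\<integral>\<^sup>+x. epowr (H x) q \<partial>lborel))"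
      using Kc(1) by (simp add: distrib_right)
    also have "(\<integral>\<^sup>+x. epowr (H x) q \<partial>lborel) = ennreal (Km powr q) * (\<integral>\<^sup>+z. epowr (strong_max F z) q \<partial>lborel)"
      using Km(1) Ks(2)[OF F] by (simp add: H_def epowr_mult epowr_ennreal nn_integral_cmult)
    also have "ennreal (c2 powr (p / 2)) * (ennreal (1 + Kc) * \<dots>)
      \<le> ennreal (c2 powr (p / 2)) * (ennreal (1 + Kc) * (ennreal (Km powr q) * (ennreal Ks * (\<integral>\<^sup>+z. epowr (F z) q \<partial>lborel))))"
      by (intro mult_left_mono Ks(3) F) auto
    also have "\<dots> = ennreal K * (\<integral>\<^sup>+z. epowr (F z) q \<partial>lborel)"
      using Kc(1) Ks(1) by (simp add: K_def ennreal_mult mult.assoc del: ennreal_plus)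
    also have "(\<integral>\<^sup>+z. epowr (F z) q \<partial>lborel) = (\<integral>\<^sup>+x. epowr (ennreal (cmod (f x))) p \<partial>lebesgue)"
      unfolding nn_integral_completion
    proof (rule nn_integral_cong_AE, rule eventually_mono[OF ff'])
      fix x assume "f x = f' x"
      then show "epowr (F x) q = epowr (ennreal (cmod (f x))) p"
        using r by (simp add: F_def epowr_ennreal powr_powr q_def)
    qed
    finally show "(\<integral>\<^sup>+x. epowr (square_function s f x) p \<partial>lebesgue) \<le> ennreal K * (\<integral>\<^sup>+x. epowr (ennreal (cmod (f x))) p \<partial>lebesgue)" .
  qed
  have K: "0 \<le> K" using c2 Kc(1) Ks(1) by (simp add: K_def)
  show ?thesis unfolding bounded_on_Lp_def
  proof (intro exI[of _ "K powr (1 / p)"] allI impI conjI)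
    fix f :: "(real^'n) \<times> (real^'m) \<Rightarrow> complex"
    assume f: "f \<in> borel_measurable lebesgue"
    show "square_function s f \<in> borel_measurable lebesgue" using main[OF f] by blast
    have "eLp_norm p (square_function s f) \<le> epowr (ennreal K * (\<integral>\<^sup>+x. epowr (ennreal (cmod (f x))) p \<partial>lebesgue)) (1 / p)"
      unfolding eLp_norm_def using main[OF f] p by (intro epowr_mono) auto
    also have "\<dots> = ennreal (K powr (1 / p)) * eLp_norm p (\<lambda>x. ennreal (cmod (f x)))"
      using K by (simp add: epowr_mult epowr_ennreal eLp_norm_def)
    finally show "eLp_norm p (square_function s f) \<le> ennreal (K powr (1 / p)) * eLp_norm p (\<lambda>x. ennreal (cmod (f x)))" .
  qed
qed

end
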